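(* Let $n\ge 1$, $N\ge 2$, and let $\phi$ be a strictly local communication kernel of range $r_0>0$ on $\mathbb{T}^n$ (as defined in the context). Then for Lebesgue-almost every initial datum $(\mathbf{x}_0,\mathbf{v}_0)\in\mathbb{T}^{nN}\times\mathbb{R}^{nN}$, the solution $(\mathbf{x}(t),\mathbf{v}(t))$ of the Cucker-Smale system $$\dot x_i=v_i,\qquad \dot v_i=\frac1N\sum_{j=1}^N\phi(x_i-x_j)(v_j-v_i),\qquad i=1,\dots,N,$$ starting from $(\mathbf{x}_0,\mathbf{v}_0)$ contains a pair of agents that align, i.e. there exist $i\neq j$ such that $|v_i(t)-v_j(t)|\to 0$ as $t\to\infty$. Consequently, if $N=2$, then for almost every $(\mathbf{x}_0,\mathbf{v}_0)\in\mathbb{T}^{2n}\times\mathbb{R}^{2n}$ one has $|v_1(t)-v_2(t)|\to0$ as $t\to\infty$.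
   Context: $\mathbb{T}^n=\mathbb{R}^n/2\pi\mathbb{Z}^n$. $\mathbf{x}=(x_1,\dots,x_N)$ with $x_i\in\mathbb{T}^n$, $\mathbf{v}=(v_1,\dots,v_N)$ with $v_i\in\mathbb{R}^n$. For $x\in\mathbb{T}^n$, $|x|$ denotes the flat (geodesic) distance from $x$ to $0$. A strictly local communication kernel of range $r_0>0$ on $\mathbb{T}^n$ is a $C^1$ function $\phi:\mathbb{T}^n\to[0,\infty)$ that is a non-increasing function of $|x|$ and is supported on the ball of radius $r_0$: $\phi(x)>0$ for $|x|<r_0$ and $\phi(x)=0$ for $|x|\ge r_0$. "Almost every" refers to Lebesgue measure on $\mathbb{T}^{nN}\times\mathbb{R}^{nN}$. *)

theory Defs
  imports "HOL-Analysis.Analysis"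
begin

text \<open>The torus of dimension \<open>CARD('n)\<close>, as the group quotient of Euclidean space by \<open>2\<pi>\<int>\<^sup>n\<close>.
  The projection is the constant \<open>abs_torus\<close>.\<close>

definition torus_rel :: "real ^ 'n \<Rightarrow> real ^ 'n \<Rightarrow> bool" where
  "torus_rel X Y \<longleftrightarrow> (\<forall>k. \<exists>m::int. X $ k - Y $ k = 2 * pi * of_int m)"

lemma torus_rel_refl: "torus_rel X X"
  unfolding torus_rel_def by (auto intro: exI[of _ 0])

lemma torus_rel_minus:
  assumes "torus_rel X X'" and "torus_rel Y Y'"
  shows "torus_rel (X - Y) (X' - Y')"
  unfolding torus_rel_def
proof
  fix k
  obtain a b :: int where "X $ k - X' $ k = 2 * pi * of_int a" "Y $ k - Y' $ k = 2 * pi * of_int b"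
    using assms unfolding torus_rel_def by blast
  then have "(X - Y) $ k - (X' - Y') $ k = 2 * pi * of_int (a - b)"
    by (simp add: algebra_simps)
  then show "\<exists>m::int. (X - Y) $ k - (X' - Y') $ k = 2 * pi * of_int m" ..
qed

lemma torus_rel_uminus: "torus_rel X X' \<Longrightarrow> torus_rel (- X) (- X')"
  using torus_rel_minus[OF torus_rel_refl[of 0]] by fastforce

lemma torus_rel_plus:
  assumes "torus_rel X X'" and "torus_rel Y Y'"
  shows "torus_rel (X + Y) (X' + Y')"
  using torus_rel_minus[OF assms(1) torus_rel_uminus[OF assms(2)]] by simp

lemma equivp_torus_rel: "equivp torus_rel"
proof (rule equivpI)
  show "reflp torus_rel" by (simp add: reflp_def torus_rel_refl)
  show sym: "symp torus_rel"
  proof (rule sympI)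
    fix X Y :: "real ^ 'n" assume "torus_rel X Y"
    from torus_rel_minus[OF torus_rel_minus[OF torus_rel_refl[of X] this] torus_rel_refl[of "X - Y - X"]]
    have "torus_rel (X - X - (X - Y - X)) (X - Y - (X - Y - X))" .
    then show "torus_rel Y X" by simp
  qed
  show "transp torus_rel"
  proof (rule transpI)
    fix X Y Z :: "real ^ 'n" assume "torus_rel X Y" "torus_rel Y Z"
    from torus_rel_minus[OF torus_rel_plus[OF this] torus_rel_refl[of Y]]
    show "torus_rel X Z" by simp
  qed
qed

quotient_type 'n torus = "real ^ 'n" / torus_rel
  by (rule equivp_torus_rel)

instantiation torus :: (finite) ab_group_add
begin

lift_definition zero_torus :: "'a torus" is 0 .
lift_definition plus_torus :: "'a torus \<Rightarrow> 'a torus \<Rightarrow> 'a torus" is "(+)" by (rule torus_rel_plus)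
lift_definition minus_torus :: "'a torus \<Rightarrow> 'a torus \<Rightarrow> 'a torus" is "(-)" by (rule torus_rel_minus)
lift_definition uminus_torus :: "'a torus \<Rightarrow> 'a torus" is uminus by (rule torus_rel_uminus)

instance
  by standard (transfer, simp add: algebra_simps torus_rel_refl)+

end

text \<open>The flat distance to \<open>0\<close>: the length of a shortest representative.\<close>

definition torus_norm :: "'n::finite torus \<Rightarrow> real" where
  "torus_norm x = (INF X\<in>{X. abs_torus X = x}. norm X)"

text \<open>Since the projection is a local diffeomorphism, a function on the torus is \<open>C\<^sup>1\<close> iff its
  periodic pullback is.\<close>

definition C1_on_torus :: "('n::finite torus \<Rightarrow> real) \<Rightarrow> bool" where
  "C1_on_torus f \<longleftrightarrow>
    (\<exists>D :: real ^ 'n \<Rightarrow> (real ^ 'n) \<Rightarrow>\<^sub>L real.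
      (\<forall>X. ((\<lambda>Y. f (abs_torus Y)) has_derivative blinfun_apply (D X)) (at X)) \<and>
      continuous_on UNIV D)"

definition strictly_local_kernel :: "real \<Rightarrow> ('n::finite torus \<Rightarrow> real) \<Rightarrow> bool" where
  "strictly_local_kernel r0 \<phi> \<longleftrightarrow>
    C1_on_torus \<phi> \<and>
    (\<forall>x. 0 \<le> \<phi> x) \<and>
    (\<forall>x y. torus_norm x \<le> torus_norm y \<longrightarrow> \<phi> y \<le> \<phi> x) \<and>
    (\<forall>x. torus_norm x < r0 \<longrightarrow> 0 < \<phi> x) \<and>
    (\<forall>x. r0 \<le> torus_norm x \<longrightarrow> \<phi> x = 0)"

text \<open>Derivative of a curve in the torus, as a tangent vector in \<open>\<real>\<^sup>n\<close>. The lift \<open>X\<close> depends on \<open>t\<close>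
  and need only be differentiable (hence continuous) at \<open>t\<close>; away from \<open>t\<close> it is any choice of
  representatives.\<close>

definition has_torus_derivative ::
    "(real \<Rightarrow> 'n::finite torus) \<Rightarrow> real ^ 'n \<Rightarrow> real \<Rightarrow> real set \<Rightarrow> bool" where
  "has_torus_derivative x w t S \<longleftrightarrow>
    (\<exists>X. (\<forall>s. abs_torus (X s) = x s) \<and> (X has_vector_derivative w) (at t within S))"

definition cucker_smale_solution ::
    "('n::finite torus \<Rightarrow> real) \<Rightarrow> (real \<Rightarrow> 'n torus ^ 'N) \<Rightarrow> (real \<Rightarrow> (real ^ 'n) ^ 'N::finite) \<Rightarrow> bool" where
  "cucker_smale_solution \<phi> x v \<longleftrightarrow>
    (\<forall>t\<ge>0. \<forall>i.
      has_torus_derivative (\<lambda>s. x s $ i) (v t $ i) t {0..} \<and>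
      ((\<lambda>s. v s $ i) has_vector_derivative
        (1 / real CARD('N)) *\<^sub>R
          (\<Sum>j\<in>UNIV. \<phi> (x t $ i - x t $ j) *\<^sub>R (v t $ j - v t $ i))) (at t within {0..}))"

text \<open>Lebesgue measure on \<open>\<real>\<^sup>n\<^sup>N \<times> \<real>\<^sup>n\<^sup>N\<close>, restricted to the fundamental cell in the positions and
  pushed forward to the phase space along the projection. A set is measurable iff its preimage in
  the cell is Lebesgue measurable.\<close>

definition phase_proj ::
    "((real ^ 'n::finite) ^ 'N::finite) \<times> ((real ^ 'n) ^ 'N) \<Rightarrow> ('n torus ^ 'N) \<times> ((real ^ 'n) ^ 'N)" where
  "phase_proj = (\<lambda>(X, V). ((\<chi> i. abs_torus (X $ i)), V))"

definition phase_cell :: "(((real ^ 'n::finite) ^ 'N::finite) \<times> ((real ^ 'n) ^ 'N)) set" where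
  "phase_cell = {X. \<forall>i k. 0 \<le> X $ i $ k \<and> X $ i $ k < 2 * pi} \<times> UNIV"

definition lebesgue_phase :: "(('n::finite torus ^ 'N::finite) \<times> ((real ^ 'n) ^ 'N)) measure" where
  "lebesgue_phase =
    distr (lebesgue_on phase_cell)
      (sigma UNIV {A. phase_proj -` A \<inter> phase_cell \<in> sets lebesgue}) phase_proj"

end

theory Submission
  imports Defs
begin

text \<open>
  Every solution has convergent velocities: each coordinate follows a symmetric consensus dynamics,
  for which sums of convex functions of the components decrease. If no pair aligns, the limit
  velocities are pairwise distinct, so the dissipation of energy bounds the time integral of every
  \<open>\<phi>(x\<^sub>i - x\<^sub>j)\<close>. This integral controls the divergence of the field, hence the flow
  contracts the volume of such data by at most a fixed factor, uniformly in time. On the other hand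
  \<open>\<phi>(x\<^sub>i - x\<^sub>j) \<rightarrow> 0\<close> along such a solution, so at late times the line from \<open>x\<^sub>i - x\<^sub>j\<close> in the
  direction \<open>v\<^sub>i - v\<^sub>j\<close> avoids the zone of interaction for an arbitrarily long time. By Kronecker's
  theorem the states whose line avoids it forever have rationally dependent \<open>v\<^sub>i - v\<^sub>j\<close> and form a
  null set. So the data in question form a null set.

  Liouville's theorem is replaced by an explicit scheme that updates one real coordinate at a
  time. Each update is affine in the updated coordinate, so it changes volume by an exact factor, and
  no differentiability or existence of the flow is needed.
\<close>

section \<open>Volume under coordinatewise affine maps\<close>

text \<open>Whether the set of data without alignment is measurable is not evident, so volume
  statements about sets of data are made for Borel covers, that is, for outer measure. The order of
  choices matters. Countable unions allow bounds \<open>R\<close> for the initial speed and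
  \<open>M\<close> for the accumulated damping to be fixed first; then comes a length
  \<open>n\<close> of the avoided segment, and only then the time from which the segment is avoided.
  The volume factor depends on \<open>M\<close> alone, so the union over that time costs nothing,
  and \<open>n\<close> can grow afterwards. Coordinatewise updates suit this field because positions
  move with the velocities only, while a velocity coordinate enters its own equation affinely, with
  a coefficient that depends on positions only. An update is then a one-dimensional affine
  substitution on parallel lines. The scheme does not preserve the fundamental cell of the
  positions; its equivariance under lattice translations makes up for this.\<close>

lemma nn_integral_lborel_coordinate:
  fixes f :: "'a::euclidean_space \<Rightarrow> ennreal"
  assumes [measurable]: "f \<in> borel_measurable borel" and b: "b \<in> Basis"
  shows "(\<integral>\<^sup>+z. f z \<partial>lborel) =
    (\<integral>\<^sup>+x. (\<integral>\<^sup>+y. f ((\<Sum>c\<in>Basis - {b}. x c *\<^sub>R c) + y *\<^sub>R b) \<partial>lborel) \<partial>(\<Pi>\<^sub>M c\<in>Basis - {b}. lborel))"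
proof -
  interpret product_sigma_finite "\<lambda>_::'a. lborel :: real measure" ..
  have ins: "insert b (Basis - {b}) = Basis" using b by auto
  have upd: "(\<Sum>c\<in>Basis. (x(b := y)) c *\<^sub>R c) = (\<Sum>c\<in>Basis - {b}. x c *\<^sub>R c) + y *\<^sub>R b"
    for x :: "'a \<Rightarrow> real" and y
    by (subst sum.remove[OF _ b]) (auto simp: add.commute intro!: sum.cong)
  have "(\<integral>\<^sup>+z. f z \<partial>lborel) = (\<integral>\<^sup>+x. f (\<Sum>c\<in>Basis. x c *\<^sub>R c) \<partial>(\<Pi>\<^sub>M c\<in>Basis. lborel))"
    by (subst lborel_eq) (simp add: nn_integral_distr)
  also have "\<dots> = (\<integral>\<^sup>+x. f (\<Sum>c\<in>Basis. x c *\<^sub>R c) \<partial>(\<Pi>\<^sub>M c\<in>insert b (Basis - {b}). lborel))"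
    by (simp only: ins)
  also have "\<dots> = (\<integral>\<^sup>+x. (\<integral>\<^sup>+y. f (\<Sum>c\<in>Basis. (x(b := y)) c *\<^sub>R c) \<partial>lborel) \<partial>(\<Pi>\<^sub>M c\<in>Basis - {b}. lborel))"
    by (subst product_nn_integral_insert) (auto simp: ins)
  also have "\<dots> = (\<integral>\<^sup>+x. (\<integral>\<^sup>+y. f ((\<Sum>c\<in>Basis - {b}. x c *\<^sub>R c) + y *\<^sub>R b) \<partial>lborel) \<partial>(\<Pi>\<^sub>M c\<in>Basis - {b}. lborel))"
    by (simp only: upd)
  finally show ?thesis .
qed

text \<open>On a line in direction \<open>b\<close> the map is affine with constant slope
  \<open>1 - a p\<close>, so the one-dimensional substitution rule applies on each line and Fubini
  collects the lines. How \<open>g\<close> and \<open>a\<close> vary from line to line enters only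
  through measurability.\<close>

lemma nn_integral_affine_coordinate:
  fixes f :: "'a::euclidean_space \<Rightarrow> ennreal" and g a :: "'a \<Rightarrow> real"
  assumes [measurable]: "f \<in> borel_measurable borel" "g \<in> borel_measurable borel"
      "a \<in> borel_measurable borel"
    and b: "b \<in> Basis"
    and a: "\<And>z s. a (z + s *\<^sub>R b) = a z" "\<And>z. a z < 1"
    and g: "\<And>z s. g (z + s *\<^sub>R b) = g z - a z * s"
  shows "(\<integral>\<^sup>+z. f (z + g z *\<^sub>R b) * ennreal (1 - a z) \<partial>lborel) = (\<integral>\<^sup>+z. f z \<partial>lborel)"
proof -
  have "(\<integral>\<^sup>+z. f (z + g z *\<^sub>R b) * ennreal (1 - a z) \<partial>lborel) =
    (\<integral>\<^sup>+x. (\<integral>\<^sup>+y. f ((\<Sum>c\<in>Basis - {b}. x c *\<^sub>R c) + y *\<^sub>R b +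
      g ((\<Sum>c\<in>Basis - {b}. x c *\<^sub>R c) + y *\<^sub>R b) *\<^sub>R b) *
      ennreal (1 - a ((\<Sum>c\<in>Basis - {b}. x c *\<^sub>R c) + y *\<^sub>R b)) \<partial>lborel) \<partial>(\<Pi>\<^sub>M c\<in>Basis - {b}. lborel))"
    by (rule nn_integral_lborel_coordinate[OF _ b]) measurable
  also have "\<dots> = (\<integral>\<^sup>+x. (\<integral>\<^sup>+y. f ((\<Sum>c\<in>Basis - {b}. x c *\<^sub>R c) + y *\<^sub>R b) \<partial>lborel) \<partial>(\<Pi>\<^sub>M c\<in>Basis - {b}. lborel))"
  proof (rule nn_integral_cong)
    fix x :: "'a \<Rightarrow> real"
    define p where "p = (\<Sum>c\<in>Basis - {b}. x c *\<^sub>R c)"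
    have pos: "1 - a p > 0" using a(2)[of p] by simp
    have "(\<integral>\<^sup>+y. f (p + y *\<^sub>R b + g (p + y *\<^sub>R b) *\<^sub>R b) * ennreal (1 - a (p + y *\<^sub>R b)) \<partial>lborel) =
       (\<integral>\<^sup>+y. ennreal (1 - a p) * f (p + (g p + (1 - a p) * y) *\<^sub>R b) \<partial>lborel)"
      by (intro nn_integral_cong) (simp add: a g algebra_simps)
    also have "\<dots> = ennreal (1 - a p) * (\<integral>\<^sup>+y. f (p + (g p + (1 - a p) * y) *\<^sub>R b) \<partial>lborel)"
      by (rule nn_integral_cmult) simp
    also have "\<dots> = (\<integral>\<^sup>+y. f (p + y *\<^sub>R b) \<partial>lborel)"
      using pos by (subst (2) nn_integral_real_affine[where c = "1 - a p" and t = "g p"]) auto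
    finally show "(\<integral>\<^sup>+y. f ((\<Sum>c\<in>Basis - {b}. x c *\<^sub>R c) + y *\<^sub>R b +
      g ((\<Sum>c\<in>Basis - {b}. x c *\<^sub>R c) + y *\<^sub>R b) *\<^sub>R b) *
      ennreal (1 - a ((\<Sum>c\<in>Basis - {b}. x c *\<^sub>R c) + y *\<^sub>R b)) \<partial>lborel) =
      (\<integral>\<^sup>+y. f ((\<Sum>c\<in>Basis - {b}. x c *\<^sub>R c) + y *\<^sub>R b) \<partial>lborel)"
      unfolding p_def .
  qed
  also have "\<dots> = (\<integral>\<^sup>+z. f z \<partial>lborel)"
    by (rule nn_integral_lborel_coordinate[OF assms(1) b, symmetric])
  finally show ?thesis .
qed

text \<open>Both \<open>C\<close> and its preimage under \<open>E\<close> meet every orbit of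
  \<open>\<Lambda>\<close> exactly once, the preimage because \<open>E\<close> commutes with the
  translations. An invariant function has the same integral over two such sets.\<close>

lemma nn_integral_fundamental_domain:
  fixes C :: "'a::euclidean_space set" and g :: "'a \<Rightarrow> ennreal" and E :: "'a \<Rightarrow> 'a"
  assumes [measurable]: "C \<in> sets borel" "g \<in> borel_measurable borel" "E \<in> borel_measurable borel"
    and L: "countable \<Lambda>" "uminus ` \<Lambda> = \<Lambda>" "\<And>z. \<exists>!l. l \<in> \<Lambda> \<and> z + l \<in> C"
    and g: "\<And>z l. l \<in> \<Lambda> \<Longrightarrow> g (z + l) = g z"
    and E: "\<And>z l. l \<in> \<Lambda> \<Longrightarrow> E (z + l) = E z + l"
  shows "(\<integral>\<^sup>+z. indicator C z * g z \<partial>lborel) = (\<integral>\<^sup>+z. indicator C (E z) * g z \<partial>lborel)"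
proof -
  have one: "(\<integral>\<^sup>+l. indicator C (z + l) \<partial>count_space \<Lambda>) = (1::ennreal)" for z
  proof -
    have "\<exists>l0. (l0 \<in> \<Lambda> \<and> z + l0 \<in> C) \<and> (\<forall>l. l \<in> \<Lambda> \<and> z + l \<in> C \<longrightarrow> l = l0)"
      using L(3)[of z] unfolding Ex1_def .
    then obtain l0 where l0: "l0 \<in> \<Lambda>" "z + l0 \<in> C"
      and u: "\<And>l. l \<in> \<Lambda> \<Longrightarrow> z + l \<in> C \<Longrightarrow> l = l0"
      by blast
    have "(\<integral>\<^sup>+l. indicator C (z + l) \<partial>count_space \<Lambda>) = (\<integral>\<^sup>+l. indicator {l0} l \<partial>count_space \<Lambda>)"
      by (rule nn_integral_cong) (use l0 in \<open>auto dest: u split: split_indicator\<close>)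
    also have "\<dots> = 1" using l0 by simp
    finally show ?thesis .
  qed
  have bij: "bij_betw uminus \<Lambda> \<Lambda>" using L(2) by (simp add: bij_betw_def)
  have one': "(\<integral>\<^sup>+l. indicator C (z - l) \<partial>count_space \<Lambda>) = (1::ennreal)" for z
    using nn_integral_bij_count_space[OF bij, of "\<lambda>l. indicator C (z + l)"] one[of z] by simp
  have shift: "(\<integral>\<^sup>+z. f z \<partial>lborel) = (\<integral>\<^sup>+z. f (l + z) \<partial>lborel)"
    if [measurable]: "f \<in> borel_measurable borel" for f :: "'a \<Rightarrow> ennreal" and l
    by (subst lborel_distr_plus[of l, symmetric]) (simp add: nn_integral_distr)
  \<comment> \<open>The factor 1 is written as a sum over the lattice that locates
    \<open>E z\<close>. After sum and integral are swapped, each term is shifted by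
    \<open>l\<close>, which exchanges the roles of the two fundamental domains.\<close>
  have "(\<integral>\<^sup>+z. indicator C z * g z \<partial>lborel) =
     (\<integral>\<^sup>+z. (\<integral>\<^sup>+l. indicator C z * g z * indicator C (E z - l) \<partial>count_space \<Lambda>) \<partial>lborel)"
    by (simp add: nn_integral_cmult one')
  also have "\<dots> = (\<integral>\<^sup>+l. (\<integral>\<^sup>+z. indicator C z * g z * indicator C (E z - l) \<partial>lborel) \<partial>count_space \<Lambda>)"
    by (rule nn_integral_count_space_nn_integral[OF L(1)]) simp
  also have "\<dots> = (\<integral>\<^sup>+l. (\<integral>\<^sup>+z. indicator C (E z) * g z * indicator C (z + l) \<partial>lborel) \<partial>count_space \<Lambda>)"
  proof (rule nn_integral_cong)
    fix l assume "l \<in> space (count_space \<Lambda>)"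
    then have l: "l \<in> \<Lambda>" by simp
    show "(\<integral>\<^sup>+z. indicator C z * g z * indicator C (E z - l) \<partial>lborel) =
        (\<integral>\<^sup>+z. indicator C (E z) * g z * indicator C (z + l) \<partial>lborel)"
      by (subst shift[where l = l], simp, rule nn_integral_cong)
        (use g[OF l] E[OF l] in \<open>simp add: add.commute mult_ac\<close>)
  qed
  also have "\<dots> = (\<integral>\<^sup>+z. (\<integral>\<^sup>+l. indicator C (E z) * g z * indicator C (z + l) \<partial>count_space \<Lambda>) \<partial>lborel)"
    by (rule nn_integral_count_space_nn_integral[OF L(1), symmetric]) simp
  also have "\<dots> = (\<integral>\<^sup>+z. indicator C (E z) * g z \<partial>lborel)"
    by (simp add: nn_integral_cmult one)
  finally show ?thesis .
qed

section \<open>Split Euler steps and their Jacobian\<close>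

text \<open>The value \<open>\<alpha> b\<close> plays the role of minus the diagonal entry of the
  Jacobian matrix of \<open>F\<close>, so its sum over \<open>Basis\<close> is minus the divergence.
  As it does not change along \<open>b\<close>, an explicit update of that coordinate is affine with
  slope \<open>1 - h * \<alpha> b z\<close>; the bound \<open>K\<close> keeps this slope positive
  for small \<open>h\<close>.\<close>

locale coordinate_affine_field =
  fixes F :: "'a::euclidean_space \<Rightarrow> 'a" and \<alpha> :: "'a \<Rightarrow> 'a \<Rightarrow> real" and K :: real
  assumes continuous_F: "continuous_on UNIV F"
    and continuous_\<alpha>: "b \<in> Basis \<Longrightarrow> continuous_on UNIV (\<alpha> b)"
    and F_line: "b \<in> Basis \<Longrightarrow> F (z + s *\<^sub>R b) \<bullet> b = F z \<bullet> b - \<alpha> b z * s"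
    and \<alpha>_line: "b \<in> Basis \<Longrightarrow> \<alpha> b (z + s *\<^sub>R b) = \<alpha> b z"
    and \<alpha>_nonneg: "b \<in> Basis \<Longrightarrow> 0 \<le> \<alpha> b z"
    and \<alpha>_le: "b \<in> Basis \<Longrightarrow> \<alpha> b z \<le> K"
begin

definition substep :: "real \<Rightarrow> 'a \<Rightarrow> 'a \<Rightarrow> 'a" where
  "substep h b z = z + (h * (F z \<bullet> b)) *\<^sub>R b"

primrec steps :: "real \<Rightarrow> 'a list \<Rightarrow> 'a \<Rightarrow> 'a" where
  "steps h [] z = z"
| "steps h (b # bs) z = steps h bs (substep h b z)"

text \<open>The Jacobian determinant of \<open>steps\<close> as the chain rule would give it: each
  factor is the slope of one update, taken at the point where the update is made.\<close>

primrec jac :: "real \<Rightarrow> 'a list \<Rightarrow> 'a \<Rightarrow> real" where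
  "jac h [] z = 1"
| "jac h (b # bs) z = (1 - h * \<alpha> b z) * jac h bs (substep h b z)"

lemma steps_append: "steps h (xs @ ys) z = steps h ys (steps h xs z)"
  by (induction xs arbitrary: z) auto

lemma jac_append: "jac h (xs @ ys) z = jac h xs z * jac h ys (steps h xs z)"
  by (induction xs arbitrary: z) auto

lemma continuous_substep: "continuous_on UNIV (substep h b)"
  unfolding substep_def by (intro continuous_intros continuous_F)

lemma continuous_steps: "continuous_on UNIV (steps h bs)"
proof (induction bs)
  case (Cons b bs)
  from continuous_on_compose2[OF Cons continuous_substep]
  show ?case by simp
qed simp

lemma continuous_jac:
  assumes "set bs \<subseteq> Basis"
  shows "continuous_on UNIV (jac h bs)"
  using assms
proof (induction bs)
  case (Cons b bs)
  then have "continuous_on UNIV (\<lambda>z. jac h bs (substep h b z))"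
    by (intro continuous_on_compose2[OF _ continuous_substep]) auto
  with Cons.prems show ?case by (auto intro!: continuous_intros continuous_\<alpha>)
qed simp

lemma jac_nonneg:
  assumes "set bs \<subseteq> Basis" "0 \<le> h" "h * K < 1"
  shows "0 \<le> jac h bs z"
  using assms
proof (induction bs arbitrary: z)
  case (Cons b bs)
  have "h * \<alpha> b z \<le> h * K" using Cons.prems by (auto intro!: mult_left_mono \<alpha>_le)
  with Cons show ?case by auto
qed simp

lemma nn_integral_steps:
  fixes f :: "'a \<Rightarrow> ennreal"
  assumes "set bs \<subseteq> Basis" "0 \<le> h" "h * K < 1" and "f \<in> borel_measurable borel"
  shows "(\<integral>\<^sup>+z. f (steps h bs z) * ennreal (jac h bs z) \<partial>lborel) = (\<integral>\<^sup>+z. f z \<partial>lborel)"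
  using assms(1)
proof (induction bs)
  case (Cons b bs)
  then have b: "b \<in> Basis" and bs: "set bs \<subseteq> Basis" by auto
  note [measurable] = assms(4) borel_measurable_continuous_onI[OF continuous_steps]
    borel_measurable_continuous_onI[OF continuous_jac[OF bs]]
    borel_measurable_continuous_onI[OF continuous_F]
    borel_measurable_continuous_onI[OF continuous_\<alpha>[OF b]]
  have lt: "h * \<alpha> b z < 1" for z
    using mult_left_mono[OF \<alpha>_le[OF b, of z] assms(2)] assms(3) by simp
  define g where "g z = f (steps h bs z) * ennreal (jac h bs z)" for z
  have [measurable]: "g \<in> borel_measurable borel" unfolding g_def by measurable
  have "(\<integral>\<^sup>+z. f (steps h (b # bs) z) * ennreal (jac h (b # bs) z) \<partial>lborel) =
    (\<integral>\<^sup>+z. g (z + (h * (F z \<bullet> b)) *\<^sub>R b) * ennreal (1 - h * \<alpha> b z) \<partial>lborel)"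
    using lt jac_nonneg[OF bs assms(2,3)]
    by (intro nn_integral_cong)
      (simp add: g_def ennreal_mult less_imp_le mult_ac flip: substep_def)
  also have "\<dots> = (\<integral>\<^sup>+z. g z \<partial>lborel)"
    by (rule nn_integral_affine_coordinate[OF _ _ _ b])
      (auto simp: \<alpha>_line[OF b] F_line[OF b] lt algebra_simps)
  also have "\<dots> = (\<integral>\<^sup>+z. f z \<partial>lborel)"
    unfolding g_def by (rule Cons.IH[OF bs])
  finally show ?case .
qed simp

lemma steps_translate:
  assumes "\<And>z. F (z + l) = F z"
  shows "steps h bs (z + l) = steps h bs z + l"
proof (induction bs arbitrary: z)
  case (Cons b bs)
  have "substep h b (z + l) = substep h b z + l"
    unfolding substep_def assms(1) by (simp add: algebra_simps)
  with Cons show ?case by simp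
qed simp

lemma jac_translate:
  assumes "\<And>z. F (z + l) = F z" "\<And>b z. \<alpha> b (z + l) = \<alpha> b z"
  shows "jac h bs (z + l) = jac h bs z"
proof (induction bs arbitrary: z)
  case (Cons b bs)
  have "substep h b (z + l) = substep h b z + l"
    unfolding substep_def assms(1) by (simp add: algebra_simps)
  with Cons show ?case by (simp add: assms)
qed simp

text \<open>On \<open>S\<close> the Jacobian is at least \<open>c\<close>, so \<open>c\<close> times
  the volume of \<open>S\<close> is at most the integral of the Jacobian over the points of the cell
  that land in \<open>G\<close>. Periodicity trades the condition of starting in \<open>C\<close>
  for that of landing in \<open>C\<close>, and the change of variables then yields the volume of
  \<open>G \<inter> C\<close>.\<close>

lemma emeasure_steps_preimage_le:
  assumes bs: "set bs \<subseteq> Basis" and h: "0 \<le> h" "h * K < 1" and c: "0 \<le> c"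
    and C: "C \<in> sets borel" and G: "G \<in> sets borel"
    and L: "countable \<Lambda>" "uminus ` \<Lambda> = \<Lambda>" "\<And>z. \<exists>!l. l \<in> \<Lambda> \<and> z + l \<in> C"
    and per: "\<And>z l. l \<in> \<Lambda> \<Longrightarrow> F (z + l) = F z" "\<And>b z l. l \<in> \<Lambda> \<Longrightarrow> \<alpha> b (z + l) = \<alpha> b z"
      "\<And>z l. l \<in> \<Lambda> \<Longrightarrow> z + l \<in> G \<longleftrightarrow> z \<in> G"
  defines "S \<equiv> {z\<in>C. steps h bs z \<in> G \<and> c \<le> jac h bs z}"
  shows "S \<in> sets borel" and "ennreal c * emeasure lborel S \<le> emeasure lborel (G \<inter> C)"
proof -
  note [measurable] = C G borel_measurable_continuous_onI[OF continuous_steps]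
    borel_measurable_continuous_onI[OF continuous_jac[OF bs]]
  have "S = C \<inter> (steps h bs -` G \<inter> space borel) \<inter> {z\<in>space borel. c \<le> jac h bs z}"
    by (auto simp: S_def)
  also have "\<dots> \<in> sets borel" by measurable
  finally show S[measurable]: "S \<in> sets borel" .
  define g :: "'a \<Rightarrow> ennreal" where "g z = indicator G (steps h bs z) * ennreal (jac h bs z)" for z
  have [measurable]: "g \<in> borel_measurable borel" unfolding g_def by measurable
  have "ennreal c * emeasure lborel S = (\<integral>\<^sup>+z. ennreal c * indicator S z \<partial>lborel)"
    by (simp add: nn_integral_cmult)
  also have "\<dots> \<le> (\<integral>\<^sup>+z. indicator C z * g z \<partial>lborel)"
    by (rule nn_integral_mono) (auto simp: S_def g_def intro!: ennreal_leI split: split_indicator)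
  also have "\<dots> = (\<integral>\<^sup>+z. indicator C (steps h bs z) * g z \<partial>lborel)"
    by (rule nn_integral_fundamental_domain[OF _ _ _ L])
      (auto simp: g_def steps_translate per jac_translate indicator_def)
  also have "\<dots> = (\<integral>\<^sup>+z. indicator (G \<inter> C) (steps h bs z) * ennreal (jac h bs z) \<partial>lborel)"
    by (intro nn_integral_cong) (auto simp: g_def split: split_indicator)
  also have "\<dots> = emeasure lborel (G \<inter> C)"
    by (subst nn_integral_steps[OF bs h]) auto
  finally show "ennreal c * emeasure lborel S \<le> emeasure lborel (G \<inter> C)" .
qed

text \<open>Each update moves the point by at most \<open>h * B\<close>, so the whole list stays in
  the ball of radius \<open>r\<close>, where \<open>F\<close> and \<open>\<alpha>\<close> differ
  from their values at \<open>w0\<close> by at most \<open>D\<close>. The list thus acts like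
  updates with coefficients frozen at \<open>w0\<close>, up to an error \<open>h * D\<close> per
  entry.\<close>

lemma steps_approx:
  assumes bs: "set bs \<subseteq> Basis" and h: "0 \<le> h" "h * K \<le> 1 / 2" and B0: "0 \<le> B"
    and B: "\<And>x b. x \<in> cball w0 r \<Longrightarrow> b \<in> Basis \<Longrightarrow> \<bar>F x \<bullet> b\<bar> \<le> B"
    and FD: "\<And>x b. x \<in> cball w0 r \<Longrightarrow> b \<in> Basis \<Longrightarrow> \<bar>F x \<bullet> b - F w0 \<bullet> b\<bar> \<le> D"
    and \<alpha>D: "\<And>x b. x \<in> cball w0 r \<Longrightarrow> b \<in> Basis \<Longrightarrow> \<bar>\<alpha> b x - \<alpha> b w0\<bar> \<le> D"
    and r: "norm (w - w0) + h * B * length bs \<le> r"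
  shows "norm (steps h bs w - w - h *\<^sub>R (\<Sum>b\<leftarrow>bs. (F w0 \<bullet> b) *\<^sub>R b)) \<le> h * D * length bs \<and>
    exp (- 2 * h * ((\<Sum>b\<leftarrow>bs. \<alpha> b w0) + D * length bs)) \<le> jac h bs w"
  using bs r
proof (induction bs arbitrary: w)
  case (Cons b bs)
  then have b: "b \<in> Basis" and bs: "set bs \<subseteq> Basis" by auto
  have nb: "norm b = 1" using b by simp
  define w1 where "w1 = substep h b w"
  have "0 \<le> h * B * length (b # bs)"
    using h B0 by simp
  then have w: "w \<in> cball w0 r"
    using Cons.prems(2) by (simp add: dist_norm norm_minus_commute)
  have "norm (w1 - w0) \<le> norm (w - w0) + norm ((h * (F w \<bullet> b)) *\<^sub>R b)"
    unfolding w1_def substep_def by (metis add_diff_eq add.commute diff_add_eq norm_triangle_ineq)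
  also have "norm ((h * (F w \<bullet> b)) *\<^sub>R b) \<le> h * B"
    using h(1) B[OF w b] nb by (simp add: abs_mult mult_left_mono)
  finally have "norm (w1 - w0) + h * B * length bs \<le> r"
    using Cons.prems(2) by (simp add: algebra_simps)
  from Cons.IH[OF bs this]
  have 1: "norm (steps h bs w1 - w1 - h *\<^sub>R (\<Sum>b\<leftarrow>bs. (F w0 \<bullet> b) *\<^sub>R b)) \<le> h * D * length bs"
    and 2: "exp (- 2 * h * ((\<Sum>b\<leftarrow>bs. \<alpha> b w0) + D * length bs)) \<le> jac h bs w1"
    by auto
  have "norm (steps h bs w1 - w - h *\<^sub>R (\<Sum>b\<leftarrow>b # bs. (F w0 \<bullet> b) *\<^sub>R b)) =
    norm ((steps h bs w1 - w1 - h *\<^sub>R (\<Sum>b\<leftarrow>bs. (F w0 \<bullet> b) *\<^sub>R b)) + (h * (F w \<bullet> b - F w0 \<bullet> b)) *\<^sub>R b)"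
    by (simp add: w1_def substep_def algebra_simps)
  also have "\<dots> \<le> h * D * length bs + norm ((h * (F w \<bullet> b - F w0 \<bullet> b)) *\<^sub>R b)"
    using 1 norm_triangle_ineq order_trans add_right_mono by blast
  also have "norm ((h * (F w \<bullet> b - F w0 \<bullet> b)) *\<^sub>R b) \<le> h * D"
    using h(1) FD[OF w b] nb by (simp add: abs_mult mult_left_mono)
  finally have 3: "norm (steps h bs w1 - w - h *\<^sub>R (\<Sum>b\<leftarrow>b # bs. (F w0 \<bullet> b) *\<^sub>R b)) \<le> h * D * length (b # bs)"
    by (simp add: algebra_simps)
  \<comment> \<open>This inequality turns the product of slopes into the exponential of a sum. It is
    the origin of the factor 2 in the later exponents and of the condition
    \<open>h * K \<le> 1 / 2\<close>.\<close>
  have x: "exp (- 2 * x) \<le> 1 - x" if "0 \<le> x" "x \<le> 1 / 2" for x :: real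
  proof -
    have "1 \<le> (1 - x) * (1 + 2 * x)"
      using mult_nonneg_nonneg[of x "1 - 2 * x"] that by (simp add: algebra_simps)
    also have "\<dots> \<le> (1 - x) * exp (2 * x)"
      using that exp_ge_add_one_self[of "2 * x"] by (intro mult_left_mono) auto
    finally show ?thesis by (simp add: exp_minus field_simps)
  qed
  have "h * \<alpha> b w \<le> h * K" "0 \<le> h * \<alpha> b w"
    using h(1) \<alpha>_le[OF b] \<alpha>_nonneg[OF b] by (auto intro!: mult_left_mono)
  then have "exp (- 2 * (h * \<alpha> b w)) \<le> 1 - h * \<alpha> b w" using h(2) by (intro x) auto
  moreover have "h * \<alpha> b w \<le> h * (\<alpha> b w0 + D)"
    using \<alpha>D[OF w b] h(1) by (intro mult_left_mono) auto
  ultimately have "exp (- 2 * (h * (\<alpha> b w0 + D))) \<le> 1 - h * \<alpha> b w"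
    by (smt (verit) exp_le_cancel_iff)
  then have "exp (- 2 * (h * (\<alpha> b w0 + D))) * exp (- 2 * h * ((\<Sum>b\<leftarrow>bs. \<alpha> b w0) + D * length bs)) \<le>
    (1 - h * \<alpha> b w) * jac h bs w1"
    using 2 \<open>h * \<alpha> b w \<le> h * K\<close> h(2) by (intro mult_mono) auto
  then have "exp (- 2 * h * ((\<Sum>b\<leftarrow>b # bs. \<alpha> b w0) + D * length (b # bs))) \<le> jac h (b # bs) w"
    by (simp add: w1_def algebra_simps flip: exp_add)
  with 3 show ?case by (simp add: w1_def)
qed simp

end

section \<open>Error of the split scheme along a trajectory\<close>

lemma real_increment_mvt:
  fixes f :: "real \<Rightarrow> real"
  assumes "\<And>t. t \<in> {0..T} \<Longrightarrow> (f has_real_derivative f' t) (at t within {0..T})"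
    and "0 \<le> t" "0 < s" "t + s \<le> T"
  obtains u where "t < u" "u < t + s" "f (t + s) - f t = s * f' u"
proof -
  have "(f has_derivative (*) (f' x)) (at x within {t..t + s})" if "t \<le> x" "x \<le> t + s" for x
    using assms(1)[of x] that assms(2-4) unfolding has_field_derivative_def
    by (auto intro: has_derivative_subset)
  then have "\<exists>x\<in>{t<..<t + s}. f (t + s) - f t = f' x * (t + s - t)"
    using assms(3) by (intro mvt_simple) auto
  then show ?thesis by (auto intro: that simp: mult.commute)
qed

context coordinate_affine_field
begin

text \<open>The consistency error of an Euler step: by the mean value theorem the path moves by at
  most a multiple of \<open>B * s\<close>, and \<open>F\<close> and \<open>\<alpha>\<close> change
  by at most \<open>L\<close> times that. Passing from coordinates to norms costs a factor of the
  dimension each time. \<open>Q\<close> is a primitive of a majorant of the sum of all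
  \<open>\<alpha> b\<close> and later measures the contraction.\<close>

lemma trajectory_increments:
  fixes U :: "'a set" and L B T :: real
  assumes B: "\<And>x b. x \<in> U \<Longrightarrow> b \<in> Basis \<Longrightarrow> \<bar>F x \<bullet> b\<bar> \<le> B"
    and FL: "\<And>x y b. x \<in> U \<Longrightarrow> y \<in> U \<Longrightarrow> b \<in> Basis \<Longrightarrow> \<bar>F x \<bullet> b - F y \<bullet> b\<bar> \<le> L * norm (x - y)"
    and \<alpha>L: "\<And>x y b. x \<in> U \<Longrightarrow> y \<in> U \<Longrightarrow> b \<in> Basis \<Longrightarrow> \<bar>\<alpha> b x - \<alpha> b y\<bar> \<le> L * norm (x - y)"
    and L: "0 \<le> L" and B0: "0 \<le> B"
    and zU: "\<And>t. t \<in> {0..T} \<Longrightarrow> z t \<in> U"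
    and z': "\<And>t. t \<in> {0..T} \<Longrightarrow> (z has_vector_derivative F (z t)) (at t within {0..T})"
    and Q': "\<And>t. t \<in> {0..T} \<Longrightarrow> (Q has_real_derivative q t) (at t within {0..T})"
    and q: "\<And>t. t \<in> {0..T} \<Longrightarrow> (\<Sum>b\<in>Basis. \<alpha> b (z t)) \<le> q t"
    and t: "0 \<le> t" "0 < s" "t + s \<le> T"
  shows "norm (z (t + s) - z t - s *\<^sub>R F (z t)) \<le> s\<^sup>2 * (real DIM('a))\<^sup>2 * L * B"
    and "s * ((\<Sum>b\<in>Basis. \<alpha> b (z t)) - (real DIM('a))\<^sup>2 * L * B * s) \<le> Q (t + s) - Q t"
proof -
  let ?d = "real DIM('a)"
  have comp: "((\<lambda>t. z t \<bullet> b) has_real_derivative F (z t) \<bullet> b) (at t within {0..T})" if "t \<in> {0..T}" for t b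
    using bounded_linear.has_vector_derivative[OF bounded_linear_inner_left z'[OF that], of b]
    by (simp add: has_real_derivative_iff_has_vector_derivative)
  have l1: "norm x \<le> ?d * c" if "\<And>b. b \<in> Basis \<Longrightarrow> \<bar>x \<bullet> b\<bar> \<le> c" for x :: 'a and c
    using order_trans[OF norm_le_l1 sum_bounded_above[OF that]] by simp
  have inc: "norm (z u - z t) \<le> ?d * (B * s)" if u: "t < u" "u < t + s" for u
  proof (rule l1)
    fix b :: 'a assume b: "b \<in> Basis"
    obtain x where x: "t < x" "x < t + (u - t)" "z (t + (u - t)) \<bullet> b - z t \<bullet> b = (u - t) * (F (z x) \<bullet> b)"
      using real_increment_mvt[OF comp[of _ b], of t "u - t"] u t by auto
    have "\<bar>(z u - z t) \<bullet> b\<bar> = (u - t) * \<bar>F (z x) \<bullet> b\<bar>"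
      using x u by (simp add: inner_diff_left abs_mult)
    also have "\<dots> \<le> s * B"
      using x u t B[OF zU[of x] b] by (intro mult_mono) auto
    finally show "\<bar>(z u - z t) \<bullet> b\<bar> \<le> B * s" by (simp add: mult.commute)
  qed
  have tT: "t \<in> {0..T}" using t by auto
  have "norm (z (t + s) - z t - s *\<^sub>R F (z t)) \<le> ?d * (s * (L * (?d * (B * s))))"
  proof (rule l1)
    fix b :: 'a assume b: "b \<in> Basis"
    obtain x where x: "t < x" "x < t + s" "z (t + s) \<bullet> b - z t \<bullet> b = s * (F (z x) \<bullet> b)"
      using real_increment_mvt[OF comp[of _ b], of t s] t by auto
    have "(z (t + s) - z t - s *\<^sub>R F (z t)) \<bullet> b = s * (F (z x) \<bullet> b - F (z t) \<bullet> b)"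
      using x by (simp add: inner_diff_left algebra_simps)
    then have "\<bar>(z (t + s) - z t - s *\<^sub>R F (z t)) \<bullet> b\<bar> = s * \<bar>F (z x) \<bullet> b - F (z t) \<bullet> b\<bar>"
      using t by (simp add: abs_mult)
    also have "\<dots> \<le> s * (L * norm (z x - z t))"
      using x t FL[OF zU[of x] zU[of t] b] by (intro mult_left_mono) auto
    also have "\<dots> \<le> s * (L * (?d * (B * s)))"
      using inc[OF x(1,2)] t L by (intro mult_left_mono) auto
    finally show "\<bar>(z (t + s) - z t - s *\<^sub>R F (z t)) \<bullet> b\<bar> \<le> s * (L * (?d * (B * s)))" .
  qed
  then show "norm (z (t + s) - z t - s *\<^sub>R F (z t)) \<le> s\<^sup>2 * ?d\<^sup>2 * L * B"
    by (simp add: power2_eq_square mult_ac)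
  obtain x where x: "t < x" "x < t + s" "Q (t + s) - Q t = s * q x"
    using real_increment_mvt[OF Q', of t s] t by auto
  have xT: "x \<in> {0..T}" using x t by auto
  have "(\<Sum>b\<in>Basis. \<alpha> b (z t)) - (\<Sum>b\<in>Basis. \<alpha> b (z x)) = (\<Sum>b\<in>Basis. \<alpha> b (z t) - \<alpha> b (z x))"
    by (simp add: sum_subtractf)
  also have "\<dots> \<le> ?d * (L * norm (z x - z t))"
    using \<alpha>L[OF zU[OF xT] zU[OF tT]] by (intro sum_bounded_above) (auto simp: abs_le_iff)
  also have "\<dots> \<le> ?d * (L * (?d * (B * s)))"
    using inc[OF x(1,2)] L by (intro mult_left_mono) auto
  finally have "(\<Sum>b\<in>Basis. \<alpha> b (z t)) - ?d * (L * (?d * (B * s))) \<le> q x" using q[OF xT] by simp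
  then have "s * ((\<Sum>b\<in>Basis. \<alpha> b (z t)) - ?d * (L * (?d * (B * s)))) \<le> s * q x"
    using t by (intro mult_left_mono) auto
  then show "s * ((\<Sum>b\<in>Basis. \<alpha> b (z t)) - ?d\<^sup>2 * L * B * s) \<le> Q (t + s) - Q t"
    using x by (simp add: power2_eq_square mult_ac)
qed

text \<open>A discrete Gronwall argument. One sweep through the coordinates turns an error
  \<open>e\<close> into at most \<open>(1 + h * a) * e + c * h\<^sup>2\<close>; half of
  \<open>c\<close> comes from updating the coordinates one after another, half from the curvature of
  the path. The number \<open>h * P\<close> bounds the distance from the path point during a sweep,
  and \<open>h * P \<le> 1\<close> keeps the sweep inside \<open>U\<close>.\<close>

lemma steps_track_trajectory_explicit:
  fixes U :: "'a set" and L B T :: real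
  assumes B: "\<And>x b. x \<in> U \<Longrightarrow> b \<in> Basis \<Longrightarrow> \<bar>F x \<bullet> b\<bar> \<le> B"
    and FL: "\<And>x y b. x \<in> U \<Longrightarrow> y \<in> U \<Longrightarrow> b \<in> Basis \<Longrightarrow> \<bar>F x \<bullet> b - F y \<bullet> b\<bar> \<le> L * norm (x - y)"
    and \<alpha>L: "\<And>x y b. x \<in> U \<Longrightarrow> y \<in> U \<Longrightarrow> b \<in> Basis \<Longrightarrow> \<bar>\<alpha> b x - \<alpha> b y\<bar> \<le> L * norm (x - y)"
    and L: "0 \<le> L" and B0: "0 \<le> B"
    and zU: "\<And>t. t \<in> {0..T} \<Longrightarrow> cball (z t) 1 \<subseteq> U"
    and z': "\<And>t. t \<in> {0..T} \<Longrightarrow> (z has_vector_derivative F (z t)) (at t within {0..T})"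
    and Q': "\<And>t. t \<in> {0..T} \<Longrightarrow> (Q has_real_derivative q t) (at t within {0..T})"
    and q: "\<And>t. t \<in> {0..T} \<Longrightarrow> (\<Sum>b\<in>Basis. \<alpha> b (z t)) \<le> q t"
    and bs: "set bs = Basis" "distinct bs"
    and h: "0 < h" "h * K \<le> 1 / 2"
  defines "d \<equiv> real DIM('a)"
  defines "a \<equiv> L * d" and "c \<equiv> 2 * L * B * d\<^sup>2"
  defines "P \<equiv> c * T * exp (a * T) + B * d"
  assumes hP: "h * P \<le> 1"
    and k: "real k * h \<le> T"
  shows "norm (steps h (concat (replicate k bs)) (z 0) - z (real k * h)) \<le> c * h\<^sup>2 * real k * (1 + h * a) ^ k"
    and "exp (- 2 * (Q (real k * h) - Q 0) - 2 * d * L * (h * P + d * B * h) * (real k * h)) \<le>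
      jac h (concat (replicate k bs)) (z 0)"
proof -
  have d: "length bs = d" unfolding d_def using bs distinct_card by metis
  have d0: "0 \<le> d" and a0: "0 \<le> a" and c0: "0 \<le> c"
    using L B0 by (auto simp: d_def a_def c_def)
  have "norm (steps h (concat (replicate k bs)) (z 0) - z (real k * h)) \<le> c * h\<^sup>2 * real k * (1 + h * a) ^ k \<and>
    exp (- 2 * (Q (real k * h) - Q 0) - 2 * d * L * (h * P + d * B * h) * (real k * h)) \<le>
      jac h (concat (replicate k bs)) (z 0)"
    using k
  proof (induction k)
    case (Suc k)
    define t where "t = real k * h"
    define w where "w = steps h (concat (replicate k bs)) (z 0)"
    define e where "e = norm (w - z t)"
    have t: "0 \<le> t" "t + h \<le> T" "real (Suc k) * h = t + h"
      using Suc.prems h by (auto simp: t_def algebra_simps)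
    then have tT: "t \<in> {0..T}" using h by auto
    have kT: "real k * h \<le> T" using Suc.prems h by (simp add: algebra_simps)
    from Suc.IH[OF kT] have e: "e \<le> c * h\<^sup>2 * real k * (1 + h * a) ^ k"
      and J: "exp (- 2 * (Q t - Q 0) - 2 * d * L * (h * P + d * B * h) * t) \<le>
        jac h (concat (replicate k bs)) (z 0)"
      by (auto simp: e_def w_def t_def)
    \<comment> \<open>The current error plus the room needed by one sweep of \<open>d\<close>
      updates.\<close>
    define r where "r = e + h * B * d"
    have "(1 + h * a) ^ k \<le> exp (h * a) ^ k"
      using a0 h by (intro power_mono exp_ge_add_one_self) (auto simp: add_nonneg_nonneg)
    also have "\<dots> = exp (a * (real k * h))" by (simp add: mult_ac flip: exp_of_nat_mult)
    also have "\<dots> \<le> exp (a * T)" using kT a0 by (simp add: mult_left_mono)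
    finally have E: "(1 + h * a) ^ k \<le> exp (a * T)" .
    have "e \<le> c * h * (real k * h) * (1 + h * a) ^ k"
      using e by (simp add: power2_eq_square mult_ac)
    also have "\<dots> \<le> c * h * T * exp (a * T)"
      using c0 h a0 kT E t tT by (intro mult_mono mult_nonneg_nonneg) auto
    finally have rP: "r \<le> h * P" by (simp add: r_def P_def algebra_simps)
    have r1: "r \<le> 1" using rP hP by simp
    have r0: "0 \<le> r" using h B0 d0 by (simp add: r_def e_def)
    have zt: "z t \<in> U" and cU: "cball (z t) r \<subseteq> U"
      using zU[OF tT] r1 subset_cball[OF r1, of "z t"] by auto
    have lr: "L * norm (x - z t) \<le> L * r" if "x \<in> cball (z t) r" for x
      using that L by (intro mult_left_mono) (auto simp: dist_norm norm_minus_commute)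
    have step: "norm (steps h bs w - w - h *\<^sub>R (\<Sum>b\<leftarrow>bs. (F (z t) \<bullet> b) *\<^sub>R b)) \<le> h * (L * r) * length bs \<and>
      exp (- 2 * h * ((\<Sum>b\<leftarrow>bs. \<alpha> b (z t)) + (L * r) * length bs)) \<le> jac h bs w"
    proof (rule steps_approx[where r = r and B = B])
      fix x b :: 'a assume x: "x \<in> cball (z t) r" and b: "b \<in> Basis"
      then have xU: "x \<in> U" using cU by auto
      show "\<bar>F x \<bullet> b\<bar> \<le> B" using B[OF xU b] .
      show "\<bar>F x \<bullet> b - F (z t) \<bullet> b\<bar> \<le> L * r" "\<bar>\<alpha> b x - \<alpha> b (z t)\<bar> \<le> L * r"
        using FL[OF xU zt b] \<alpha>L[OF xU zt b] lr[OF x] by auto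
    qed (use bs h B0 d in \<open>auto simp: r_def e_def\<close>)
    have sums: "(\<Sum>b\<leftarrow>bs. (F (z t) \<bullet> b) *\<^sub>R b) = F (z t)" "(\<Sum>b\<leftarrow>bs. \<alpha> b (z t)) = (\<Sum>b\<in>Basis. \<alpha> b (z t))"
      using bs by (simp_all add: sum_list_distinct_conv_sum_set euclidean_representation)
    have step1: "norm (steps h bs w - w - h *\<^sub>R F (z t)) \<le> h * (L * r) * d"
      and step2: "exp (- 2 * h * ((\<Sum>b\<in>Basis. \<alpha> b (z t)) + L * r * d)) \<le> jac h bs w"
      using step unfolding sums d by auto
    have zU': "\<And>t. t \<in> {0..T} \<Longrightarrow> z t \<in> U" using zU by force
    note incr = trajectory_increments[of U B L T z Q q t h, OF B FL \<alpha>L L B0 zU' z' Q' q t(1) h(1) t(2), folded d_def]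
    have "norm (steps h bs w - z (t + h)) =
      norm ((steps h bs w - w - h *\<^sub>R F (z t)) - (z (t + h) - z t - h *\<^sub>R F (z t)) + (w - z t))"
      by (simp add: algebra_simps)
    also have "\<dots> \<le> norm (steps h bs w - w - h *\<^sub>R F (z t)) + norm (z (t + h) - z t - h *\<^sub>R F (z t)) + norm (w - z t)"
      by (intro order_trans[OF norm_triangle_ineq] add_right_mono norm_triangle_ineq4)
    also have "\<dots> \<le> h * (L * r) * d + h\<^sup>2 * d\<^sup>2 * L * B + e"
      using step1 incr(1) by (simp add: e_def)
    also have "\<dots> = (1 + h * a) * e + c * h\<^sup>2"
      by (simp add: r_def a_def c_def power2_eq_square algebra_simps)
    also have "\<dots> \<le> (1 + h * a) * (c * h\<^sup>2 * real k * (1 + h * a) ^ k) + c * h\<^sup>2 * (1 + h * a) ^ Suc k"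
    proof (intro add_mono mult_left_mono e)
      have "1 \<le> (1 + h * a) ^ Suc k" using a0 h by (intro one_le_power) auto
      then show "c * h\<^sup>2 \<le> c * h\<^sup>2 * (1 + h * a) ^ Suc k" using mult_left_mono[of 1 "(1 + h * a) ^ Suc k" "c * h\<^sup>2"] c0 by simp
    qed (use a0 h in auto)
    also have "\<dots> = c * h\<^sup>2 * real (Suc k) * (1 + h * a) ^ Suc k" by (simp add: algebra_simps)
    finally have 1: "norm (steps h bs w - z (t + h)) \<le> c * h\<^sup>2 * real (Suc k) * (1 + h * a) ^ Suc k" .
    have "h * (L * d) * r \<le> h * (L * d) * (h * P)"
      using rP h L d0 by (intro mult_left_mono) auto
    then have "- 2 * (Q (t + h) - Q t) - 2 * d * L * (h * P + d * B * h) * h \<le>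
      - 2 * h * ((\<Sum>b\<in>Basis. \<alpha> b (z t)) + L * r * d)"
      using incr(2) by (simp add: algebra_simps power2_eq_square)
    then have J2: "exp (- 2 * (Q (t + h) - Q t) - 2 * d * L * (h * P + d * B * h) * h) \<le> jac h bs w"
      using step2 by (meson exp_le_cancel_iff order_trans)
    have "exp (- 2 * (Q (t + h) - Q 0) - 2 * d * L * (h * P + d * B * h) * (t + h)) =
      exp (- 2 * (Q t - Q 0) - 2 * d * L * (h * P + d * B * h) * t) *
      exp (- 2 * (Q (t + h) - Q t) - 2 * d * L * (h * P + d * B * h) * h)"
      by (simp add: algebra_simps flip: exp_add)
    also have "\<dots> \<le> jac h (concat (replicate k bs)) (z 0) * jac h bs w"
      using J J2 by (intro mult_mono) (auto intro: order_trans[OF exp_ge_zero])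
    finally have 2: "exp (- 2 * (Q (t + h) - Q 0) - 2 * d * L * (h * P + d * B * h) * (t + h)) \<le>
      jac h (concat (replicate k bs)) (z 0) * jac h bs w" .
    have "concat (replicate (Suc k) bs) = concat (replicate k bs) @ bs"
      by (metis concat.simps(1,2) append_Nil2 concat_append replicate_Suc replicate_append_same)
    then show ?case
      using 1 2 unfolding t(3) by (simp only: steps_append jac_append w_def[symmetric])
  qed simp
  then show "norm (steps h (concat (replicate k bs)) (z 0) - z (real k * h)) \<le> c * h\<^sup>2 * real k * (1 + h * a) ^ k"
    and "exp (- 2 * (Q (real k * h) - Q 0) - 2 * d * L * (h * P + d * B * h) * (real k * h)) \<le>
      jac h (concat (replicate k bs)) (z 0)"
    by auto
qed


text \<open>The unit ball leaves room for the discrete orbit next to the path. Only the increment of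
  \<open>Q\<close> is used afterwards, so its derivative is hidden by a quantifier.\<close>

definition trajectory_until :: "'a set \<Rightarrow> real \<Rightarrow> (real \<Rightarrow> 'a) \<Rightarrow> (real \<Rightarrow> real) \<Rightarrow> bool" where
  "trajectory_until U T z Q \<longleftrightarrow> (\<exists>q. \<forall>t\<in>{0..T}. cball (z t) 1 \<subseteq> U \<and>
    (z has_vector_derivative F (z t)) (at t within {0..T}) \<and>
    (Q has_real_derivative q t) (at t within {0..T}) \<and>
    (\<Sum>b\<in>Basis. \<alpha> b (z t)) \<le> q t)"

text \<open>The step size and the list of coordinates are chosen before the trajectory: one and the
  same map follows all trajectories that stay in \<open>U\<close>, which is what a comparison of
  volumes requires.\<close>

lemma steps_track_trajectory:
  fixes U :: "'a set" and L B T \<epsilon> :: real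
  assumes B: "\<And>x b. x \<in> U \<Longrightarrow> b \<in> Basis \<Longrightarrow> \<bar>F x \<bullet> b\<bar> \<le> B"
    and FL: "\<And>x y b. x \<in> U \<Longrightarrow> y \<in> U \<Longrightarrow> b \<in> Basis \<Longrightarrow> \<bar>F x \<bullet> b - F y \<bullet> b\<bar> \<le> L * norm (x - y)"
    and \<alpha>L: "\<And>x y b. x \<in> U \<Longrightarrow> y \<in> U \<Longrightarrow> b \<in> Basis \<Longrightarrow> \<bar>\<alpha> b x - \<alpha> b y\<bar> \<le> L * norm (x - y)"
    and L: "0 \<le> L" and B0: "0 \<le> B" and T: "0 < T" and \<epsilon>: "0 < \<epsilon>"
  shows "\<exists>h bs. 0 \<le> h \<and> h * K < 1 \<and> set bs \<subseteq> Basis \<and>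
    (\<forall>z Q. trajectory_until U T z Q \<longrightarrow>
      norm (steps h bs (z 0) - z T) \<le> \<epsilon> \<and> exp (- 2 * (Q T - Q 0) - 1) \<le> jac h bs (z 0))"
proof -
  obtain bs0 :: "'a list" where bs0: "set bs0 = Basis" "distinct bs0"
    using finite_distinct_list[OF finite_Basis] by blast
  define d where "d = real DIM('a)"
  define a where "a = L * d"
  define c where "c = 2 * L * B * d\<^sup>2"
  define P where "P = c * T * exp (a * T) + B * d"
  \<comment> \<open>\<open>M\<close> collects four demands on \<open>h\<close>: slopes at least 1/2,
    orbit within distance 1 of the path, final error at most \<open>\<epsilon>\<close>, and a loss
    of at most 1 in the exponent of the Jacobian bound.\<close>
  define M where "M = 2 * \<bar>K\<bar> + P + P / \<epsilon> + 2 * d * L * (P + d * B) * T"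
  have d0: "0 \<le> d" and a0: "0 \<le> a" and c0: "0 \<le> c"
    using L B0 by (auto simp: d_def a_def c_def)
  have P0: "0 \<le> P" using c0 T d0 B0 by (simp add: P_def)
  have J0: "0 \<le> 2 * d * L * (P + d * B) * T" using P0 d0 L B0 T by simp
  obtain n :: nat where n: "T * M < real n" using reals_Archimedean2 by blast
  have M0: "0 \<le> M" unfolding M_def using P0 \<epsilon> J0 by simp
  with n T have n0: "0 < n" by (metis gr0I leD mult_nonneg_nonneg of_nat_0 less_imp_le)
  define h where "h = T / real n"
  have h0: "0 < h" using T n0 by (simp add: h_def)
  have nh: "real n * h = T" using n0 by (simp add: h_def)
  have hM: "h * M \<le> 1" using n n0 by (simp add: h_def field_simps)
  have bd: "h * y \<le> 1" if "y \<le> M" for y using that hM h0 by (meson less_imp_le mult_left_mono order_trans)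
  have 1: "h * (2 * \<bar>K\<bar>) \<le> 1" "h * P \<le> 1" "h * (P / \<epsilon>) \<le> 1" "h * (2 * d * L * (P + d * B) * T) \<le> 1"
    by (rule bd, use P0 \<epsilon> J0 in \<open>simp add: M_def\<close>)+
  have "h * K \<le> h * \<bar>K\<bar>" using h0 by simp
  with 1(1) have hK: "h * K \<le> 1 / 2" by simp
  have "h * P = h * (P / \<epsilon>) * \<epsilon>" using \<epsilon> by simp
  also have "\<dots> \<le> 1 * \<epsilon>" using 1(3) \<epsilon> by (intro mult_right_mono) auto
  finally have hP: "h * P \<le> \<epsilon>" by simp
  have "norm (steps h (concat (replicate n bs0)) (z 0) - z T) \<le> \<epsilon> \<and>
      exp (- 2 * (Q T - Q 0) - 1) \<le> jac h (concat (replicate n bs0)) (z 0)"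
    if tr: "trajectory_until U T z Q" for z Q
  proof -
    from tr obtain q where q: "\<And>t. t \<in> {0..T} \<Longrightarrow> cball (z t) 1 \<subseteq> U"
      "\<And>t. t \<in> {0..T} \<Longrightarrow> (z has_vector_derivative F (z t)) (at t within {0..T})"
      "\<And>t. t \<in> {0..T} \<Longrightarrow> (Q has_real_derivative q t) (at t within {0..T})"
      "\<And>t. t \<in> {0..T} \<Longrightarrow> (\<Sum>b\<in>Basis. \<alpha> b (z t)) \<le> q t"
      unfolding trajectory_until_def by blast
    note track = steps_track_trajectory_explicit[of U B L T z Q q bs0 h n, folded d_def,
        folded a_def c_def, folded P_def, unfolded nh]
    have ex: "norm (steps h (concat (replicate n bs0)) (z 0) - z T) \<le> c * h\<^sup>2 * real n * (1 + h * a) ^ n"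
      "exp (- 2 * (Q T - Q 0) - 2 * d * L * (h * P + d * B * h) * T) \<le> jac h (concat (replicate n bs0)) (z 0)"
      by (rule track[OF B FL \<alpha>L L B0 q bs0 h0 hK 1(2) order_refl]; assumption)+
    have "(1 + h * a) ^ n \<le> exp (h * a) ^ n"
      using a0 h0 by (intro power_mono exp_ge_add_one_self) (auto simp: add_nonneg_nonneg)
    also have "\<dots> = exp (a * T)" using nh by (simp add: mult_ac flip: exp_of_nat_mult)
    finally have E: "(1 + h * a) ^ n \<le> exp (a * T)" .
    have "c * h\<^sup>2 * real n * (1 + h * a) ^ n = h * (c * T) * (1 + h * a) ^ n"
      by (simp add: power2_eq_square flip: nh)
    also have "\<dots> \<le> h * (c * T) * exp (a * T)"
      using E c0 T h0 by (intro mult_left_mono) auto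
    also have "\<dots> \<le> h * P" using h0 B0 d0 by (simp add: P_def algebra_simps)
    finally have "norm (steps h (concat (replicate n bs0)) (z 0) - z T) \<le> \<epsilon>"
      using ex(1) hP by simp
    moreover have "- 2 * (Q T - Q 0) - 1 \<le> - 2 * (Q T - Q 0) - 2 * d * L * (h * P + d * B * h) * T"
      using 1(4) by (simp add: algebra_simps)
    then have "exp (- 2 * (Q T - Q 0) - 1) \<le> jac h (concat (replicate n bs0)) (z 0)"
      using ex(2) by (meson exp_le_cancel_iff order_trans)
    ultimately show ?thesis by simp
  qed
  moreover have "set (concat (replicate n bs0)) \<subseteq> Basis" using bs0 by auto
  ultimately show ?thesis using h0 hK by (intro exI[of _ h] exI[of _ "concat (replicate n bs0)"]) auto
qed

text \<open>Volume transport without a flow: the approximating map sends \<open>A\<close> into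
  \<open>G\<close>, and on \<open>A\<close> its Jacobian is at least
  \<open>exp (- 2 * M - 1)\<close>, where the 1 is the allowance for discretization.
  \<open>A\<close> is an arbitrary subset of the cell, so the bound is stated for a Borel
  cover.\<close>

lemma emeasure_cover_trajectories:
  fixes U :: "'a set" and L B T \<epsilon> M :: real
  assumes U: "\<And>x b. x \<in> U \<Longrightarrow> b \<in> Basis \<Longrightarrow> \<bar>F x \<bullet> b\<bar> \<le> B"
      "\<And>x y b. x \<in> U \<Longrightarrow> y \<in> U \<Longrightarrow> b \<in> Basis \<Longrightarrow> \<bar>F x \<bullet> b - F y \<bullet> b\<bar> \<le> L * norm (x - y)"
      "\<And>x y b. x \<in> U \<Longrightarrow> y \<in> U \<Longrightarrow> b \<in> Basis \<Longrightarrow> \<bar>\<alpha> b x - \<alpha> b y\<bar> \<le> L * norm (x - y)"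
    and pos: "0 \<le> L" "0 \<le> B" "0 < T" "0 < \<epsilon>"
    and C: "C \<in> sets borel" and G: "G \<in> sets borel"
    and L: "countable \<Lambda>" "uminus ` \<Lambda> = \<Lambda>" "\<And>z. \<exists>!l. l \<in> \<Lambda> \<and> z + l \<in> C"
    and per: "\<And>z l. l \<in> \<Lambda> \<Longrightarrow> F (z + l) = F z" "\<And>b z l. l \<in> \<Lambda> \<Longrightarrow> \<alpha> b (z + l) = \<alpha> b z"
      "\<And>z l. l \<in> \<Lambda> \<Longrightarrow> z + l \<in> G \<longleftrightarrow> z \<in> G"
    and A: "A \<subseteq> C" "\<And>x. x \<in> A \<Longrightarrow> \<exists>z Q. z 0 = x \<and> trajectory_until U T z Q \<and> Q T - Q 0 \<le> M \<and> cball (z T) \<epsilon> \<subseteq> G"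
  shows "\<exists>S\<in>sets borel. A \<subseteq> S \<and> emeasure lborel S \<le> ennreal (exp (2 * M + 1)) * emeasure lborel (G \<inter> C)"
proof -
  obtain h bs where h: "0 \<le> h" "h * K < 1" and bs: "set bs \<subseteq> Basis"
    and tr: "\<And>z Q. trajectory_until U T z Q \<Longrightarrow>
      norm (steps h bs (z 0) - z T) \<le> \<epsilon> \<and> exp (- 2 * (Q T - Q 0) - 1) \<le> jac h bs (z 0)"
    using steps_track_trajectory[of U B L T \<epsilon>, OF U pos] by auto
  define c where "c = exp (- 2 * M - 1)"
  have c0: "0 \<le> c" by (simp add: c_def)
  define S where "S = {z\<in>C. steps h bs z \<in> G \<and> c \<le> jac h bs z}"
  note S = emeasure_steps_preimage_le[OF bs h c0 C G L per, folded S_def]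
  have "A \<subseteq> S"
  proof
    fix x assume x: "x \<in> A"
    from A(2)[OF this] obtain z Q where z: "z 0 = x" "trajectory_until U T z Q" "Q T - Q 0 \<le> M" "cball (z T) \<epsilon> \<subseteq> G"
      by auto
    have "steps h bs x \<in> cball (z T) \<epsilon>" using tr[OF z(2)] z(1) by (simp add: dist_norm norm_minus_commute)
    moreover have "c \<le> exp (- 2 * (Q T - Q 0) - 1)" using z(3) by (simp add: c_def)
    then have "c \<le> jac h bs x" using tr[OF z(2)] z(1) by simp
    ultimately show "x \<in> S" using z(4) A(1) x by (auto simp: S_def)
  qed
  moreover have "emeasure lborel S \<le> ennreal (exp (2 * M + 1)) * emeasure lborel (G \<inter> C)"
  proof -
    have "emeasure lborel S = ennreal (exp (2 * M + 1)) * (ennreal c * emeasure lborel S)"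
      by (simp add: c_def mult.assoc[symmetric] ennreal_mult[symmetric] flip: exp_add)
    also have "\<dots> \<le> ennreal (exp (2 * M + 1)) * emeasure lborel (G \<inter> C)"
      by (intro mult_left_mono S(2)) auto
    finally show ?thesis .
  qed
  ultimately show ?thesis using S(1) by blast
qed

end

section \<open>Symmetric consensus dynamics\<close>

lemma nonincreasing_halfline:
  fixes f :: "real \<Rightarrow> real"
  assumes "\<And>t. 0 \<le> t \<Longrightarrow> (f has_real_derivative f' t) (at t within {0..})"
    and "\<And>t. T \<le> t \<Longrightarrow> f' t \<le> 0" and "0 \<le> T" "T \<le> s" "s \<le> t"
  shows "f t \<le> f s"
proof (cases "s < t")
  case True
  have "(f has_derivative (*) (f' x)) (at x within {s..t})" if "s \<le> x" "x \<le> t" for x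
    using assms(1)[of x] that assms(3,4) unfolding has_field_derivative_def
    by (auto intro: has_derivative_subset)
  then obtain x where "x \<in> {s<..<t}" "f t - f s = f' x * (t - s)"
    using mvt_simple[OF True, of f "\<lambda>x. (*) (f' x)"] by auto
  moreover from this have "f' x * (t - s) \<le> 0"
    using assms(2)[of x] assms(4) True by (intro mult_nonpos_nonneg) auto
  ultimately show ?thesis by simp
qed (use assms in auto)

lemma antimono_bounded_below_tendsto:
  fixes f :: "real \<Rightarrow> real"
  assumes mono: "\<And>s t. T \<le> s \<Longrightarrow> s \<le> t \<Longrightarrow> f t \<le> f s" and bd: "\<And>t. T \<le> t \<Longrightarrow> c \<le> f t"
  shows "\<exists>l. (f \<longlongrightarrow> l) at_top"
proof
  have bdd: "bdd_below (f ` {T..})" using bd by (auto intro: bdd_belowI[of _ c])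
  show "(f \<longlongrightarrow> (INF t\<in>{T..}. f t)) at_top"
  proof (rule decreasing_tendsto)
    show "\<forall>\<^sub>F t in at_top. (INF t\<in>{T..}. f t) \<le> f t"
      using eventually_ge_at_top[of T] by eventually_elim (use bdd in \<open>auto intro: cINF_lower\<close>)
  next
    fix x assume "(INF t\<in>{T..}. f t) < x"
    then obtain s where s: "T \<le> s" "f s < x"
      using cINF_less_iff[OF _ bdd] by auto
    show "\<forall>\<^sub>F t in at_top. f t < x"
      using eventually_ge_at_top[of s] by eventually_elim (use mono[OF s(1)] s(2) in fastforce)
  qed
qed

text \<open>A bounded function whose lower and upper limits agree converges. Here they differ, and
  \<open>\<alpha>\<close> and \<open>\<beta>\<close> are picked strictly between them.\<close>

lemma bounded_not_convergent_oscillates: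
  fixes a :: "real \<Rightarrow> real"
  assumes bd: "\<forall>\<^sub>F t in at_top. \<bar>a t\<bar> \<le> R" and nc: "\<nexists>l. (a \<longlongrightarrow> l) at_top"
  shows "\<exists>\<alpha> \<beta>. \<alpha> < \<beta> \<and> (\<exists>\<^sub>F t in at_top. a t \<le> \<alpha>) \<and> (\<exists>\<^sub>F t in at_top. \<beta> \<le> a t)"
proof -
  define X where "X t = ereal (a t)" for t
  have bd1: "\<forall>\<^sub>F t in at_top. ereal (- R) \<le> X t" and bd2: "\<forall>\<^sub>F t in at_top. X t \<le> ereal R"
    using bd by (auto simp: X_def elim!: eventually_mono)
  have lo: "ereal (- R) \<le> Liminf at_top X" using bd1 by (rule Liminf_bounded)
  have hi: "Limsup at_top X \<le> ereal R" using bd2 by (rule Limsup_bounded)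
  have le: "Liminf at_top X \<le> Limsup at_top X" by (intro Liminf_le_Limsup) simp
  have "Liminf at_top X \<noteq> Limsup at_top X"
  proof
    assume eq: "Liminf at_top X = Limsup at_top X"
    obtain l where l: "Limsup at_top X = ereal l"
      using lo hi unfolding eq by (cases "Limsup at_top X") auto
    have "(X \<longlongrightarrow> ereal l) at_top"
      using eq l by (subst tendsto_iff_Liminf_eq_Limsup) auto
    then have "(a \<longlongrightarrow> l) at_top" by (simp add: X_def[abs_def])
    then show False using nc by blast
  qed
  with le have "Liminf at_top X < Limsup at_top X" by simp
  then obtain \<alpha> where \<alpha>: "Liminf at_top X < ereal \<alpha>" "ereal \<alpha> < Limsup at_top X"
    using ereal_dense2 by blast
  then obtain \<beta> where \<beta>: "ereal \<alpha> < ereal \<beta>" "ereal \<beta> < Limsup at_top X"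
    using ereal_dense2 by blast
  have "\<not> (\<forall>\<^sub>F t in at_top. ereal \<alpha> \<le> X t)"
    using Liminf_bounded[of "ereal \<alpha>" X at_top] \<alpha>(1) by auto
  then have "\<exists>\<^sub>F t in at_top. a t \<le> \<alpha>"
    unfolding frequently_def by (rule contrapos_nn) (auto simp: X_def elim!: eventually_mono)
  moreover have "\<not> (\<forall>\<^sub>F t in at_top. X t \<le> ereal \<beta>)"
    using Limsup_bounded[of X "ereal \<beta>" at_top] \<beta>(2) by auto
  then have "\<exists>\<^sub>F t in at_top. \<beta> \<le> a t"
    unfolding frequently_def by (rule contrapos_nn) (auto simp: X_def elim!: eventually_mono)
  ultimately show ?thesis using \<beta>(1) by auto
qed

text \<open>The square makes the truncated power differentiable everywhere with a monotone
  derivative, as the convexity argument for the consensus dynamics demands.\<close>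

definition pos_square :: "real \<Rightarrow> real" where
  "pos_square x = (max 0 x)\<^sup>2"

lemma DERIV_pos_square: "(pos_square has_real_derivative 2 * max 0 x) (at x)"
proof -
  consider "x < 0" | "x > 0" | "x = 0" by linarith
  then show ?thesis
  proof cases
    case 1
    have "((\<lambda>_. 0) has_real_derivative 2 * max 0 x) (at x)" using 1 by simp
    then show ?thesis
      by (rule has_field_derivative_transform_within_open[of _ _ _ "{..<0}"])
        (use 1 in \<open>auto simp: pos_square_def\<close>)
  next
    case 2
    have "((\<lambda>y. y\<^sup>2) has_real_derivative 2 * max 0 x) (at x)"
      using 2 by (auto intro!: derivative_eq_intros)
    then show ?thesis
      by (rule has_field_derivative_transform_within_open[of _ _ _ "{0<..}"])
        (use 2 in \<open>auto simp: pos_square_def\<close>)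
  next
    case 3
    have "((\<lambda>h. pos_square h / h) \<longlongrightarrow> 0) (at 0)"
    proof (rule Lim_null_comparison)
      show "\<forall>\<^sub>F h in at 0. norm (pos_square h / h) \<le> \<bar>h\<bar>"
        by (intro always_eventually) (auto simp: pos_square_def max_def power2_eq_square)
      show "((\<lambda>h::real. \<bar>h\<bar>) \<longlongrightarrow> 0) (at 0)" by (auto intro!: tendsto_eq_intros)
    qed
    then show ?thesis using 3 by (simp add: DERIV_def pos_square_def)
  qed
qed

text \<open>The quadratic B-spline, written as a combination of convex \<open>C\<^sup>1\<close> functions: a consensus
  dynamics decreases the sum of the values of any such function.\<close>

definition bspline :: "real \<Rightarrow> real \<Rightarrow> real \<Rightarrow> real" where
  "bspline r u x = pos_square (x - u) - 3 * pos_square (x - (u + r)) +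
    3 * pos_square (x - (u + 2 * r)) - pos_square (x - (u + 3 * r))"

text \<open>Beyond the last knot all four truncations are inactive and leave a third difference of a
  quadratic, which is zero.\<close>

lemma bspline_outside:
  assumes "0 < r" "x \<le> u \<or> u + 3 * r \<le> x"
  shows "bspline r u x = 0"
  using assms by (auto simp: bspline_def pos_square_def max_def power2_eq_square algebra_simps)

lemma bspline_nonneg:
  assumes "0 < r"
  shows "0 \<le> bspline r u x"
proof -
  define y where "y = x - u"
  have eq: "bspline r u x = pos_square y - 3 * pos_square (y - r) + 3 * pos_square (y - 2 * r) - pos_square (y - 3 * r)"
    by (simp add: bspline_def y_def algebra_simps)
  consider "y \<le> 0 \<or> 3 * r \<le> y" | "0 < y" "y \<le> r" | "r < y" "y \<le> 2 * r" | "2 * r < y" "y < 3 * r"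
    by linarith
  then show ?thesis
  proof cases
    case 1
    then show ?thesis using bspline_outside[OF assms, of x u] by (auto simp: y_def)
  next
    case 2
    then show ?thesis using assms by (simp add: eq pos_square_def max_def)
  next
    case 3
    have "y\<^sup>2 - 3 * (y - r)\<^sup>2 = 2 * ((y - r) * (2 * r - y)) + r\<^sup>2"
      by (simp add: power2_eq_square algebra_simps)
    moreover have "0 \<le> (y - r) * (2 * r - y)" using 3 by simp
    ultimately have "0 \<le> y\<^sup>2 - 3 * (y - r)\<^sup>2" by simp
    then show ?thesis using 3 assms by (simp add: eq pos_square_def max_def)
  next
    case 4
    \<comment> \<open>By the same vanishing third difference, the three active terms add up to the
      square of the distance to the last knot.\<close>
    have "y\<^sup>2 - 3 * (y - r)\<^sup>2 + 3 * (y - 2 * r)\<^sup>2 = (3 * r - y)\<^sup>2"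
      by (simp add: power2_eq_square algebra_simps)
    then show ?thesis using 4 assms by (simp add: eq pos_square_def max_def)
  qed
qed

lemma bspline_mid: "0 < r \<Longrightarrow> bspline r u (u + 3 / 2 * r) = 3 / 2 * r\<^sup>2"
  by (auto simp: bspline_def pos_square_def max_def power2_eq_square algebra_simps)

section \<open>Convergence of scalar consensus dynamics\<close>

locale symmetric_consensus =
  fixes a :: "real \<Rightarrow> 'N::finite \<Rightarrow> real" and m :: "'N \<Rightarrow> 'N \<Rightarrow> real \<Rightarrow> real"
  assumes m_nonneg: "0 \<le> t \<Longrightarrow> 0 \<le> m i j t" and m_sym: "m i j t = m j i t"
    and a': "0 \<le> t \<Longrightarrow>
      ((\<lambda>s. a s i) has_real_derivative (\<Sum>j\<in>UNIV. m i j t * (a t j - a t i))) (at t within {0..})"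
begin

text \<open>Exchanging \<open>i\<close> and \<open>j\<close> and using the symmetry of
  \<open>m\<close>, twice the derivative becomes minus the double sum of
  \<open>m i j t * ((a t j - a t i) * (f' (a t j) - f' (a t i)))\<close>. Each term is nonnegative
  because \<open>f'\<close> is monotone.\<close>

lemma sum_convex_nonincreasing:
  assumes f: "\<And>x. (f has_real_derivative f' x) (at x)" and mono: "mono f'"
    and "0 \<le> s" "s \<le> t"
  shows "(\<Sum>i\<in>UNIV. f (a t i)) \<le> (\<Sum>i\<in>UNIV. f (a s i))"
proof (rule nonincreasing_halfline[where T = 0 and f = "\<lambda>t. \<Sum>i\<in>UNIV. f (a t i)"])
  fix t :: real assume t: "0 \<le> t"
  define D where "D = (\<Sum>i\<in>UNIV. f' (a t i) * (\<Sum>j\<in>UNIV. m i j t * (a t j - a t i)))"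
  show "((\<lambda>t. \<Sum>i\<in>UNIV. f (a t i)) has_real_derivative
      (\<Sum>i\<in>UNIV. f' (a t i) * (\<Sum>j\<in>UNIV. m i j t * (a t j - a t i)))) (at t within {0..})"
    by (intro DERIV_sum DERIV_chain2[OF f a'[OF t]])
  have 1: "D = (\<Sum>i\<in>UNIV. \<Sum>j\<in>UNIV. m i j t * (a t j - a t i) * f' (a t i))"
    by (simp add: D_def sum_distrib_left mult_ac)
  have "D = (\<Sum>i\<in>UNIV. \<Sum>j\<in>UNIV. m j i t * (a t i - a t j) * f' (a t j))"
    by (subst 1) (rule sum.swap)
  also have "\<dots> = (\<Sum>i\<in>UNIV. \<Sum>j\<in>UNIV. - (m i j t * (a t j - a t i) * f' (a t j)))"
    by (intro sum.cong refl) (simp add: m_sym algebra_simps)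
  finally have "D + D = (\<Sum>i\<in>UNIV. \<Sum>j\<in>UNIV. - (m i j t * ((a t j - a t i) * (f' (a t j) - f' (a t i)))))"
    by (subst (1) 1) (simp add: sum.distrib[symmetric] algebra_simps)
  also have "\<dots> \<le> 0"
  proof (intro sum_nonpos)
    fix i j
    have "0 \<le> (a t j - a t i) * (f' (a t j) - f' (a t i))"
      using monoD[OF mono, of "a t i" "a t j"] monoD[OF mono, of "a t j" "a t i"]
      by (cases "a t i \<le> a t j") (auto intro: mult_nonneg_nonneg mult_nonpos_nonpos)
    then show "- (m i j t * ((a t j - a t i) * (f' (a t j) - f' (a t i)))) \<le> 0"
      using m_nonneg[OF t] by simp
  qed
  finally show "(\<Sum>i\<in>UNIV. f' (a t i) * (\<Sum>j\<in>UNIV. m i j t * (a t j - a t i))) \<le> 0"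
    by (simp add: D_def)
qed (use assms in auto)

text \<open>The spline sum itself need not be monotone, but it is a fixed linear combination of four
  sums that are nonincreasing and bounded below by 0.\<close>

lemma sum_bspline_converges: "\<exists>l. ((\<lambda>t. \<Sum>i\<in>UNIV. bspline r u (a t i)) \<longlongrightarrow> l) at_top"
proof -
  have "\<exists>l. ((\<lambda>t. \<Sum>i\<in>UNIV. pos_square (a t i - c)) \<longlongrightarrow> l) at_top" for c
  proof (rule antimono_bounded_below_tendsto)
    fix s t :: real assume "0 \<le> s" "s \<le> t"
    have "((\<lambda>x. pos_square (x - c)) has_real_derivative 2 * max 0 (x - c)) (at x)" for x
      by (rule DERIV_cong[OF DERIV_chain2[OF DERIV_pos_square]]) (auto intro!: derivative_eq_intros)
    then show "(\<Sum>i\<in>UNIV. pos_square (a t i - c)) \<le> (\<Sum>i\<in>UNIV. pos_square (a s i - c))"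
      by (rule sum_convex_nonincreasing[of _ "\<lambda>x. 2 * max 0 (x - c)"])
        (use \<open>0 \<le> s\<close> \<open>s \<le> t\<close> in \<open>auto intro!: monoI\<close>)
  qed (auto intro: sum_nonneg simp: pos_square_def)
  then obtain l where l: "\<And>c. ((\<lambda>t. \<Sum>i\<in>UNIV. pos_square (a t i - c)) \<longlongrightarrow> l c) at_top"
    by metis
  have "(\<lambda>t. \<Sum>i\<in>UNIV. bspline r u (a t i)) =
    (\<lambda>t. (\<Sum>i\<in>UNIV. pos_square (a t i - u)) - 3 * (\<Sum>i\<in>UNIV. pos_square (a t i - (u + r))) +
      3 * (\<Sum>i\<in>UNIV. pos_square (a t i - (u + 2 * r))) - (\<Sum>i\<in>UNIV. pos_square (a t i - (u + 3 * r))))"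
    by (simp add: bspline_def sum.distrib sum_subtractf sum_distrib_left)
  moreover have "(\<dots> \<longlongrightarrow> l u - 3 * l (u + r) + 3 * l (u + 2 * r) - l (u + 3 * r)) at_top"
    by (intro tendsto_intros l)
  ultimately show ?thesis by auto
qed

lemma bounded: "\<exists>R. \<forall>t\<ge>0. \<bar>a t i\<bar> \<le> R"
proof -
  define E where "E = (\<Sum>i\<in>UNIV. (a 0 i)\<^sup>2)"
  have "\<bar>a t i\<bar> \<le> sqrt E" if t: "0 \<le> t" for t
  proof -
    have "(a t i)\<^sup>2 \<le> (\<Sum>i\<in>UNIV. (a t i)\<^sup>2)" by (rule member_le_sum) auto
    also have "\<dots> \<le> E" unfolding E_def
      by (rule sum_convex_nonincreasing[of "\<lambda>x. x\<^sup>2" "\<lambda>x. 2 * x"])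
        (use t in \<open>auto intro!: monoI derivative_eq_intros\<close>)
    finally show ?thesis using real_le_rsqrt[of "\<bar>a t i\<bar>" E] by simp
  qed
  then show ?thesis by auto
qed

lemma frequently_attained:
  assumes "\<exists>\<^sub>F t in at_top. a t i \<le> \<alpha>" "\<exists>\<^sub>F t in at_top. \<beta> \<le> a t i" "\<alpha> \<le> c" "c \<le> \<beta>"
  shows "\<exists>\<^sub>F t in at_top. a t i = c"
proof -
  have freq: "(\<exists>\<^sub>F t in at_top. P t) \<longleftrightarrow> (\<forall>T. \<exists>t\<ge>T. P t)" for P :: "real \<Rightarrow> bool"
    by (auto simp: frequently_def eventually_at_top_linorder)
  have "\<exists>t\<ge>T. a t i = c" for T
  proof -
    obtain s where s: "max T 0 \<le> s" "a s i \<le> \<alpha>" using assms(1) unfolding freq by meson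
    obtain s' where s': "max T 0 \<le> s'" "\<beta> \<le> a s' i" using assms(2) unfolding freq by meson
    have "continuous_on {0..} (\<lambda>t. a t i)"
      using a' by (auto simp: continuous_on_eq_continuous_within intro!: DERIV_continuous)
    then have "connected ((\<lambda>t. a t i) ` {min s s'..max s s'})"
      using s s' by (intro connected_continuous_image) (auto elim!: continuous_on_subset)
    then have "c \<in> (\<lambda>t. a t i) ` {min s s'..max s s'}"
      by (rule connectedD_interval[where x = "a s i" and y = "a s' i"]) (use s s' assms in auto)
    then obtain t where "a t i = c" "min s s' \<le> t" by auto
    then show ?thesis using s s' by (intro exI[of _ t]) auto
  qed
  then show ?thesis unfolding freq by blast
qed

text \<open>An oscillating component would frequently visit any number of disjoint intervals. By
  convergence of the spline sums, each of these would finally always contain some component.\<close>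

theorem converges: "\<exists>l. ((\<lambda>t. a t i) \<longlongrightarrow> l) at_top"
proof (rule ccontr)
  assume nc: "\<not> ?thesis"
  obtain R where "\<And>t. 0 \<le> t \<Longrightarrow> \<bar>a t i\<bar> \<le> R" using bounded by blast
  then have "\<forall>\<^sub>F t in at_top. \<bar>a t i\<bar> \<le> R"
    by (intro eventually_mono[OF eventually_ge_at_top[of 0]]) auto
  from bounded_not_convergent_oscillates[OF this] nc obtain \<alpha> \<beta> where
    \<alpha>\<beta>: "\<alpha> < \<beta>" "\<exists>\<^sub>F t in at_top. a t i \<le> \<alpha>" "\<exists>\<^sub>F t in at_top. \<beta> \<le> a t i" by blast
  define n where "n = CARD('N)"
  \<comment> \<open>The interval from \<open>\<alpha>\<close> to \<open>\<beta>\<close> is cut into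
    \<open>n + 1\<close> supports of length \<open>3 * r\<close>, one more than there are
    components.\<close>
  define r where "r = (\<beta> - \<alpha>) / 3 / (real n + 1)"
  define u where "u k = \<alpha> + 3 * r * real k" for k
  have r: "0 < r" using \<alpha>\<beta>(1) by (simp add: r_def)
  have rn: "3 * r * (real n + 1) = \<beta> - \<alpha>"
  proof -
    have "r * (real n + 1) = (\<beta> - \<alpha>) / 3" unfolding r_def 
      by (rule nonzero_eq_divide_eq[THEN iffD1, OF _ refl]) linarith
    then show ?thesis by simp
  qed
  have ev: "\<forall>\<^sub>F t in at_top. \<exists>j. u k < a t j \<and> a t j < u (Suc k)" if k: "k \<le> n" for k
  proof -
    define S where "S t = (\<Sum>i\<in>UNIV. bspline r (u k) (a t i))" for t
    obtain l where l: "(S \<longlongrightarrow> l) at_top" using sum_bspline_converges[of r "u k"] by (auto simp: S_def[abs_def])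
    have u3: "u (Suc k) = u k + 3 * r" by (simp add: u_def algebra_simps)
    have "3 * r * real k \<le> 3 * r * real n" using k r by (intro mult_left_mono) auto
    moreover have "3 * r * real n + 3 * r = \<beta> - \<alpha>" using rn by (simp add: algebra_simps)
    ultimately have "u k + 3 / 2 * r \<le> \<beta>" unfolding u_def using r by linarith
    moreover have "\<alpha> \<le> u k + 3 / 2 * r" using r by (simp add: u_def)
    ultimately have "\<exists>\<^sub>F t in at_top. a t i = u k + 3 / 2 * r"
      by (intro frequently_attained[OF \<alpha>\<beta>(2,3)]) auto
    \<comment> \<open>The oscillating component passes through the centre of the spline at
      arbitrarily late times, so the limit of the spline sum is at least the central value, in
      particular positive.\<close>
    then have "\<exists>\<^sub>F t in at_top. 3 / 2 * r\<^sup>2 \<le> S t"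
    proof (rule frequently_elim1)
      fix t assume "a t i = u k + 3 / 2 * r"
      then have "3 / 2 * r\<^sup>2 = bspline r (u k) (a t i)" using bspline_mid[OF r] by simp
      also have "\<dots> \<le> S t" unfolding S_def
        by (rule member_le_sum) (auto intro: bspline_nonneg[OF r])
      finally show "3 / 2 * r\<^sup>2 \<le> S t" .
    qed
    then have "\<not> l < 3 / 2 * r\<^sup>2"
      using order_tendstoD(2)[OF l, of "3 / 2 * r\<^sup>2"] by (auto simp: frequently_def not_le)
    moreover have "0 < 3 / 2 * r\<^sup>2" using r by simp
    ultimately have "0 < l" by linarith
    with l have "\<forall>\<^sub>F t in at_top. 0 < S t" by (auto dest: order_tendstoD)
    then show ?thesis
    proof eventually_elim
      case (elim t)
      show ?case
      proof (rule ccontr)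
        assume "\<not> ?case"
        then have "S t = 0" unfolding S_def u3
          by (intro sum.neutral ballI bspline_outside[OF r]) (auto simp: not_less)
        with elim show False by simp
      qed
    qed
  qed
  have "\<forall>\<^sub>F t in at_top. \<forall>k\<in>{..n}. \<exists>j. u k < a t j \<and> a t j < u (Suc k)"
    using ev by (intro eventually_ball_finite) auto
  then obtain t where "\<forall>k\<in>{..n}. \<exists>j. u k < a t j \<and> a t j < u (Suc k)"
    using eventually_happens'[OF trivial_limit_at_top_linorder] by blast
  then obtain J where J: "\<And>k. k \<le> n \<Longrightarrow> u k < a t (J k) \<and> a t (J k) < u (Suc k)" by (metis atMost_iff)
  have mono_u: "u k \<le> u k'" if "k \<le> k'" for k k'
    using that r by (simp add: u_def mult_left_mono)
  \<comment> \<open>All these disjoint intervals are occupied at one common time, which takes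
    \<open>n + 1\<close> different components.\<close>
  have "inj_on J {..n}"
  proof (rule linorder_inj_onI)
    fix k k' assume "k < k'" "k \<in> {..n}" "k' \<in> {..n}"
    then have "a t (J k) < a t (J k')" using J[of k] J[of k'] mono_u[of "Suc k" k'] by auto
    then show "J k \<noteq> J k'" by auto
  qed auto
  then have "card {..n} \<le> CARD('N)" by (intro card_inj_on_le[of J]) auto
  then show False by (simp add: n_def)
qed

end

section \<open>The lifted Cucker-Smale field\<close>

lemma norm_fst_diff_le: "norm (fst x - fst y) \<le> norm (x - y)"
  and norm_snd_diff_le: "norm (snd x - snd y) \<le> norm (x - y)"
  by (metis fst_diff norm_fst_le prod.collapse, metis snd_diff norm_snd_le prod.collapse)

text \<open>The kernel pulled back to the covering space, where ordinary calculus applies;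
  \<open>\<Lambda>\<close> is a Lipschitz constant and \<open>H\<close> an upper bound.\<close>

locale periodic_kernel =
  fixes \<Phi> :: "real ^ 'n::finite \<Rightarrow> real" and \<Lambda> H :: real
  assumes \<Phi>_nonneg: "0 \<le> \<Phi> X" and \<Phi>_even: "\<Phi> (- X) = \<Phi> X"
    and \<Phi>_periodic: "(\<And>k. \<exists>m::int. l $ k = 2 * pi * of_int m) \<Longrightarrow> \<Phi> (X + l) = \<Phi> X"
    and \<Phi>_lipschitz: "\<bar>\<Phi> X - \<Phi> Y\<bar> \<le> \<Lambda> * norm (X - Y)"
    and \<Phi>_le: "\<Phi> X \<le> H" and \<Phi>_0: "0 < \<Phi> 0"
begin

definition accel :: "(real ^ 'n) ^ 'N \<Rightarrow> (real ^ 'n) ^ 'N \<Rightarrow> (real ^ 'n) ^ 'N::finite" where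
  "accel X V = (\<chi> i. (1 / real CARD('N)) *\<^sub>R (\<Sum>j\<in>UNIV. \<Phi> (X $ i - X $ j) *\<^sub>R (V $ j - V $ i)))"

definition cs_field :: "((real ^ 'n) ^ 'N) \<times> ((real ^ 'n) ^ 'N) \<Rightarrow> ((real ^ 'n) ^ 'N::finite) \<times> ((real ^ 'n) ^ 'N)" where
  "cs_field z = (snd z, accel (fst z) (snd z))"

text \<open>The term \<open>j = i\<close> is left out because it contributes nothing to the
  acceleration. What remains is the coefficient of \<open>- V $ i\<close> in the acceleration of
  agent \<open>i\<close>.\<close>

definition rate :: "'N \<Rightarrow> (real ^ 'n) ^ 'N::finite \<Rightarrow> real" where
  "rate i X = (\<Sum>j\<in>UNIV - {i}. \<Phi> (X $ i - X $ j)) / real CARD('N)"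

text \<open>\<open>cs_damping b\<close> is minus the derivative of the field's \<open>b\<close>-component in direction \<open>b\<close>; for a
  basis vector \<open>b\<close> the weight \<open>norm (snd b $ i)\<close> is \<open>1\<close> if \<open>b\<close> is a velocity direction of agent \<open>i\<close>
  and \<open>0\<close> otherwise.\<close>

definition cs_damping :: "((real ^ 'n) ^ 'N) \<times> ((real ^ 'n) ^ 'N) \<Rightarrow> ((real ^ 'n) ^ 'N::finite) \<times> ((real ^ 'n) ^ 'N) \<Rightarrow> real" where
  "cs_damping b z = (\<Sum>i\<in>UNIV. norm (snd b $ i) * rate i (fst z))"

lemma \<Lambda>_nonneg: "0 \<le> \<Lambda>"
proof -
  have "0 \<le> \<Lambda> * norm (axis undefined 1 :: real ^ 'n)"
    using \<Phi>_lipschitz[of "axis undefined 1" 0] by (simp add: order_trans[OF abs_ge_zero])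
  then show ?thesis by simp
qed

lemma H_pos: "0 < H" using \<Phi>_le[of 0] \<Phi>_0 by simp

lemma continuous_\<Phi>: "continuous_on UNIV \<Phi>"
proof -
  have "\<Lambda>-lipschitz_on UNIV \<Phi>"
    by (intro lipschitz_onI) (auto simp: dist_norm \<Phi>_lipschitz \<Lambda>_nonneg)
  then show ?thesis by (rule lipschitz_on_continuous_on)
qed

lemma continuous_\<Phi>_compose[continuous_intros]:
  "continuous_on S f \<Longrightarrow> continuous_on S (\<lambda>x. \<Phi> (f x))"
  by (rule continuous_on_compose2[OF continuous_\<Phi>]) auto

lemma rate_nonneg: "0 \<le> rate i X"
  unfolding rate_def by (intro divide_nonneg_nonneg sum_nonneg) (auto simp: \<Phi>_nonneg)

lemma rate_le: "rate (i::'N::finite) X \<le> H"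
proof -
  have "(\<Sum>j\<in>UNIV - {i}. \<Phi> (X $ i - X $ j)) \<le> (\<Sum>j\<in>(UNIV::'N set). \<Phi> (X $ i - X $ j))"
    by (rule sum_mono2) (auto simp: \<Phi>_nonneg)
  also have "\<dots> \<le> real CARD('N) * H"
    using sum_bounded_above[of "UNIV :: 'N set" "\<lambda>j. \<Phi> (X $ i - X $ j)" H] \<Phi>_le by simp
  finally show ?thesis by (simp add: rate_def field_simps)
qed

lemma cs_Basis_cases:
  fixes b :: "((real ^ 'n) ^ 'N) \<times> ((real ^ 'n) ^ 'N::finite)"
  assumes "b \<in> Basis"
  obtains u where "b = (u, 0)" "u \<in> Basis" | i u where "b = (0, axis i u)" "u \<in> Basis" "norm u = 1"
proof -
  consider u where "b = (u, 0)" "u \<in> Basis" | v where "b = (0, v)" "v \<in> Basis"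
    using assms unfolding Basis_prod_def by auto
  then show ?thesis
  proof cases
    case (2 v)
    then obtain i u where "v = axis i u" "u \<in> Basis" unfolding Basis_vec_def[where 'a = "real ^ 'n"] by auto
    with 2 show ?thesis using that(2) norm_Basis by blast
  qed (rule that(1))
qed

lemma snd_Basis_le:
  fixes b :: "((real ^ 'n) ^ 'N) \<times> ((real ^ 'n) ^ 'N::finite)"
  assumes "b \<in> Basis"
  shows "norm (snd b $ i) \<le> 1"
  using Finite_Cartesian_Product.norm_nth_le[of "snd b" i] norm_snd_le[of "snd b" "fst b"] assms by simp

lemma cs_damping_le:
  assumes "b \<in> Basis"
  shows "cs_damping b z \<le> (\<Sum>i\<in>UNIV. rate i (fst z))"
  unfolding cs_damping_def
  by (intro sum_mono mult_left_le_one_le) (auto simp: rate_nonneg snd_Basis_le[OF assms])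

lemma accel_inner_axis:
  "accel X V \<bullet> axis i u = (\<Sum>j\<in>UNIV. \<Phi> (X $ i - X $ j) * ((V $ j - V $ i) \<bullet> u)) / real CARD('N)"
  for X V :: "(real ^ 'n) ^ 'N::finite"
  by (simp add: accel_def inner_axis inner_sum_left)

text \<open>The position components of the field are velocities and do not involve positions. The
  velocity of agent \<open>i\<close> enters its own acceleration with the coefficient
  \<open>- rate i\<close>, which depends on positions only.\<close>

sublocale cs: coordinate_affine_field cs_field
  "cs_damping :: ((real ^ 'n) ^ 'N::finite) \<times> ((real ^ 'n) ^ 'N) \<Rightarrow> _" "real CARD('N) * H"
proof
  show "continuous_on UNIV (cs_field :: ((real ^ 'n) ^ 'N) \<times> ((real ^ 'n) ^ 'N) \<Rightarrow> _)"
    unfolding cs_field_def accel_def by (intro continuous_intros continuous_on_vec_lambda)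
next
  fix b z :: "((real ^ 'n) ^ 'N) \<times> ((real ^ 'n) ^ 'N)" and s :: real
  assume b: "b \<in> Basis"
  show "continuous_on UNIV (cs_damping b)"
    unfolding cs_damping_def rate_def by (intro continuous_intros) auto
  show "0 \<le> cs_damping b z"
    unfolding cs_damping_def by (intro sum_nonneg mult_nonneg_nonneg rate_nonneg norm_ge_zero)
  have "cs_damping b z \<le> (\<Sum>i\<in>UNIV. rate i (fst z))" by (rule cs_damping_le[OF b])
  also have "\<dots> \<le> real CARD('N) * H"
    using sum_bounded_above[of "UNIV :: 'N set" "\<lambda>i. rate i (fst z)" H] rate_le[of _ "fst z"] by simp
  finally show "cs_damping b z \<le> real CARD('N) * H" .
  obtain X V where z: "z = (X, V)" by (cases z)
  from b show "cs_field (z + s *\<^sub>R b) \<bullet> b = cs_field z \<bullet> b - cs_damping b z * s"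
  proof (cases rule: cs_Basis_cases)
    case (1 u)
    then show ?thesis by (simp add: cs_field_def cs_damping_def)
  next
    case (2 i u)
    have damp: "cs_damping b z = rate i X"
      using 2 by (simp add: cs_damping_def z axis_def if_distrib[of norm] if_distrib[of "\<lambda>x. x * _"] cong: if_cong)
    \<comment> \<open>Moving the velocity of agent \<open>i\<close> by \<open>s\<close> along
      \<open>u\<close> changes every difference to another agent by \<open>- s\<close> in that
      direction and leaves the term \<open>j = i\<close> at zero.\<close>
    have "(\<Sum>j\<in>UNIV. \<Phi> (X $ i - X $ j) * (((V + s *\<^sub>R axis i u) $ j - (V + s *\<^sub>R axis i u) $ i) \<bullet> u)) =
      (\<Sum>j\<in>UNIV. \<Phi> (X $ i - X $ j) * ((V $ j - V $ i) \<bullet> u) - (if j \<in> UNIV - {i} then \<Phi> (X $ i - X $ j) * s else 0))"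
      using 2 by (intro sum.cong refl) (auto simp: axis_def algebra_simps dot_square_norm)
    also have "\<dots> = (\<Sum>j\<in>UNIV. \<Phi> (X $ i - X $ j) * ((V $ j - V $ i) \<bullet> u)) - (\<Sum>j\<in>UNIV - {i}. \<Phi> (X $ i - X $ j) * s)"
      by (simp only: sum_subtractf sum.inter_restrict[symmetric, OF finite] Int_UNIV_left)
    also have "(\<Sum>j\<in>UNIV - {i}. \<Phi> (X $ i - X $ j) * s) = real CARD('N) * rate i X * s"
      by (simp add: rate_def sum_distrib_right)
    finally show ?thesis
      unfolding damp using 2 by (simp add: z cs_field_def accel_inner_axis diff_divide_distrib)
  qed
  from b show "cs_damping b (z + s *\<^sub>R b) = cs_damping b z"
  proof (cases rule: cs_Basis_cases)
    case (1 u)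
    then show ?thesis by (simp add: cs_damping_def)
  next
    case (2 i u)
    then show ?thesis by (simp add: cs_damping_def)
  qed
qed

text \<open>The field grows with the velocities, so its bounds hold for bounded speed only;
  solutions respect such a bound because their energy does not increase. Positions are left free, as
  the bounds on the kernel are global.\<close>

definition slab :: "real \<Rightarrow> (((real ^ 'n) ^ 'N::finite) \<times> ((real ^ 'n) ^ 'N)) set" where
  "slab R = {z. norm (snd z) \<le> R}"

lemma norm_pair_components:
  fixes x y :: "((real ^ 'n) ^ 'N::finite) \<times> ((real ^ 'n) ^ 'N)"
  shows "norm (fst x $ i - fst y $ i) \<le> norm (x - y)" "norm (snd x $ i - snd y $ i) \<le> norm (x - y)"
  using Finite_Cartesian_Product.norm_nth_le[of "fst x - fst y" i] norm_fst_diff_le[of x y]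
    Finite_Cartesian_Product.norm_nth_le[of "snd x - snd y" i] norm_snd_diff_le[of x y]
  by auto

lemma \<Phi>_diff_le:
  fixes x y :: "((real ^ 'n) ^ 'N::finite) \<times> ((real ^ 'n) ^ 'N)"
  shows "\<bar>\<Phi> (fst x $ i - fst x $ j) - \<Phi> (fst y $ i - fst y $ j)\<bar> \<le> 2 * \<Lambda> * norm (x - y)"
proof -
  have "norm ((fst x $ i - fst x $ j) - (fst y $ i - fst y $ j)) =
    norm ((fst x $ i - fst y $ i) - (fst x $ j - fst y $ j))" by (simp add: algebra_simps)
  also have "\<dots> \<le> 2 * norm (x - y)"
    using norm_triangle_ineq4[of "fst x $ i - fst y $ i" "fst x $ j - fst y $ j"]
      norm_pair_components(1)[of x i y] norm_pair_components(1)[of x j y] by simp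
  finally have "\<Lambda> * norm ((fst x $ i - fst x $ j) - (fst y $ i - fst y $ j)) \<le> \<Lambda> * (2 * norm (x - y))"
    using \<Lambda>_nonneg by (rule mult_left_mono)
  then show ?thesis using \<Phi>_lipschitz[of "fst x $ i - fst x $ j" "fst y $ i - fst y $ j"] by simp
qed

lemma rate_lipschitz:
  fixes x y :: "((real ^ 'n) ^ 'N::finite) \<times> ((real ^ 'n) ^ 'N)"
  shows "\<bar>rate i (fst x) - rate i (fst y)\<bar> \<le> 2 * \<Lambda> * norm (x - y)"
proof -
  have "\<bar>(\<Sum>j\<in>UNIV - {i}. \<Phi> (fst x $ i - fst x $ j)) - (\<Sum>j\<in>UNIV - {i}. \<Phi> (fst y $ i - fst y $ j))\<bar> \<le>
      (\<Sum>j\<in>UNIV - {i}. \<bar>\<Phi> (fst x $ i - fst x $ j) - \<Phi> (fst y $ i - fst y $ j)\<bar>)"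
    unfolding sum_subtractf[symmetric] by (rule sum_abs)
  also have "\<dots> \<le> (\<Sum>j\<in>(UNIV::'N set). \<bar>\<Phi> (fst x $ i - fst x $ j) - \<Phi> (fst y $ i - fst y $ j)\<bar>)"
    by (rule sum_mono2) auto
  also have "\<dots> \<le> real CARD('N) * (2 * \<Lambda> * norm (x - y))"
    using sum_bounded_above[of "UNIV :: 'N set" "\<lambda>j. \<bar>\<Phi> (fst x $ i - fst x $ j) - \<Phi> (fst y $ i - fst y $ j)\<bar>", OF \<Phi>_diff_le] by simp
  finally show ?thesis
    unfolding rate_def diff_divide_distrib[symmetric] by (simp add: divide_le_eq mult.commute)
qed

lemma cs_damping_lipschitz:
  fixes x y :: "((real ^ 'n) ^ 'N::finite) \<times> ((real ^ 'n) ^ 'N)"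
  assumes "b \<in> Basis"
  shows "\<bar>cs_damping b x - cs_damping b y\<bar> \<le> real CARD('N) * (2 * \<Lambda>) * norm (x - y)"
proof -
  have "\<bar>cs_damping b x - cs_damping b y\<bar> \<le>
      (\<Sum>i\<in>UNIV. \<bar>norm (snd b $ i) * (rate i (fst x) - rate i (fst y))\<bar>)"
    unfolding cs_damping_def sum_subtractf[symmetric] right_diff_distrib[symmetric] by (rule sum_abs)
  also have "\<dots> \<le> (\<Sum>i\<in>(UNIV::'N set). 2 * \<Lambda> * norm (x - y))"
  proof (rule sum_mono)
    fix i
    have "\<bar>norm (snd b $ i) * (rate i (fst x) - rate i (fst y))\<bar> \<le> 1 * (2 * \<Lambda> * norm (x - y))"
      unfolding abs_mult by (rule mult_mono) (auto simp: snd_Basis_le[OF assms] rate_lipschitz)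
    then show "\<bar>norm (snd b $ i) * (rate i (fst x) - rate i (fst y))\<bar> \<le> 2 * \<Lambda> * norm (x - y)" by simp
  qed
  finally show ?thesis by (simp add: mult_ac)
qed

lemma norm_velocity_diff_le:
  fixes V :: "(real ^ 'n) ^ 'N::finite"
  shows "norm (V $ i - V $ j) \<le> 2 * norm V"
  using norm_triangle_ineq4[of "V $ i" "V $ j"] Finite_Cartesian_Product.norm_nth_le[of V i] Finite_Cartesian_Product.norm_nth_le[of V j] by simp

lemma cs_field_bounded:
  fixes x :: "((real ^ 'n) ^ 'N::finite) \<times> ((real ^ 'n) ^ 'N)"
  assumes x: "x \<in> slab R" and b: "b \<in> Basis"
  shows "\<bar>cs_field x \<bullet> b\<bar> \<le> R + H * (2 * R)"
proof -
  have R: "0 \<le> R" "norm (snd x) \<le> R" using x order_trans[OF norm_ge_zero[of "snd x"]] by (auto simp: slab_def)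
  from b show ?thesis
  proof (cases rule: cs_Basis_cases)
    case (1 u)
    then have "\<bar>cs_field x \<bullet> b\<bar> \<le> norm (snd x)" by (simp add: cs_field_def Basis_le_norm)
    moreover have "0 \<le> H * (2 * R)" using R H_pos by simp
    ultimately show ?thesis using R by simp
  next
    case (2 i u)
    have "\<bar>\<Sum>j\<in>UNIV. \<Phi> (fst x $ i - fst x $ j) * ((snd x $ j - snd x $ i) \<bullet> u)\<bar> \<le> (\<Sum>j\<in>(UNIV::'N set). H * (2 * R))"
    proof (rule order_trans[OF sum_abs sum_mono])
      fix j
      have "\<bar>(snd x $ j - snd x $ i) \<bullet> u\<bar> \<le> norm (snd x $ j - snd x $ i)" using 2 by (simp add: Basis_le_norm)
      then show "\<bar>\<Phi> (fst x $ i - fst x $ j) * ((snd x $ j - snd x $ i) \<bullet> u)\<bar> \<le> H * (2 * R)"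
        unfolding abs_mult using R norm_velocity_diff_le[of "snd x" j i] H_pos
        by (intro mult_mono) (auto simp: \<Phi>_nonneg \<Phi>_le)
    qed
    then have "\<bar>cs_field x \<bullet> b\<bar> \<le> H * (2 * R)"
      using 2 by (simp add: cs_field_def accel_inner_axis divide_le_eq mult_ac)
    with R show ?thesis by simp
  qed
qed

lemma cs_field_lipschitz:
  fixes x y :: "((real ^ 'n) ^ 'N::finite) \<times> ((real ^ 'n) ^ 'N)"
  assumes x: "x \<in> slab R" and b: "b \<in> Basis"
  shows "\<bar>cs_field x \<bullet> b - cs_field y \<bullet> b\<bar> \<le> (1 + 4 * \<Lambda> * R + 2 * H) * norm (x - y)"
proof -
  have R: "0 \<le> R" "norm (snd x) \<le> R" using x order_trans[OF norm_ge_zero[of "snd x"]] by (auto simp: slab_def)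
  have nn: "0 \<le> (4 * \<Lambda> * R + 2 * H) * norm (x - y)" using R H_pos \<Lambda>_nonneg by simp
  from b show ?thesis
  proof (cases rule: cs_Basis_cases)
    case (1 u)
    then have "\<bar>cs_field x \<bullet> b - cs_field y \<bullet> b\<bar> = \<bar>snd (x - y) \<bullet> u\<bar>"
      by (simp add: cs_field_def inner_diff_left)
    also have "\<dots> \<le> norm (snd (x - y))" using 1 by (intro Basis_le_norm)
    also have "\<dots> \<le> norm (x - y)" 
      using norm_snd_diff_le[of x y] by simp
    finally show ?thesis using nn by (simp add: distrib_right)
  next
    case (2 i u)
    let ?D = "4 * \<Lambda> * R + 2 * H"
    have "\<bar>(\<Sum>j\<in>UNIV. \<Phi> (fst x $ i - fst x $ j) * ((snd x $ j - snd x $ i) \<bullet> u)) -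
        (\<Sum>j\<in>UNIV. \<Phi> (fst y $ i - fst y $ j) * ((snd y $ j - snd y $ i) \<bullet> u))\<bar> \<le>
      (\<Sum>j\<in>(UNIV::'N set). ?D * norm (x - y))"
      unfolding sum_subtractf[symmetric]
    proof (rule order_trans[OF sum_abs sum_mono])
      fix j
      let ?p = "\<Phi> (fst x $ i - fst x $ j)" and ?p' = "\<Phi> (fst y $ i - fst y $ j)"
      let ?v = "snd x $ j - snd x $ i" and ?v' = "snd y $ j - snd y $ i"
      have "\<bar>?v \<bullet> u\<bar> \<le> norm ?v" using 2 by (simp add: Basis_le_norm)
      then have v: "\<bar>?v \<bullet> u\<bar> \<le> 2 * R" using norm_velocity_diff_le[of "snd x" j i] R by simp
      have "norm (?v - ?v') = norm ((snd x $ j - snd y $ j) - (snd x $ i - snd y $ i))"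
        by (simp add: algebra_simps)
      also have "\<dots> \<le> 2 * norm (x - y)"
        using norm_triangle_ineq4[of "snd x $ j - snd y $ j" "snd x $ i - snd y $ i"]
          norm_pair_components(2)[of x i y] norm_pair_components(2)[of x j y] by simp
      finally have dv: "\<bar>(?v - ?v') \<bullet> u\<bar> \<le> 2 * norm (x - y)"
        using 2 Basis_le_norm[of u "?v - ?v'"] by simp
      \<comment> \<open>The difference of kernel values is paired with the velocities of
        \<open>x\<close>, which are the ones bounded by \<open>R\<close>.\<close>
      have "?p * (?v \<bullet> u) - ?p' * (?v' \<bullet> u) = (?p - ?p') * (?v \<bullet> u) + ?p' * ((?v - ?v') \<bullet> u)"
        by (simp add: inner_diff_left algebra_simps)
      then have "\<bar>?p * (?v \<bullet> u) - ?p' * (?v' \<bullet> u)\<bar> \<le> \<bar>?p - ?p'\<bar> * \<bar>?v \<bullet> u\<bar> + ?p' * \<bar>(?v - ?v') \<bullet> u\<bar>"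
        using abs_triangle_ineq[of "(?p - ?p') * (?v \<bullet> u)" "?p' * ((?v - ?v') \<bullet> u)"]
        by (simp add: abs_mult \<Phi>_nonneg)
      also have "\<dots> \<le> (2 * \<Lambda> * norm (x - y)) * (2 * R) + H * (2 * norm (x - y))"
        using v dv \<Phi>_diff_le[of x i j y] \<Phi>_le[of "fst y $ i - fst y $ j"] R H_pos \<Lambda>_nonneg
        by (intro add_mono mult_mono) (auto simp: \<Phi>_nonneg)
      finally show "\<bar>?p * (?v \<bullet> u) - ?p' * (?v' \<bullet> u)\<bar> \<le> ?D * norm (x - y)"
        by (simp add: algebra_simps)
    qed
    then have "\<bar>cs_field x \<bullet> b - cs_field y \<bullet> b\<bar> \<le> ?D * norm (x - y)"
      using 2 by (simp add: cs_field_def accel_inner_axis divide_le_eq mult_ac flip: diff_divide_distrib)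
    moreover have "(1 + ?D) * norm (x - y) = norm (x - y) + ?D * norm (x - y)"
      by (simp only: distrib_right mult_1)
    ultimately show ?thesis using norm_ge_zero[of "x - y"] unfolding add.assoc by linarith
  qed
qed

end

section \<open>Asymptotics of lifted solutions\<close>

lemma has_vector_derivative_integral_halfline:
  fixes f :: "real \<Rightarrow> 'a::banach"
  assumes "continuous_on {0..} f" "0 \<le> t"
  shows "((\<lambda>t. integral {0..t} f) has_vector_derivative f t) (at t within {0..})"
proof -
  have "continuous_on {0..t + 1} f" using assms(1) by (rule continuous_on_subset) auto
  then have "((\<lambda>t. integral {0..t} f) has_vector_derivative f t) (at t within {0..t + 1})"
    using assms(2) by (intro integral_has_vector_derivative) auto
  also have "at t within {0..t + 1} = at t within {0..}"
    by (rule at_within_nhd[where S = "{..<t + 1}"]) auto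
  finally show ?thesis .
qed

text \<open>If \<open>q\<close> were at least \<open>e\<close> at a late time, the Lipschitz bound
  would keep it above \<open>e / 2\<close> for a fixed duration \<open>\<delta>\<close>, and
  \<open>Q\<close> would rise by at least \<open>\<delta> * e / 2\<close>. But \<open>Q\<close> is
  monotone and bounded, so its late increments are smaller than that.\<close>

lemma barbalat:
  fixes Q :: "real \<Rightarrow> real"
  assumes Q': "\<And>t. 0 \<le> t \<Longrightarrow> (Q has_real_derivative q t) (at t within {0..})"
    and q: "\<And>t. 0 \<le> t \<Longrightarrow> 0 \<le> q t"
    and \<kappa>: "\<And>s t. 0 \<le> s \<Longrightarrow> s \<le> t \<Longrightarrow> \<bar>q t - q s\<bar> \<le> \<kappa> * (t - s)"
    and M: "\<And>t. 0 \<le> t \<Longrightarrow> Q t \<le> M"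
  shows "(q \<longlongrightarrow> 0) at_top"
proof -
  have mono: "Q s \<le> Q t" if "0 \<le> s" "s \<le> t" for s t
    using nonincreasing_halfline[of "\<lambda>t. - Q t" "\<lambda>t. - q t" 0 s t] Q' q that
    by (auto intro!: derivative_intros)
  have "\<exists>l. ((\<lambda>t. - Q t) \<longlongrightarrow> l) at_top"
    by (rule antimono_bounded_below_tendsto[of 0 _ "- M"]) (auto simp: mono M)
  then obtain l where "((\<lambda>t. - Q t) \<longlongrightarrow> l) at_top" ..
  then have lim: "(Q \<longlongrightarrow> - l) at_top" using tendsto_minus by fastforce
  have \<kappa>0: "0 \<le> \<kappa>" using \<kappa>[of 0 1] by simp
  show ?thesis
  proof (rule tendstoI)
    fix e :: real assume e: "0 < e"
    \<comment> \<open>The summand 1 keeps the denominator positive when \<open>\<kappa>\<close> is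
      0.\<close>
    define \<delta> where "\<delta> = e / (2 * (\<kappa> + 1))"
    have \<delta>: "0 < \<delta>" using e \<kappa>0 by (simp add: \<delta>_def)
    have "\<kappa> * \<delta> \<le> (\<kappa> + 1) * \<delta>" using \<delta> by simp
    also have "\<dots> = e / 2" using \<kappa>0 by (simp add: \<delta>_def field_simps add_nonneg_eq_0_iff)
    finally have \<kappa>\<delta>: "\<kappa> * \<delta> \<le> e / 2" .
    have "\<forall>\<^sub>F t in at_top. dist (Q t) (- l) < \<delta> * e / 4"
      using \<delta> e by (intro tendstoD[OF lim]) auto
    then obtain T where T: "\<And>t. T \<le> t \<Longrightarrow> dist (Q t) (- l) < \<delta> * e / 4"
      by (auto simp: eventually_at_top_linorder)
    have "q t < e" if t: "max T 0 \<le> t" for t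
    proof (rule ccontr)
      assume ge: "\<not> q t < e"
      have "(Q has_real_derivative q x) (at x within {0..t + \<delta>})" if "x \<in> {0..t + \<delta>}" for x
        using has_field_derivative_subset[OF Q'[of x]] that by auto
      then obtain u where u: "t < u" "u < t + \<delta>" "Q (t + \<delta>) - Q t = \<delta> * q u"
        by (rule real_increment_mvt[of "t + \<delta>" Q q t \<delta>]) (use t \<delta> in auto)
      have "\<kappa> * (u - t) \<le> \<kappa> * \<delta>" using u \<kappa>0 by (intro mult_left_mono) auto
      then have "e / 2 \<le> q u" using \<kappa>[of t u] u t ge \<kappa>\<delta> by auto
      then have "\<delta> * (e / 2) \<le> Q (t + \<delta>) - Q t" using u(3) \<delta> by simp
      moreover have "dist (Q t) (- l) < \<delta> * e / 4" "dist (Q (t + \<delta>)) (- l) < \<delta> * e / 4"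
        using T[of t] T[of "t + \<delta>"] t \<delta> by auto
      ultimately show False unfolding dist_real_def by linarith
    qed
    then show "\<forall>\<^sub>F t in at_top. dist (q t) 0 < e"
      using q by (intro eventually_mono[OF eventually_ge_at_top[of "max T 0"]]) (auto simp: dist_real_def)
  qed
qed

section \<open>Energy, limit velocities and damping along a lifted solution\<close>

context periodic_kernel
begin

definition lifted_solution :: "(real \<Rightarrow> (real ^ 'n) ^ 'N::finite) \<Rightarrow> (real \<Rightarrow> (real ^ 'n) ^ 'N) \<Rightarrow> bool" where
  "lifted_solution X V \<longleftrightarrow> (\<forall>t\<ge>0. (X has_vector_derivative V t) (at t within {0..}) \<and>
    (V has_vector_derivative accel (X t) (V t)) (at t within {0..}))"

text \<open>A generous majorant of the sum of all \<open>cs_damping b\<close>: each basis vector is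
  charged with the rates of all agents. The surplus factor is harmless because only the finiteness
  of the time integral matters.\<close>

definition total_rate :: "(real \<Rightarrow> (real ^ 'n) ^ 'N::finite) \<Rightarrow> real \<Rightarrow> real" where
  "total_rate X t = real DIM(((real ^ 'n) ^ 'N) \<times> ((real ^ 'n) ^ 'N)) * (\<Sum>i\<in>UNIV. rate i (X t))"

definition total_damping :: "(real \<Rightarrow> (real ^ 'n) ^ 'N::finite) \<Rightarrow> real \<Rightarrow> real" where
  "total_damping X t = integral {0..t} (total_rate X)"

context
  fixes X V :: "real \<Rightarrow> (real ^ 'n) ^ 'N::finite"
  assumes sol: "lifted_solution X V"
begin

lemma X': "0 \<le> t \<Longrightarrow> (X has_vector_derivative V t) (at t within {0..})"
  and V': "0 \<le> t \<Longrightarrow> (V has_vector_derivative accel (X t) (V t)) (at t within {0..})"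
  using sol by (auto simp: lifted_solution_def)

text \<open>The acceleration is tested with the velocities and the double sum is symmetrized;
  evenness of the kernel makes the weights symmetric.\<close>

lemma energy_derivative:
  assumes "0 \<le> t"
  shows "((\<lambda>t. V t \<bullet> V t) has_real_derivative
    - (\<Sum>i\<in>UNIV. \<Sum>j\<in>UNIV. \<Phi> (X t $ i - X t $ j) * (norm (V t $ i - V t $ j))\<^sup>2) / real CARD('N))
    (at t within {0..})"
proof -
  let ?m = "\<lambda>i j. \<Phi> (X t $ i - X t $ j)" and ?v = "\<lambda>i. V t $ i"
  have sym: "?m i j = ?m j i" for i j using \<Phi>_even[of "X t $ i - X t $ j"] by simp
  define S where "S = (\<Sum>i\<in>UNIV. \<Sum>j\<in>UNIV. ?m i j * (?v i \<bullet> (?v j - ?v i)))"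
  have "S = (\<Sum>i\<in>UNIV. \<Sum>j\<in>UNIV. ?m j i * (?v j \<bullet> (?v i - ?v j)))"
    unfolding S_def by (rule sum.swap)
  then have "2 * S = (\<Sum>i\<in>UNIV. \<Sum>j\<in>UNIV. ?m i j * (?v i \<bullet> (?v j - ?v i)) + ?m j i * (?v j \<bullet> (?v i - ?v j)))"
    by (simp add: S_def sum.distrib)
  also have "\<dots> = - (\<Sum>i\<in>UNIV. \<Sum>j\<in>UNIV. ?m i j * (norm (?v i - ?v j))\<^sup>2)"
    unfolding sum_negf[symmetric]
    by (intro sum.cong refl)
      (subst sym, simp add: power2_norm_eq_inner inner_diff inner_commute algebra_simps)
  finally have S2: "2 * S = - (\<Sum>i\<in>UNIV. \<Sum>j\<in>UNIV. ?m i j * (norm (?v i - ?v j))\<^sup>2)" .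
  have "V t \<bullet> accel (X t) (V t) = S / real CARD('N)"
    by (subst inner_vec_def) (simp add: accel_def S_def inner_sum_right sum_divide_distrib sum_distrib_left)
  then have "2 * (V t \<bullet> accel (X t) (V t)) =
      - (\<Sum>i\<in>UNIV. \<Sum>j\<in>UNIV. ?m i j * (norm (?v i - ?v j))\<^sup>2) / real CARD('N)"
    using S2 by simp
  moreover have "((\<lambda>t. V t \<bullet> V t) has_real_derivative 2 * (V t \<bullet> accel (X t) (V t))) (at t within {0..})"
    using bounded_bilinear.has_vector_derivative[OF bounded_bilinear_inner V'[OF assms] V'[OF assms]]
    by (simp add: has_real_derivative_iff_has_vector_derivative inner_commute)
  ultimately show ?thesis by simp
qed

lemma norm_V_le:
  assumes "0 \<le> t"
  shows "norm (V t) \<le> norm (V 0)"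
proof -
  have "V t \<bullet> V t \<le> V 0 \<bullet> V 0"
    by (rule nonincreasing_halfline[where f = "\<lambda>t. V t \<bullet> V t" and T = 0, OF energy_derivative])
      (use assms in \<open>auto intro!: divide_nonneg_nonneg sum_nonneg mult_nonneg_nonneg \<Phi>_nonneg\<close>)
  then show ?thesis by (simp add: norm_le)
qed

text \<open>Along a given solution the kernel values are just time-dependent symmetric weights, and
  each coordinate of the velocities solves the scalar consensus equation with them. The weights have
  no positive lower bound, so the limits may differ from agent to agent.\<close>

lemma V_converges: "\<exists>w. (V \<longlongrightarrow> w) at_top"
proof -
  have "\<exists>l. ((\<lambda>t. V t $ i $ k) \<longlongrightarrow> l) at_top" for i k
  proof -
    interpret symmetric_consensus "\<lambda>t i. V t $ i $ k" "\<lambda>i j t. \<Phi> (X t $ i - X t $ j) / real CARD('N)"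
    proof
      fix t :: real and i j :: 'N
      show "0 \<le> \<Phi> (X t $ i - X t $ j) / real CARD('N)" by (simp add: \<Phi>_nonneg)
      show "\<Phi> (X t $ i - X t $ j) / real CARD('N) = \<Phi> (X t $ j - X t $ i) / real CARD('N)"
        using \<Phi>_even[of "X t $ i - X t $ j"] by simp
      assume t: "0 \<le> t"
      have "((\<lambda>s. V s $ i $ k) has_vector_derivative accel (X t) (V t) $ i $ k) (at t within {0..})"
        by (intro bounded_linear.has_vector_derivative[OF bounded_linear_vec_nth] V' t)
      then show "((\<lambda>s. V s $ i $ k) has_real_derivative
        (\<Sum>j\<in>UNIV. \<Phi> (X t $ i - X t $ j) / real CARD('N) * (V t $ j $ k - V t $ i $ k))) (at t within {0..})"
        by (simp add: has_real_derivative_iff_has_vector_derivative accel_def sum_divide_distrib)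
    qed
    show ?thesis by (rule converges)
  qed
  then obtain l where l: "\<And>i k. ((\<lambda>t. V t $ i $ k) \<longlongrightarrow> l i k) at_top" by metis
  have "(V \<longlongrightarrow> (\<chi> i. \<chi> k. l i k)) at_top"
    by (intro vec_tendstoI) (simp add: l)
  then show ?thesis by blast
qed

lemma continuous_X: "continuous_on {0..} X"
  using X' by (auto simp: continuous_on_eq_continuous_within intro!: has_vector_derivative_continuous)

lemma norm_X_diff_le:
  assumes "0 \<le> s" "s \<le> t"
  shows "norm (X t - X s) \<le> norm (V 0) * (t - s)"
proof -
  have "norm (X t - X s) \<le> norm (V 0) * norm (t - s)"
  proof (rule differentiable_bound[where S = "{s..t}" and f' = "\<lambda>x h. h *\<^sub>R V x"])
    fix x assume x: "x \<in> {s..t}"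
    show "(X has_derivative (\<lambda>h. h *\<^sub>R V x)) (at x within {s..t})"
      using has_vector_derivative_within_subset[OF X'[of x]] x assms
      by (auto simp flip: has_vector_derivative_def)
    show "onorm (\<lambda>h. h *\<^sub>R V x) \<le> norm (V 0)"
      using norm_V_le[of x] x assms by (intro onorm_le) (simp add: mult.commute mult_left_mono)
  qed (use assms in auto)
  then show ?thesis using assms by simp
qed

lemma continuous_total_rate: "continuous_on {0..} (total_rate X)"
  unfolding total_rate_def[abs_def] rate_def by (intro continuous_intros continuous_X) auto

lemma total_rate_nonneg: "0 \<le> total_rate X t"
  unfolding total_rate_def by (intro mult_nonneg_nonneg sum_nonneg rate_nonneg) auto

lemma sum_damping_le: "(\<Sum>b\<in>Basis. cs_damping b (X t, V t)) \<le> total_rate X t"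
  unfolding total_rate_def
  using sum_bounded_above[of Basis "\<lambda>b. cs_damping b (X t, V t)", OF cs_damping_le] by simp

lemma \<Phi>_le_total_rate:
  assumes "i \<noteq> j"
  shows "\<Phi> (X t $ i - X t $ j) \<le> real CARD('N) * total_rate X t"
proof -
  have "\<Phi> (X t $ i - X t $ j) \<le> (\<Sum>j\<in>UNIV - {i}. \<Phi> (X t $ i - X t $ j))"
    by (rule member_le_sum) (use assms in \<open>auto simp: \<Phi>_nonneg\<close>)
  also have "\<dots> = real CARD('N) * rate i (X t)" by (simp add: rate_def)
  also have "\<dots> \<le> real CARD('N) * (\<Sum>i\<in>UNIV. rate i (X t))"
    by (intro mult_left_mono member_le_sum) (auto simp: rate_nonneg)
  also have "\<dots> \<le> real CARD('N) * total_rate X t"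
  proof (rule mult_left_mono)
    have "1 \<le> real DIM(((real ^ 'n) ^ 'N) \<times> ((real ^ 'n) ^ 'N))"
      using DIM_positive[where 'a = "((real ^ 'n) ^ 'N) \<times> ((real ^ 'n) ^ 'N)"] by linarith
    moreover have "0 \<le> (\<Sum>i\<in>UNIV. rate i (X t))" by (intro sum_nonneg rate_nonneg)
    ultimately show "(\<Sum>i\<in>UNIV. rate i (X t)) \<le> total_rate X t"
      unfolding total_rate_def by (simp add: mult_le_cancel_right1 del: DIM_prod)
  qed simp
  finally show ?thesis .
qed

lemma total_rate_lipschitz:
  assumes "0 \<le> s" "s \<le> t"
  shows "\<bar>total_rate X t - total_rate X s\<bar> \<le>
    real DIM(((real ^ 'n) ^ 'N) \<times> ((real ^ 'n) ^ 'N)) * (real CARD('N) * (2 * \<Lambda> * norm (V 0))) * (t - s)"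
proof -
  have "\<bar>(\<Sum>i\<in>UNIV. rate i (X t)) - (\<Sum>i\<in>UNIV. rate i (X s))\<bar> \<le> (\<Sum>i\<in>UNIV. \<bar>rate i (X t) - rate i (X s)\<bar>)"
    unfolding sum_subtractf[symmetric] by (rule sum_abs)
  also have "\<dots> \<le> (\<Sum>i\<in>(UNIV::'N set). 2 * \<Lambda> * (norm (V 0) * (t - s)))"
  proof (rule sum_mono)
    fix i
    have "norm ((X t, 0) - (X s, 0::(real ^ 'n) ^ 'N)) \<le> norm (V 0) * (t - s)"
      using norm_X_diff_le[OF assms] by (simp add: norm_Pair)
    then have "2 * \<Lambda> * norm ((X t, 0) - (X s, 0::(real ^ 'n) ^ 'N)) \<le> 2 * \<Lambda> * (norm (V 0) * (t - s))"
      using \<Lambda>_nonneg by (intro mult_left_mono) auto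
    with rate_lipschitz[of i "(X t, 0)" "(X s, 0)"]
    show "\<bar>rate i (X t) - rate i (X s)\<bar> \<le> 2 * \<Lambda> * (norm (V 0) * (t - s))" by simp
  qed
  finally have "\<bar>(\<Sum>i\<in>UNIV. rate i (X t)) - (\<Sum>i\<in>UNIV. rate i (X s))\<bar> \<le>
      real CARD('N) * (2 * \<Lambda> * norm (V 0)) * (t - s)" by simp
  from mult_left_mono[OF this, of "real DIM(((real ^ 'n) ^ 'N) \<times> ((real ^ 'n) ^ 'N))"]
  show ?thesis
    unfolding total_rate_def right_diff_distrib[symmetric] abs_mult by (simp add: mult.assoc)
qed

lemma total_damping_derivative:
  "0 \<le> t \<Longrightarrow> (total_damping X has_real_derivative total_rate X t) (at t within {0..})"
  unfolding total_damping_def has_real_derivative_iff_has_vector_derivative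
  by (rule has_vector_derivative_integral_halfline[OF continuous_total_rate])

text \<open>The slab is one unit wider than the speed bound so as to contain the unit balls around
  the path.\<close>

lemma trajectory:
  assumes "norm (V 0) \<le> R"
  shows "cs.trajectory_until (slab (R + 1)) T (\<lambda>t. (X t, V t)) (total_damping X)"
  unfolding cs.trajectory_until_def
proof (intro exI[of _ "total_rate X"] ballI conjI)
  fix t assume t: "t \<in> {0..T}"
  show "cball (X t, V t) 1 \<subseteq> slab (R + 1)"
  proof
    fix y assume "y \<in> cball (X t, V t) 1"
    then have "norm (V t - snd y) \<le> 1" using norm_snd_diff_le[of "(X t, V t)" y] by (simp add: dist_norm)
    moreover have "norm (V t) \<le> R" using norm_V_le[of t] t assms by auto
    moreover have "norm (snd y) \<le> norm (V t) + norm (V t - snd y)"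
      by (metis norm_minus_commute norm_triangle_sub)
    ultimately show "y \<in> slab (R + 1)" by (simp add: slab_def)
  qed
  have "((\<lambda>t. (X t, V t)) has_vector_derivative (V t, accel (X t) (V t))) (at t within {0..})"
    using t by (intro has_vector_derivative_Pair X' V') auto
  then show "((\<lambda>t. (X t, V t)) has_vector_derivative cs_field (X t, V t)) (at t within {0..T})"
    unfolding cs_field_def by (auto intro: has_vector_derivative_within_subset)
  show "(total_damping X has_real_derivative total_rate X t) (at t within {0..T})"
    using total_damping_derivative[of t] t by (auto intro: has_field_derivative_subset)
qed (rule sum_damping_le)

context
  fixes w :: "(real ^ 'n) ^ 'N"
  assumes lim: "(V \<longlongrightarrow> w) at_top" and distinct: "\<And>i j. i \<noteq> j \<Longrightarrow> w $ i \<noteq> w $ j"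
begin

text \<open>Once all squared velocity differences exceed \<open>\<delta>\<close>, energy is lost at
  least at the rate \<open>\<delta>\<close> times the sum of all \<open>rate i\<close>. Adding a
  suitable multiple of the energy to the damping therefore gives a quantity \<open>G\<close> that no
  longer increases.\<close>

lemma total_damping_bounded: "\<exists>M. \<forall>t\<ge>0. total_damping X t \<le> M"
proof -
  let ?d = "real DIM(((real ^ 'n) ^ 'N) \<times> ((real ^ 'n) ^ 'N))"
  have "\<exists>\<delta>>0. \<forall>i j. i \<noteq> j \<longrightarrow> \<delta> < (norm (w $ i - w $ j))\<^sup>2"
  proof -
    \<comment> \<open>The element 1 keeps the set nonempty even without a pair
      \<open>i \<noteq> j\<close>; halving makes the minimum a strict lower bound.\<close>
    define A where "A = insert 1 ((\<lambda>(i, j). (norm (w $ i - w $ j))\<^sup>2 / 2) ` {(i, j). i \<noteq> j})"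
    have fin: "finite A" unfolding A_def by auto
    have pos: "0 < a" if "a \<in> A" for a using that distinct by (auto simp: A_def)
    have "0 < Min A" using fin pos by (subst Min_gr_iff) (auto simp: A_def)
    moreover have "Min A < (norm (w $ i - w $ j))\<^sup>2" if "i \<noteq> j" for i j
    proof -
      have "Min A \<le> (norm (w $ i - w $ j))\<^sup>2 / 2"
        using that by (intro Min_le fin) (force simp: A_def)
      also have "\<dots> < (norm (w $ i - w $ j))\<^sup>2" using distinct[OF that] by simp
      finally show ?thesis .
    qed
    ultimately show ?thesis by blast
  qed
  then obtain \<delta> where \<delta>: "0 < \<delta>" "\<And>i j. i \<noteq> j \<Longrightarrow> \<delta> < (norm (w $ i - w $ j))\<^sup>2" by blast
  have "\<forall>\<^sub>F t in at_top. \<forall>p\<in>{(i, j). i \<noteq> j}. \<delta> < (norm (V t $ fst p - V t $ snd p))\<^sup>2"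
  proof (rule eventually_ball_finite, simp, safe)
    fix i j :: 'N assume "i \<noteq> j"
    have "((\<lambda>t. (norm (V t $ i - V t $ j))\<^sup>2) \<longlongrightarrow> (norm (w $ i - w $ j))\<^sup>2) at_top"
      by (intro tendsto_intros lim)
    from order_tendstoD(1)[OF this \<delta>(2)[OF \<open>i \<noteq> j\<close>]]
    show "\<forall>\<^sub>F t in at_top. \<delta> < (norm (V t $ fst (i, j) - V t $ snd (i, j)))\<^sup>2" by simp
  qed
  then obtain T0 where T0: "\<And>t i j. T0 \<le> t \<Longrightarrow> i \<noteq> j \<Longrightarrow> \<delta> < (norm (V t $ i - V t $ j))\<^sup>2"
    unfolding eventually_at_top_linorder by fastforce
  define T where "T = max T0 0"
  define G where "G t = total_damping X t + ?d / \<delta> * (V t \<bullet> V t)" for t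
  have Gle: "G t \<le> G T" if "T \<le> t" for t
  proof (rule nonincreasing_halfline[where f = G and T = T])
    fix t :: real assume t: "0 \<le> t"
    show "(G has_real_derivative total_rate X t + ?d / \<delta> *
      (- (\<Sum>i\<in>UNIV. \<Sum>j\<in>UNIV. \<Phi> (X t $ i - X t $ j) * (norm (V t $ i - V t $ j))\<^sup>2) / real CARD('N)))
      (at t within {0..})"
      unfolding G_def by (intro DERIV_add DERIV_cmult total_damping_derivative energy_derivative t)
  next
    fix t assume t: "T \<le> t"
    have "\<delta> * (\<Sum>i\<in>UNIV. rate i (X t)) = (\<Sum>i\<in>UNIV. \<Sum>j\<in>UNIV - {i}. \<delta> * \<Phi> (X t $ i - X t $ j)) / real CARD('N)"
      by (simp add: rate_def sum_distrib_left sum_divide_distrib)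
    also have "\<dots> \<le> (\<Sum>i\<in>UNIV. \<Sum>j\<in>UNIV. \<Phi> (X t $ i - X t $ j) * (norm (V t $ i - V t $ j))\<^sup>2) / real CARD('N)"
    proof (intro divide_right_mono sum_mono)
      fix i
      have "(\<Sum>j\<in>UNIV - {i}. \<delta> * \<Phi> (X t $ i - X t $ j)) \<le>
        (\<Sum>j\<in>UNIV - {i}. \<Phi> (X t $ i - X t $ j) * (norm (V t $ i - V t $ j))\<^sup>2)"
      proof (rule sum_mono)
        fix j assume "j \<in> UNIV - {i}"
        then have "\<delta> \<le> (norm (V t $ i - V t $ j))\<^sup>2" using T0[of t i j] t by (auto simp: T_def)
        then show "\<delta> * \<Phi> (X t $ i - X t $ j) \<le> \<Phi> (X t $ i - X t $ j) * (norm (V t $ i - V t $ j))\<^sup>2"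
          by (subst mult.commute) (intro mult_left_mono \<Phi>_nonneg)
      qed
      also have "\<dots> \<le> (\<Sum>j\<in>UNIV. \<Phi> (X t $ i - X t $ j) * (norm (V t $ i - V t $ j))\<^sup>2)"
        by (rule sum_mono2) (auto simp: \<Phi>_nonneg)
      finally show "(\<Sum>j\<in>UNIV - {i}. \<delta> * \<Phi> (X t $ i - X t $ j)) \<le>
        (\<Sum>j\<in>UNIV. \<Phi> (X t $ i - X t $ j) * (norm (V t $ i - V t $ j))\<^sup>2)" .
    qed simp
    finally have "?d / \<delta> * (\<delta> * (\<Sum>i\<in>UNIV. rate i (X t))) \<le> ?d / \<delta> *
      ((\<Sum>i\<in>UNIV. \<Sum>j\<in>UNIV. \<Phi> (X t $ i - X t $ j) * (norm (V t $ i - V t $ j))\<^sup>2) / real CARD('N))"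
      using \<delta> by (intro mult_left_mono) auto
    then show "total_rate X t + ?d / \<delta> *
      (- (\<Sum>i\<in>UNIV. \<Sum>j\<in>UNIV. \<Phi> (X t $ i - X t $ j) * (norm (V t $ i - V t $ j))\<^sup>2) / real CARD('N)) \<le> 0"
      using \<delta> by (simp add: total_rate_def)
  qed (use that in \<open>auto simp: T_def\<close>)
  have mono: "total_damping X s \<le> total_damping X t" if "0 \<le> s" "s \<le> t" for s t
    using nonincreasing_halfline[of "\<lambda>t. - total_damping X t" "\<lambda>t. - total_rate X t" 0 s t]
      total_damping_derivative total_rate_nonneg that
    by (auto intro!: derivative_intros)
  have "total_damping X t \<le> max (G T) (total_damping X T)" if "0 \<le> t" for t
  proof (cases "T \<le> t")
    case True
    have "0 \<le> ?d / \<delta> * (V t \<bullet> V t)" using \<delta> by (intro mult_nonneg_nonneg divide_nonneg_nonneg) auto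
    then have "total_damping X t \<le> G t" by (simp add: G_def)
    then show ?thesis using Gle[OF True] by simp
  next
    case False
    then show ?thesis using mono[of t T] that by auto
  qed
  then show ?thesis by blast
qed

text \<open>At late times the velocities are almost constant, so over a time span \<open>L\<close>
  the relative path stays close to the straight line through its present state. The kernel tends to
  0 along the path by \<open>barbalat\<close>, hence it is small on the line as well.\<close>

lemma relative_line_avoids:
  assumes "i \<noteq> j" "0 < e" "0 \<le> L"
  shows "\<forall>\<^sub>F t in at_top. \<forall>s\<in>{-L..L}. \<Phi> ((X t $ i - X t $ j) + s *\<^sub>R (V t $ i - V t $ j)) \<le> e"
proof -
  obtain M where M: "\<And>t. 0 \<le> t \<Longrightarrow> total_damping X t \<le> M" using total_damping_bounded by blast
  have "(total_rate X \<longlongrightarrow> 0) at_top"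
    by (rule barbalat[OF total_damping_derivative total_rate_nonneg total_rate_lipschitz M])
  then have "((\<lambda>t. real CARD('N) * total_rate X t) \<longlongrightarrow> real CARD('N) * 0) at_top"
    by (intro tendsto_intros)
  then have "\<forall>\<^sub>F t in at_top. real CARD('N) * total_rate X t < e / 2"
    using assms(2) by (intro order_tendstoD) auto
  then obtain T1 where T1: "\<And>t. T1 \<le> t \<Longrightarrow> \<Phi> (X t $ i - X t $ j) < e / 2"
    using \<Phi>_le_total_rate[OF assms(1)] unfolding eventually_at_top_linorder by (meson le_less_trans)
  define W where "W t = V t $ i - V t $ j" for t
  define Y where "Y t = X t $ i - X t $ j" for t
  have Y': "(Y has_vector_derivative W t) (at t within {0..})" if "0 \<le> t" for t
    unfolding Y_def W_def
    by (intro has_vector_derivative_diff bounded_linear.has_vector_derivative[OF bounded_linear_vec_nth] X' that)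
  \<comment> \<open>Relative velocities within \<open>c\<close> of their limit let the path deviate
    from the line by at most \<open>L * (2 * c)\<close>, which changes the kernel by at most
    \<open>e / 4\<close>; the summand 1 avoids a division by zero.\<close>
  define c where "c = e / (8 * (\<Lambda> * L + 1))"
  have \<Lambda>L: "0 \<le> \<Lambda> * L" using \<Lambda>_nonneg assms by simp
  have c: "0 < c" using assms \<Lambda>L by (simp add: c_def)
  have "(W \<longlongrightarrow> w $ i - w $ j) at_top" unfolding W_def by (intro tendsto_intros lim)
  then have "\<forall>\<^sub>F t in at_top. dist (W t) (w $ i - w $ j) < c" using c by (rule tendstoD)
  then obtain T2 where T2: "\<And>t. T2 \<le> t \<Longrightarrow> dist (W t) (w $ i - w $ j) < c"
    unfolding eventually_at_top_linorder by blast
  define T where "T = max (max T1 T2) 0"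
  \<comment> \<open>The line is also followed backwards; starting at \<open>T + L\<close> keeps all
    times \<open>t + s\<close> beyond \<open>T\<close>.\<close>
  have "\<Phi> (Y t + s *\<^sub>R W t) \<le> e" if t: "T + L \<le> t" and s: "s \<in> {-L..L}" for s t
  proof -
    have "norm (Y (t + s) - Y t - (t + s - t) *\<^sub>R W t) \<le> norm (t + s - t) * (2 * c)"
    proof (rule vector_differentiable_bound_linearization[where S = "{T..}"])
      show "(Y has_vector_derivative W x) (at x within {T..})" if "x \<in> {T..}" for x
        using has_vector_derivative_within_subset[OF Y'[of x]] that by (auto simp: T_def)
      show "closed_segment t (t + s) \<subseteq> {T..}"
        using t s assms(3) by (auto simp: closed_segment_eq_real_ivl split: if_splits)
      show "t \<in> {T..}" using t assms(3) by auto
      have "T2 \<le> t" using t assms(3) by (simp add: T_def)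
      then show "norm (W x - W t) \<le> 2 * c" if "x \<in> {T..}" for x
        using dist_triangle_less_add[OF T2[of x] T2[of t]] that by (simp add: T_def dist_norm)
    qed
    also have "\<dots> \<le> L * (2 * c)" using s c by (intro mult_right_mono) auto
    finally have "norm (Y t + s *\<^sub>R W t - Y (t + s)) \<le> L * (2 * c)"
      by (simp add: norm_minus_commute algebra_simps)
    then have "\<Lambda> * norm (Y t + s *\<^sub>R W t - Y (t + s)) \<le> \<Lambda> * (L * (2 * c))"
      using \<Lambda>_nonneg by (rule mult_left_mono)
    also have "\<dots> \<le> (\<Lambda> * L + 1) * (2 * c)" using c by (simp add: algebra_simps)
    also have "\<dots> = e / 4" using \<Lambda>L by (simp add: c_def field_simps add_nonneg_eq_0_iff)
    finally have "\<Phi> (Y t + s *\<^sub>R W t) \<le> \<Phi> (Y (t + s)) + e / 4"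
      using \<Phi>_lipschitz[of "Y t + s *\<^sub>R W t" "Y (t + s)"] by simp
    moreover have "\<Phi> (Y (t + s)) < e / 2" unfolding Y_def using t s by (intro T1) (auto simp: T_def)
    ultimately show ?thesis using assms(2) by simp
  qed
  then show ?thesis unfolding Y_def W_def eventually_at_top_linorder by blast
qed

end

end

end

section \<open>Lattice translates and irrational directions\<close>

text \<open>Intersecting the covers gives a Borel null set that contains \<open>A\<close>;
  measurability of \<open>A\<close> is then a consequence of completeness and not an input.\<close>

lemma negligible_if_cover_small:
  fixes A :: "'a::euclidean_space set"
  assumes cover: "\<And>n::nat. \<exists>S\<in>sets borel. A \<subseteq> S \<and> emeasure lborel S \<le> c n"
    and lim: "c \<longlonglongrightarrow> 0"
  shows "negligible A"
proof -
  obtain S where S: "\<And>n. S n \<in> sets borel" "\<And>n. A \<subseteq> S n" "\<And>n. emeasure lborel (S n) \<le> c n"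
    using cover by metis
  have meas: "(\<Inter>n. S n) \<in> sets borel" using S(1) by auto
  have "emeasure lborel (\<Inter>n. S n) \<le> 0"
  proof (rule LIMSEQ_le_const[OF lim], intro exI allI impI)
    fix n
    have "emeasure lborel (\<Inter>n. S n) \<le> emeasure lborel (S n)"
      using S(1) by (intro emeasure_mono) auto
    with S(3)[of n] show "emeasure lborel (\<Inter>n. S n) \<le> c n" by simp
  qed
  then have "(\<Inter>n. S n) \<in> null_sets lborel" using meas by (auto simp: null_sets_def)
  then have "(\<Inter>n. S n) \<in> null_sets lebesgue" by (rule null_sets_completionI)
  moreover have "A \<subseteq> (\<Inter>n. S n)" using S(2) by auto
  ultimately show ?thesis
    unfolding negligible_iff_null_sets using null_sets_completion_subset by blast
qed

text \<open>Continuity from below for outer measure. The given covers need not increase, but the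
  intersections of all later covers do, and they still contain the sets \<open>A n\<close>.\<close>

lemma cover_increasing_Union:
  fixes A :: "nat \<Rightarrow> 'a set"
  assumes cover: "\<And>n. \<exists>S\<in>sets M. A n \<subseteq> S \<and> emeasure M S \<le> c" and "incseq A"
  shows "\<exists>S\<in>sets M. (\<Union>n. A n) \<subseteq> S \<and> emeasure M S \<le> c"
proof -
  obtain S where S: "\<And>n. S n \<in> sets M" "\<And>n. A n \<subseteq> S n" "\<And>n. emeasure M (S n) \<le> c"
    using cover by metis
  define B where "B n = (\<Inter>m\<in>{n..}. S m)" for n
  have B: "B n \<in> sets M" for n using S(1) by (auto simp: B_def)
  have "A n \<subseteq> B n" for n
    using S(2) \<open>incseq A\<close> unfolding B_def incseq_def by (meson INT_greatest atLeast_iff order_trans)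
  moreover have "incseq B" unfolding B_def by (rule incseq_SucI) force
  then have "emeasure M (\<Union>n. B n) = (SUP n. emeasure M (B n))"
    using B by (intro SUP_emeasure_incseq[symmetric]) auto
  moreover have "emeasure M (B n) \<le> c" for n
    using emeasure_mono[of "B n" "S n" M] S(1,3)[of n] by (auto simp: B_def intro: order_trans)
  ultimately show ?thesis
    using B by (intro bexI[of _ "\<Union>n. B n"]) (auto intro: SUP_least)
qed

section \<open>Lattice translates of positions and their fundamental cell\<close>

definition position_lattice :: "(((real ^ 'n::finite) ^ 'N::finite) \<times> ((real ^ 'n) ^ 'N)) set" where
  "position_lattice = {(l, 0) | l. \<forall>i k. \<exists>m::int. l $ i $ k = 2 * pi * of_int m}"

lemma countable_position_lattice:
  "countable (position_lattice :: (((real ^ 'n::finite) ^ 'N::finite) \<times> ((real ^ 'n) ^ 'N)) set)"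
proof -
  have "position_lattice \<subseteq> range (\<lambda>m :: 'N \<Rightarrow> 'n \<Rightarrow> int. ((\<chi> i k. 2 * pi * of_int (m i k)) :: (real ^ 'n) ^ 'N, 0 :: (real ^ 'n) ^ 'N))"
  proof
    fix z :: "((real ^ 'n) ^ 'N) \<times> ((real ^ 'n) ^ 'N)"
    assume "z \<in> position_lattice"
    then obtain l where z: "z = (l, 0)" and "\<forall>i k. \<exists>m::int. l $ i $ k = 2 * pi * of_int m"
      by (auto simp: position_lattice_def)
    then obtain m :: "'N \<Rightarrow> 'n \<Rightarrow> int" where "\<And>i k. l $ i $ k = 2 * pi * of_int (m i k)" by metis
    then have "l = (\<chi> i k. 2 * pi * of_int (m i k))" by (simp add: vec_eq_iff)
    with z show "z \<in> range (\<lambda>m :: 'N \<Rightarrow> 'n \<Rightarrow> int. ((\<chi> i k. 2 * pi * of_int (m i k)) :: (real ^ 'n) ^ 'N, 0 :: (real ^ 'n) ^ 'N))"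
      by auto
  qed
  then show ?thesis by (rule countable_subset) auto
qed

lemma uminus_position_lattice:
  "uminus ` position_lattice = (position_lattice :: (((real ^ 'n::finite) ^ 'N::finite) \<times> ((real ^ 'n) ^ 'N)) set)"
proof -
  have "- z \<in> position_lattice" if zL: "z \<in> position_lattice" for z :: "((real ^ 'n) ^ 'N) \<times> ((real ^ 'n) ^ 'N)"
  proof -
    obtain l where z: "z = (l, 0)" and l: "\<forall>i k. \<exists>m::int. l $ i $ k = 2 * pi * of_int m"
      using zL by (auto simp: position_lattice_def)
    have "\<exists>m::int. (- l) $ i $ k = 2 * pi * of_int m" for i k
    proof -
      obtain m :: int where "l $ i $ k = 2 * pi * of_int m" using l by blast
      then show ?thesis by (intro exI[of _ "- m"]) simp
    qed
    then show ?thesis by (auto simp: z position_lattice_def)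
  qed
  then show ?thesis by (force intro: image_eqI[of _ _ "- _"])
qed

lemma floor_period_unique:
  fixes x :: real
  shows "0 \<le> x + 2 * pi * of_int m \<and> x + 2 * pi * of_int m < 2 * pi \<longleftrightarrow> m = - \<lfloor>x / (2 * pi)\<rfloor>"
proof -
  have "0 \<le> x + 2 * pi * of_int m \<and> x + 2 * pi * of_int m < 2 * pi \<longleftrightarrow>
    of_int (- m) \<le> x / (2 * pi) \<and> x / (2 * pi) < of_int (- m) + 1"
    by (auto simp: field_simps)
  also have "\<dots> \<longleftrightarrow> \<lfloor>x / (2 * pi)\<rfloor> = - m" by (rule floor_eq_iff[symmetric])
  finally show ?thesis by auto
qed

lemma position_lattice_cell:
  fixes z :: "((real ^ 'n::finite) ^ 'N::finite) \<times> ((real ^ 'n) ^ 'N)"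
  shows "\<exists>!l. l \<in> position_lattice \<and> z + l \<in> phase_cell"
proof (rule ex1I)
  define l0 where "l0 = (\<chi> i k. 2 * pi * of_int (- \<lfloor>fst z $ i $ k / (2 * pi)\<rfloor>))"
  have fl: "0 \<le> x + 2 * pi * of_int (- \<lfloor>x / (2 * pi)\<rfloor>) \<and> x + 2 * pi * of_int (- \<lfloor>x / (2 * pi)\<rfloor>) < 2 * pi"
    for x :: real
    by (simp only: floor_period_unique)
  have "(l0, 0) \<in> position_lattice"
    by (auto simp: position_lattice_def l0_def simp del: of_int_minus)
  moreover have "z + (l0, 0) \<in> phase_cell"
    by (cases z) (simp add: phase_cell_def l0_def fl del: of_int_minus)
  ultimately show "(l0, 0) \<in> position_lattice \<and> z + (l0, 0) \<in> phase_cell" ..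
  fix l assume l: "l \<in> position_lattice \<and> z + l \<in> phase_cell"
  then obtain l' where l': "l = (l', 0)" and "\<forall>i k. \<exists>m::int. l' $ i $ k = 2 * pi * of_int m"
    by (auto simp: position_lattice_def)
  then obtain m :: "'N \<Rightarrow> 'n \<Rightarrow> int" where m: "\<And>i k. l' $ i $ k = 2 * pi * of_int (m i k)" by metis
  have "m i k = - \<lfloor>fst z $ i $ k / (2 * pi)\<rfloor>" for i k
  proof -
    have "0 \<le> fst z $ i $ k + l' $ i $ k \<and> fst z $ i $ k + l' $ i $ k < 2 * pi"
      using l unfolding l' by (cases z) (simp add: phase_cell_def)
    then show ?thesis unfolding m floor_period_unique .
  qed
  then show "l = (l0, 0)" by (auto simp: l' l0_def vec_eq_iff m)
qed

lemma phase_cell_borel: "phase_cell \<in> sets borel"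
proof -
  have "phase_cell = {z :: ((real ^ 'n) ^ 'N) \<times> ((real ^ 'n) ^ 'N). \<forall>i k. 0 \<le> fst z $ i $ k \<and> fst z $ i $ k < 2 * pi}"
    by (auto simp: phase_cell_def)
  also have "\<dots> = (\<Inter>i. \<Inter>k. {z. 0 \<le> fst z $ i $ k} \<inter> {z. fst z $ i $ k < 2 * pi})" by auto
  also have "\<dots> \<in> sets borel"
    by (intro sets.countable_INT'' sets.Int borel_closed borel_open closed_Collect_le open_Collect_less continuous_intros) auto
  finally show ?thesis .
qed

text \<open>Provides the finite volume that continuity of the measure from above
  presupposes.\<close>

lemma bounded_cell_slab: "bounded (phase_cell \<inter> {z :: ((real ^ 'n::finite) ^ 'N::finite) \<times> ((real ^ 'n) ^ 'N). norm (snd z) \<le> R})"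
proof -
  have "norm z \<le> real CARD('N) * (real CARD('n) * (2 * pi)) + R"
    if z: "z \<in> phase_cell" "norm (snd z) \<le> R" for z :: "((real ^ 'n) ^ 'N) \<times> ((real ^ 'n) ^ 'N)"
  proof -
    have "\<bar>fst z $ i $ k\<bar> \<le> 2 * pi" for i k
      using z(1) by (cases z) (auto simp: phase_cell_def abs_le_iff intro: less_imp_le order_trans[of _ 0])
    then have "norm (fst z $ i) \<le> real CARD('n) * (2 * pi)" for i
      using order_trans[OF norm_le_l1_cart sum_bounded_above[of UNIV "\<lambda>k. \<bar>fst z $ i $ k\<bar>" "2 * pi"]] by simp
    moreover have "norm (fst z) \<le> (\<Sum>i\<in>UNIV. norm (fst z $ i))"
      unfolding norm_vec_def by (rule L2_set_le_sum) auto
    ultimately have "norm (fst z) \<le> real CARD('N) * (real CARD('n) * (2 * pi))"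
      using order_trans[OF _ sum_bounded_above[of UNIV "\<lambda>i. norm (fst z $ i)" "real CARD('n) * (2 * pi)"]] by simp
    moreover have "norm z \<le> norm (fst z) + norm (snd z)"
      by (metis norm_Pair_le prod.collapse)
    ultimately show ?thesis using z(2) by simp
  qed
  then show ?thesis by (intro boundedI) auto
qed

section \<open>States whose relative line avoids the zone of interaction\<close>

context periodic_kernel
begin

text \<open>Kronecker's theorem brings the line within \<open>\<delta>\<close> of a lattice point,
  and so close to the lattice the kernel exceeds half its value at 0.\<close>

lemma irrational_line_dense:
  fixes Y W :: "real ^ 'n"
  assumes irr: "\<And>k :: 'n \<Rightarrow> int. (\<Sum>c\<in>UNIV. of_int (k c) * W $ c) = 0 \<Longrightarrow> (\<forall>c. k c = 0)"
  shows "\<exists>s. \<Phi> 0 / 2 < \<Phi> (Y + s *\<^sub>R W)"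
proof -
  interpret Z: Modules.module "\<lambda>r. (*) (real_of_int r)"
    by (simp add: Modules.module.intro distrib_left mult.commute)
  define n where "n = CARD('n)"
  obtain e where e: "bij_betw e {..<n} (UNIV :: 'n set)"
    using ex_bij_betw_nat_finite[of "UNIV :: 'n set"] by (auto simp: n_def atLeast0LessThan)
  \<comment> \<open>Independence over the integers is a property of the set of components, so
    repetitions must be excluded separately; a repetition would itself be an integer
    relation.\<close>
  have injW: "inj (\<lambda>c. W $ c)"
  proof (rule injI)
    fix c d assume eq: "W $ c = W $ d"
    show "c = d"
    proof (rule ccontr)
      assume cd: "c \<noteq> d"
      define k :: "'n \<Rightarrow> int" where "k x = (if x = c then 1 else if x = d then - 1 else 0)" for x
      have "(\<Sum>x\<in>UNIV. of_int (k x) * W $ x) = (\<Sum>x\<in>{c, d}. of_int (k x) * W $ x)"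
        by (rule sum.mono_neutral_right) (auto simp: k_def)
      also have "\<dots> = 0" using cd eq by (simp add: k_def)
      finally have "k c = 0" using irr by blast
      then show False by (simp add: k_def)
    qed
  qed
  have range_e: "(\<lambda>i. W $ e i) ` {..<n} = range (\<lambda>c. W $ c)"
    using e by (auto simp: bij_betw_def image_image[symmetric])
  have "Z.independent ((\<lambda>i. W $ e i) ` {..<n})"
  proof
    assume "Z.dependent ((\<lambda>i. W $ e i) ` {..<n})"
    then obtain t u where t: "finite t" "t \<subseteq> range (\<lambda>c. W $ c)" "(\<Sum>v\<in>t. real_of_int (u v) * v) = 0" "\<exists>v\<in>t. u v \<noteq> 0"
      unfolding Z.dependent_explicit range_e by blast
    define k where "k c = (if W $ c \<in> t then u (W $ c) else 0)" for c
    have "(\<Sum>c\<in>UNIV. of_int (k c) * W $ c) = (\<Sum>v\<in>range (\<lambda>c. W $ c). of_int (if v \<in> t then u v else 0) * v)"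
      by (simp add: sum.reindex[OF injW] k_def)
    also have "\<dots> = (\<Sum>v\<in>t. real_of_int (u v) * v)"
      using t(2) by (intro sum.mono_neutral_cong_right) auto
    finally have "\<forall>c. k c = 0" using t(3) irr by simp
    then have k0: "k c = 0" for c by blast
    obtain v c where "v \<in> t" "u v \<noteq> 0" "v = W $ c" using t(2,4) by blast
    then show False using k0[of c] by (simp add: k_def)
  qed
  moreover have "inj_on (\<lambda>i. W $ e i) {..<n}"
    using comp_inj_on[of e "{..<n}" "\<lambda>c. W $ c"] e injW
    by (auto simp: bij_betw_def comp_def inj_on_def)
  \<comment> \<open>At distance \<open>\<delta>\<close> the Lipschitz bound still leaves more than
    half of \<open>\<Phi> 0\<close>; below, \<open>\<epsilon>\<close> distributes
    \<open>\<delta>\<close> over the \<open>n\<close> coordinates, measured in periods.\<close>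
  moreover define \<delta> where "\<delta> = \<Phi> 0 / (2 * (\<Lambda> + 1))"
  have \<delta>: "0 < \<delta>" using \<Phi>_0 \<Lambda>_nonneg by (simp add: \<delta>_def)
  define \<epsilon> where "\<epsilon> = \<delta> / (real n * (2 * pi))"
  have n0: "0 < n" by (simp add: n_def)
  have "0 < \<epsilon>" using \<delta> n0 by (simp add: \<epsilon>_def)
  \<comment> \<open>Approximating \<open>- Y / (2 * pi)\<close> by a multiple \<open>t * W\<close>
    modulo integers puts \<open>Y + 2 * pi * t * W\<close> near the lattice.\<close>
  ultimately obtain t h where th: "\<And>i. i < n \<Longrightarrow> \<bar>t * (W $ e i) - of_int (h i) - - (Y $ e i) / (2 * pi)\<bar> < \<epsilon>"
    using Kronecker_thm_1[of "\<lambda>i. W $ e i" n \<epsilon> "\<lambda>i. - (Y $ e i) / (2 * pi)"] by blast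
  define e' where "e' = the_inv_into {..<n} e"
  have e': "e' c < n" "e (e' c) = c" for c
    using e the_inv_into_into[of e "{..<n}" c "{..<n}"] f_the_inv_into_f[of e "{..<n}" c]
    by (auto simp: bij_betw_def e'_def)
  define l :: "real ^ 'n" where "l = (\<chi> c. 2 * pi * of_int (- h (e' c)))"
  define s where "s = 2 * pi * t"
  have "norm (Y + s *\<^sub>R W + l) \<le> real n * (2 * pi * \<epsilon>)"
  proof -
    have "\<bar>(Y + s *\<^sub>R W + l) $ c\<bar> \<le> 2 * pi * \<epsilon>" for c
    proof -
      have "(Y + s *\<^sub>R W + l) $ c = 2 * pi * (t * (W $ c) - of_int (h (e' c)) - - (Y $ c) / (2 * pi))"
        by (simp add: l_def s_def field_simps)
      then have "\<bar>(Y + s *\<^sub>R W + l) $ c\<bar> = 2 * pi * \<bar>t * (W $ c) - of_int (h (e' c)) - - (Y $ c) / (2 * pi)\<bar>"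
        by (simp only: abs_mult) simp
      also have "\<dots> \<le> 2 * pi * \<epsilon>" using th[OF e'(1)[of c]] by (intro mult_left_mono) (auto simp: e'(2))
      finally show ?thesis .
    qed
    then show ?thesis
      using order_trans[OF norm_le_l1_cart sum_bounded_above[of UNIV "\<lambda>c. \<bar>(Y + s *\<^sub>R W + l) $ c\<bar>" "2 * pi * \<epsilon>"]]
      by (simp add: n_def)
  qed
  also have "\<dots> = \<delta>" using n0 by (simp add: \<epsilon>_def)
  finally have "\<Lambda> * norm (Y + s *\<^sub>R W + l) \<le> \<Lambda> * \<delta>" using \<Lambda>_nonneg by (rule mult_left_mono)
  also have "\<dots> < (\<Lambda> + 1) * \<delta>" using \<delta> by simp
  also have "\<dots> = \<Phi> 0 / 2" using \<Lambda>_nonneg by (simp add: \<delta>_def field_simps add_nonneg_eq_0_iff)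
  finally have "\<Phi> 0 / 2 < \<Phi> (Y + s *\<^sub>R W + l)"
    using \<Phi>_lipschitz[of "Y + s *\<^sub>R W + l" 0] by simp
  moreover have "\<Phi> (Y + s *\<^sub>R W + l) = \<Phi> (Y + s *\<^sub>R W)"
    by (rule \<Phi>_periodic) (auto simp: l_def simp del: of_int_minus)
  ultimately show ?thesis by auto
qed

text \<open>The level \<open>\<Phi> 0 / 2\<close> instead of 0 leaves room for approximation errors,
  the weak inequality makes the set closed, and the speed bound makes its part in the cell
  bounded.\<close>

definition avoiding :: "'N \<Rightarrow> 'N \<Rightarrow> real \<Rightarrow> real \<Rightarrow> (((real ^ 'n) ^ 'N::finite) \<times> ((real ^ 'n) ^ 'N)) set" where
  "avoiding i j L R = {z. norm (snd z) \<le> R \<and>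
    (\<forall>s\<in>{-L..L}. \<Phi> ((fst z $ i - fst z $ j) + s *\<^sub>R (snd z $ i - snd z $ j)) \<le> \<Phi> 0 / 2)}"

lemma closed_avoiding: "closed (avoiding i j L R)"
proof -
  have "avoiding i j L R = {z. norm (snd z) \<le> R} \<inter>
    (\<Inter>s\<in>{-L..L}. {z. \<Phi> ((fst z $ i - fst z $ j) + s *\<^sub>R (snd z $ i - snd z $ j)) \<le> \<Phi> 0 / 2})"
    by (auto simp: avoiding_def)
  also have "closed \<dots>"
    by (intro closed_Int closed_INT ballI closed_Collect_le continuous_intros)
  finally show ?thesis .
qed

text \<open>A line that stays below the level forever has a nontrivial integer relation between the
  components of its direction. Each such relation cuts out a hyperplane of phase space, and there
  are countably many relations.\<close>

lemma negligible_avoiding_forever: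
  fixes i j :: "'N::finite"
  assumes "i \<noteq> j"
  shows "negligible (\<Inter>n. avoiding i j (real n) R)"
proof -
  define a :: "('n \<Rightarrow> int) \<Rightarrow> ((real ^ 'n) ^ 'N) \<times> ((real ^ 'n) ^ 'N)" where
    "a k = (0, axis i (\<chi> c. of_int (k c)) - axis j (\<chi> c. of_int (k c)))" for k
  have inner: "a k \<bullet> z = (\<Sum>c\<in>UNIV. of_int (k c) * (snd z $ i - snd z $ j) $ c)" for k z
  proof -
    have "a k \<bullet> z = (\<chi> c. of_int (k c)) \<bullet> (snd z $ i - snd z $ j)"
      by (cases z) (simp add: a_def inner_diff inner_axis')
    then show ?thesis by (simp add: inner_vec_def)
  qed
  have "a k \<noteq> 0" if "k c \<noteq> 0" for k c
  proof -
    have "snd (a k) $ i $ c = of_int (k c)" using assms by (simp add: a_def axis_def)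
    then show ?thesis using that by (auto simp: prod_eq_iff)
  qed
  then have "negligible (\<Union>k\<in>{k. \<exists>c. k c \<noteq> 0}. {z. a k \<bullet> z = 0})"
    by (intro negligible_countable_Union) (auto intro!: negligible_hyperplane)
  moreover have "(\<Inter>n. avoiding i j (real n) R) \<subseteq> (\<Union>k\<in>{k. \<exists>c. k c \<noteq> 0}. {z. a k \<bullet> z = 0})"
  proof
    fix z assume z: "z \<in> (\<Inter>n. avoiding i j (real n) R)"
    show "z \<in> (\<Union>k\<in>{k. \<exists>c. k c \<noteq> 0}. {z. a k \<bullet> z = 0})"
    proof (rule ccontr)
      assume "\<not> ?thesis"
      then have "\<And>k. (\<Sum>c\<in>UNIV. of_int (k c) * (snd z $ i - snd z $ j) $ c) = 0 \<Longrightarrow> (\<forall>c. k c = 0)"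
        by (auto simp: inner)
      from irrational_line_dense[where W = "snd z $ i - snd z $ j" and Y = "fst z $ i - fst z $ j", OF this]
      obtain s where s: "\<Phi> 0 / 2 < \<Phi> ((fst z $ i - fst z $ j) + s *\<^sub>R (snd z $ i - snd z $ j))" by auto
      obtain n :: nat where "\<bar>s\<bar> \<le> real n" using real_arch_simple by blast
      then have "s \<in> {- real n..real n}" by auto
      with z have "\<Phi> ((fst z $ i - fst z $ j) + s *\<^sub>R (snd z $ i - snd z $ j)) \<le> \<Phi> 0 / 2"
        unfolding avoiding_def by blast
      with s show False by simp
    qed
  qed
  ultimately show ?thesis by (rule negligible_subset)
qed

section \<open>Initial data with pairwise distinct limit velocities\<close>


lemma \<Phi>_position_lattice:
  fixes z l :: "((real ^ 'n) ^ 'N::finite) \<times> ((real ^ 'n) ^ 'N)"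
  assumes "l \<in> position_lattice"
  shows "\<Phi> (fst (z + l) $ i - fst (z + l) $ j + y) = \<Phi> (fst z $ i - fst z $ j + y)"
    and "\<Phi> (fst (z + l) $ i - fst (z + l) $ j) = \<Phi> (fst z $ i - fst z $ j)"
    and "snd (z + l) = snd z"
proof -
  obtain m where l: "l = (m, 0)" and m: "\<forall>i k. \<exists>a::int. m $ i $ k = 2 * pi * of_int a"
    using assms by (auto simp: position_lattice_def)
  have per: "\<exists>a::int. (m $ i - m $ j) $ k = 2 * pi * of_int a" for k
  proof -
    obtain a b :: int where "m $ i $ k = 2 * pi * of_int a" "m $ j $ k = 2 * pi * of_int b" using m by blast
    then show ?thesis by (intro exI[of _ "a - b"]) (simp add: algebra_simps)
  qed
  have eq: "fst (z + l) $ i - fst (z + l) $ j + y = (fst z $ i - fst z $ j + y) + (m $ i - m $ j)" for y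
    by (simp add: l)
  show 1: "\<Phi> (fst (z + l) $ i - fst (z + l) $ j + y) = \<Phi> (fst z $ i - fst z $ j + y)" for y
    unfolding eq by (rule \<Phi>_periodic[OF per])
  show "\<Phi> (fst (z + l) $ i - fst (z + l) $ j) = \<Phi> (fst z $ i - fst z $ j)" using 1[of 0] by simp
  show "snd (z + l) = snd z" by (simp add: l)
qed

lemma periodic_data:
  fixes z l :: "((real ^ 'n) ^ 'N::finite) \<times> ((real ^ 'n) ^ 'N)"
  assumes "l \<in> position_lattice"
  shows "cs_field (z + l) = cs_field z" and "cs_damping b (z + l) = cs_damping b z"
    and "z + l \<in> avoiding i j L R \<longleftrightarrow> z \<in> avoiding i j L R"
  unfolding cs_field_def accel_def cs_damping_def rate_def avoiding_def mem_Collect_eq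
    \<Phi>_position_lattice[OF assms] by simp_all

text \<open>Moving the state by \<open>\<epsilon>\<close> moves the point of its line at parameter
  \<open>s\<close> by at most \<open>2 * \<epsilon> + L * (2 * \<epsilon>)\<close>, and the
  Lipschitz bound then raises the level from \<open>\<Phi> 0 / 4\<close> to at most
  \<open>\<Phi> 0 / 2\<close>.\<close>

lemma cball_subset_avoiding:
  fixes x v :: "(real ^ 'n) ^ 'N::finite"
  assumes v: "norm v \<le> R" and L: "0 \<le> L"
    and \<Phi>: "\<And>s. s \<in> {-L..L} \<Longrightarrow> \<Phi> ((x $ i - x $ j) + s *\<^sub>R (v $ i - v $ j)) \<le> \<Phi> 0 / 4"
    and \<epsilon>: "\<epsilon> \<le> 1" "\<Lambda> * (2 * \<epsilon> + L * (2 * \<epsilon>)) \<le> \<Phi> 0 / 4"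
  shows "cball (x, v) \<epsilon> \<subseteq> avoiding i j L (R + 1)"
proof
  fix y assume "y \<in> cball (x, v) \<epsilon>"
  then have y: "norm (y - (x, v)) \<le> \<epsilon>" by (simp add: dist_norm norm_minus_commute)
  have d1: "norm (fst y $ k - x $ k) \<le> \<epsilon>" and d2: "norm (snd y $ k - v $ k) \<le> \<epsilon>" for k
    using norm_pair_components[of y k "(x, v)"] y by auto
  have "norm (snd y - v) \<le> \<epsilon>" using norm_snd_diff_le[of y "(x, v)"] y by simp
  then have "norm (snd y) \<le> R + 1" using v \<epsilon>(1) norm_triangle_sub[of "snd y" v] by linarith
  moreover have "\<Phi> ((fst y $ i - fst y $ j) + s *\<^sub>R (snd y $ i - snd y $ j)) \<le> \<Phi> 0 / 2" if s: "s \<in> {-L..L}" for s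
  proof -
    let ?a = "fst y $ i - x $ i" and ?b = "fst y $ j - x $ j"
    let ?c = "snd y $ i - v $ i" and ?d = "snd y $ j - v $ j"
    have "norm (((fst y $ i - fst y $ j) + s *\<^sub>R (snd y $ i - snd y $ j)) -
        ((x $ i - x $ j) + s *\<^sub>R (v $ i - v $ j))) = norm ((?a - ?b) + s *\<^sub>R (?c - ?d))"
      by (simp add: algebra_simps)
    also have "\<dots> \<le> norm (?a - ?b) + \<bar>s\<bar> * norm (?c - ?d)"
      using norm_triangle_ineq[of "?a - ?b" "s *\<^sub>R (?c - ?d)"] by simp
    also have "\<dots> \<le> 2 * \<epsilon> + L * (2 * \<epsilon>)"
    proof (intro add_mono mult_mono)
      show "norm (?a - ?b) \<le> 2 * \<epsilon>" using norm_triangle_ineq4[of ?a ?b] d1[of i] d1[of j] by simp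
      show "norm (?c - ?d) \<le> 2 * \<epsilon>" using norm_triangle_ineq4[of ?c ?d] d2[of i] d2[of j] by simp
    qed (use s L in auto)
    finally have "\<Lambda> * norm (((fst y $ i - fst y $ j) + s *\<^sub>R (snd y $ i - snd y $ j)) -
        ((x $ i - x $ j) + s *\<^sub>R (v $ i - v $ j))) \<le> \<Phi> 0 / 4"
      using \<epsilon>(2) \<Lambda>_nonneg by (meson mult_left_mono order_trans)
    with \<Phi>[OF s] \<Phi>_lipschitz[of "(fst y $ i - fst y $ j) + s *\<^sub>R (snd y $ i - snd y $ j)"
        "(x $ i - x $ j) + s *\<^sub>R (v $ i - v $ j)"]
    show ?thesis by linarith
  qed
  ultimately show "y \<in> avoiding i j L (R + 1)" by (simp add: avoiding_def)
qed

lemma emeasure_avoiding_tendsto_0: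
  fixes i j :: "'N::finite"
  assumes "i \<noteq> j"
  shows "(\<lambda>n. emeasure lborel (avoiding i j (real n) R \<inter> phase_cell)) \<longlonglongrightarrow> 0"
proof -
  let ?A = "\<lambda>n. avoiding i j (real n) R \<inter> phase_cell"
  have sets: "?A n \<in> sets borel" for n
    by (intro sets.Int borel_closed[OF closed_avoiding] phase_cell_borel)
  have fin: "emeasure lborel (?A n) \<noteq> \<infinity>" for n
  proof -
    have "bounded (?A n)" by (rule bounded_subset[OF bounded_cell_slab[of R]]) (auto simp: avoiding_def)
    then show ?thesis using emeasure_bounded_finite[of "?A n"] by simp
  qed
  have "decseq ?A" unfolding decseq_def avoiding_def by auto
  then have "(\<lambda>n. emeasure lborel (?A n)) \<longlonglongrightarrow> emeasure lborel (\<Inter>n. ?A n)"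
    using sets fin by (intro Lim_emeasure_decseq) auto
  moreover have "emeasure lborel (\<Inter>n. ?A n) = 0"
  proof -
    have "negligible (\<Inter>n. ?A n)"
      by (rule negligible_subset[OF negligible_avoiding_forever[OF assms, of R]]) auto
    then have "emeasure lebesgue (\<Inter>n. ?A n) = 0" by (simp add: negligible_iff_null_sets null_setsD1)
    moreover have "(\<Inter>n. ?A n) \<in> sets lborel" by (intro sets.countable_INT) (use sets in auto)
    ultimately show ?thesis by simp
  qed
  ultimately show ?thesis by simp
qed

definition spread_data :: "(((real ^ 'n) ^ 'N::finite) \<times> ((real ^ 'n) ^ 'N)) set" where
  "spread_data = {z. \<exists>X V w. lifted_solution X V \<and> (X 0, V 0) = z \<and> (V \<longlongrightarrow> w) at_top \<and>
    (\<forall>i j. i \<noteq> j \<longrightarrow> w $ i \<noteq> w $ j)}"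

text \<open>\<open>R\<close> fixes the slab with its bounds on the field and \<open>M\<close> fixes
  the volume factor, so that the estimates are uniform on the set. Countably many such sets exhaust
  \<open>spread_data\<close> within the cell.\<close>

definition bounded_spread_data :: "nat \<Rightarrow> nat \<Rightarrow> (((real ^ 'n) ^ 'N::finite) \<times> ((real ^ 'n) ^ 'N)) set" where
  "bounded_spread_data R M = {z \<in> phase_cell. \<exists>X V w. lifted_solution X V \<and> (X 0, V 0) = z \<and>
    (V \<longlongrightarrow> w) at_top \<and> (\<forall>i j. i \<noteq> j \<longrightarrow> w $ i \<noteq> w $ j) \<and>
    norm (V 0) \<le> real R \<and> (\<forall>t\<ge>0. total_damping X t \<le> real M)}"

text \<open>For fixed \<open>n\<close>, data whose solutions stay in the avoiding set from time
  \<open>m + 1\<close> on are carried into it at that time, so they have a cover of volume at most a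
  constant times the volume of the avoiding set in the cell. The constant does not depend on
  \<open>m\<close>, the bound passes to the union over \<open>m\<close>, and then \<open>n\<close>
  tends to infinity.\<close>

lemma negligible_bounded_spread_data:
  fixes i j :: "'N::finite"
  assumes ij: "i \<noteq> j"
  shows "negligible (bounded_spread_data R M :: (((real ^ 'n) ^ 'N) \<times> ((real ^ 'n) ^ 'N)) set)"
    (is "negligible ?A")
proof (rule negligible_if_cover_small)
  let ?C = "ennreal (exp (2 * real M + 1))"
  show "(\<lambda>n. ?C * emeasure lborel (avoiding i j (real n) (real R + 1) \<inter> phase_cell)) \<longlonglongrightarrow> 0"
    using ennreal_tendsto_cmult[OF _ emeasure_avoiding_tendsto_0[OF ij], of ?C "real R + 1"] by simp
next
  fix n :: nat
  let ?C = "ennreal (exp (2 * real M + 1))"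
  let ?G = "avoiding i j (real n) (real R + 1)"
  \<comment> \<open>With this \<open>q\<close>, displacing the state by
    \<open>\<epsilon> \<le> \<Phi> 0 / q\<close> costs at most \<open>\<Phi> 0 / 4\<close> in the
    kernel on the segment of parameters up to \<open>n\<close>.\<close>
  define q where "q = 8 * (\<Lambda> + 1) * (1 + real n)"
  have q: "0 < q" unfolding q_def using \<Lambda>_nonneg by (intro mult_pos_pos) auto
  define \<epsilon> where "\<epsilon> = min 1 (\<Phi> 0 / q)"
  have \<epsilon>: "0 < \<epsilon>" "\<epsilon> \<le> 1" using \<Phi>_0 q by (auto simp: \<epsilon>_def)
  have "\<Lambda> * (2 * \<epsilon> + real n * (2 * \<epsilon>)) \<le> (\<Lambda> + 1) * (2 * \<epsilon> + real n * (2 * \<epsilon>))"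
    using \<epsilon> by (intro mult_right_mono) auto
  also have "\<dots> = q * \<epsilon> / 4" by (simp add: q_def algebra_simps)
  also have "\<dots> \<le> q * (\<Phi> 0 / q) / 4"
    using q by (intro divide_right_mono mult_left_mono) (auto simp: \<epsilon>_def)
  also have "\<dots> = \<Phi> 0 / 4" using q by simp
  finally have \<epsilon>\<Lambda>: "\<Lambda> * (2 * \<epsilon> + real n * (2 * \<epsilon>)) \<le> \<Phi> 0 / 4" .
  \<comment> \<open>\<open>Suc m\<close> makes the time positive, as the scheme requires. Demanding
    the ball at all later times makes the sets increase with \<open>m\<close>.\<close>
  define A where "A m = {z \<in> phase_cell. \<exists>X V. lifted_solution X V \<and> (X 0, V 0) = z \<and>
    norm (V 0) \<le> real R \<and> (\<forall>t\<ge>0. total_damping X t \<le> real M) \<and>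
    (\<forall>t\<ge>real (Suc m). cball (X t, V t) \<epsilon> \<subseteq> ?G)}" for m
  have "\<exists>S\<in>sets lborel. (\<Union>m. A m) \<subseteq> S \<and> emeasure lborel S \<le> ?C * emeasure lborel (?G \<inter> phase_cell)"
  proof (rule cover_increasing_Union)
    show "incseq A" unfolding incseq_def
    proof (intro allI impI subsetI)
      fix m m' :: nat and z assume mm: "m \<le> m'" and "z \<in> A m"
      then obtain X V where XV: "z \<in> phase_cell" "lifted_solution X V" "(X 0, V 0) = z" "norm (V 0) \<le> real R"
        "\<forall>t\<ge>0. total_damping X t \<le> real M" "\<forall>t\<ge>real (Suc m). cball (X t, V t) \<epsilon> \<subseteq> ?G"
        unfolding A_def by blast
      have "real (Suc m) \<le> t" if "real (Suc m') \<le> t" for t using mm that by simp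
      then have "\<forall>t\<ge>real (Suc m'). cball (X t, V t) \<epsilon> \<subseteq> ?G" using XV(6) by blast
      then show "z \<in> A m'" unfolding A_def using XV(1-5) by blast
    qed
    fix m
    have R1: "0 \<le> (real R + 1) + H * (2 * (real R + 1))" using H_pos by simp
    \<comment> \<open>One constant that serves the Lipschitz conditions of both the field and the
      damping.\<close>
    define K where "K = (1 + 4 * \<Lambda> * (real R + 1) + 2 * H) + real CARD('N) * (2 * \<Lambda>)"
    have K1: "1 + 4 * \<Lambda> * (real R + 1) + 2 * H \<le> K" "real CARD('N) * (2 * \<Lambda>) \<le> K" "0 \<le> K"
      using \<Lambda>_nonneg H_pos by (auto simp: K_def add_nonneg_nonneg)
    have "\<exists>S\<in>sets borel. A m \<subseteq> S \<and> emeasure lborel S \<le> ?C * emeasure lborel (?G \<inter> phase_cell)"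
    proof (rule cs.emeasure_cover_trajectories[where U = "slab (real R + 1)" and T = "real (Suc m)"
          and \<epsilon> = \<epsilon> and \<Lambda> = position_lattice])
      fix x y b :: "((real ^ 'n) ^ 'N) \<times> ((real ^ 'n) ^ 'N)"
      assume x: "x \<in> slab (real R + 1)" and b: "b \<in> Basis"
      show "\<bar>cs_field x \<bullet> b\<bar> \<le> (real R + 1) + H * (2 * (real R + 1))" by (rule cs_field_bounded[OF x b])
      show "\<bar>cs_field x \<bullet> b - cs_field y \<bullet> b\<bar> \<le> K * norm (x - y)"
        using cs_field_lipschitz[OF x b, of y] mult_right_mono[OF K1(1), of "norm (x - y)"] by simp
      show "\<bar>cs_damping b x - cs_damping b y\<bar> \<le> K * norm (x - y)"
        using cs_damping_lipschitz[OF b, of x y] mult_right_mono[OF K1(2), of "norm (x - y)"] by simp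
    next
      fix z assume "z \<in> A m"
      then obtain X V where XV: "lifted_solution X V" "(X 0, V 0) = z" "norm (V 0) \<le> real R"
        "\<forall>t\<ge>0. total_damping X t \<le> real M" "\<forall>t\<ge>real (Suc m). cball (X t, V t) \<epsilon> \<subseteq> ?G"
        unfolding A_def by blast
      have "total_damping X (real (Suc m)) - total_damping X 0 \<le> real M"
        using XV(4) by (simp add: total_damping_def)
      then show "\<exists>z' Q. z' 0 = z \<and> cs.trajectory_until (slab (real R + 1)) (real (Suc m)) z' Q \<and>
          Q (real (Suc m)) - Q 0 \<le> real M \<and> cball (z' (real (Suc m))) \<epsilon> \<subseteq> ?G"
        using trajectory[OF XV(1,3)] XV(2,5)
        by (intro exI[of _ "\<lambda>t. (X t, V t)"] exI[of _ "total_damping X"]) auto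
    next
      show "avoiding i j (real n) (real R + 1) \<in> sets borel" by (rule borel_closed[OF closed_avoiding])
      show "A m \<subseteq> phase_cell" by (auto simp: A_def)
    qed (use R1 K1(3) \<epsilon>(1) in \<open>simp_all add: phase_cell_borel countable_position_lattice
        uminus_position_lattice periodic_data position_lattice_cell del: ex1_eq\<close>)
    then show "\<exists>S\<in>sets lborel. A m \<subseteq> S \<and> emeasure lborel S \<le> ?C * emeasure lborel (?G \<inter> phase_cell)"
      by simp
  qed
  moreover have "?A \<subseteq> (\<Union>m. A m)"
  proof
    fix z assume "z \<in> ?A"
    then obtain X V w where z: "z \<in> phase_cell" and sol: "lifted_solution X V" and z0: "(X 0, V 0) = z"
      and lim: "(V \<longlongrightarrow> w) at_top" and dist: "\<And>i j :: 'N. i \<noteq> j \<Longrightarrow> w $ i \<noteq> w $ j"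
      and R: "norm (V 0) \<le> real R" and M: "\<forall>t\<ge>0. total_damping X t \<le> real M"
      unfolding bounded_spread_data_def by blast
    have "\<forall>\<^sub>F t in at_top. \<forall>s\<in>{-real n..real n}. \<Phi> ((X t $ i - X t $ j) + s *\<^sub>R (V t $ i - V t $ j)) \<le> \<Phi> 0 / 4"
      using \<Phi>_0 by (intro relative_line_avoids[OF sol lim dist ij]) auto
    then obtain T where T: "\<And>t s. T \<le> t \<Longrightarrow> s \<in> {-real n..real n} \<Longrightarrow>
        \<Phi> ((X t $ i - X t $ j) + s *\<^sub>R (V t $ i - V t $ j)) \<le> \<Phi> 0 / 4"
      unfolding eventually_at_top_linorder by blast
    obtain m :: nat where m: "T \<le> real m" using real_arch_simple by blast
    have "cball (X t, V t) \<epsilon> \<subseteq> ?G" if t: "real (Suc m) \<le> t" for t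
    proof (rule cball_subset_avoiding[OF _ _ _ \<epsilon>(2) \<epsilon>\<Lambda>])
      show "norm (V t) \<le> real R" using norm_V_le[OF sol, of t] R t by simp
      show "\<Phi> ((X t $ i - X t $ j) + s *\<^sub>R (V t $ i - V t $ j)) \<le> \<Phi> 0 / 4" if "s \<in> {-real n..real n}" for s
        using T[of t s] that t m by simp
    qed simp
    then have "z \<in> A m" using z sol z0 R M unfolding A_def by blast
    then show "z \<in> (\<Union>m. A m)" by blast
  qed
  ultimately show "\<exists>S\<in>sets borel. ?A \<subseteq> S \<and> emeasure lborel S \<le> ?C * emeasure lborel (?G \<inter> phase_cell)"
    unfolding sets_lborel by (meson subset_trans)
qed

lemma negligible_spread_data:
  assumes "CARD('N::finite) \<ge> 2"
  shows "negligible (phase_cell \<inter> (spread_data :: (((real ^ 'n) ^ 'N) \<times> ((real ^ 'n) ^ 'N)) set))"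
proof -
  obtain i j :: 'N where ij: "i \<noteq> j"
    using assms card_le_Suc0_iff_eq[of "UNIV :: 'N set"] by auto
  let ?A = "\<lambda>(R, M). bounded_spread_data R M :: (((real ^ 'n) ^ 'N) \<times> ((real ^ 'n) ^ 'N)) set"
  have "negligible (\<Union>p. ?A p)"
    by (intro negligible_countable_Union) (auto intro!: negligible_bounded_spread_data[OF ij])
  moreover have "phase_cell \<inter> spread_data \<subseteq> (\<Union>p. ?A p)"
  proof
    fix z assume "z \<in> phase_cell \<inter> (spread_data :: (((real ^ 'n) ^ 'N) \<times> ((real ^ 'n) ^ 'N)) set)"
    then obtain X V w where z: "z \<in> phase_cell" and sol: "lifted_solution X V" and z0: "(X 0, V 0) = z"
      and lim: "(V \<longlongrightarrow> w) at_top" and dist: "\<And>i j. i \<noteq> j \<Longrightarrow> w $ i \<noteq> w $ j"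
      by (auto simp: spread_data_def)
    obtain M0 where "\<forall>t\<ge>0. total_damping X t \<le> M0" using total_damping_bounded[OF sol lim dist] by blast
    moreover obtain M :: nat where "M0 \<le> real M" using real_arch_simple by blast
    ultimately have "\<forall>t\<ge>0. total_damping X t \<le> real M" by force
    moreover obtain R :: nat where "norm (V 0) \<le> real R" using real_arch_simple by blast
    ultimately have "z \<in> ?A (R, M)"
      using z sol z0 lim dist unfolding bounded_spread_data_def by blast
    then show "z \<in> (\<Union>p. ?A p)" by blast
  qed
  ultimately show ?thesis by (rule negligible_subset)
qed

end

section \<open>Descent to the torus\<close>

lemma abs_torus_eq_iff: "abs_torus X = abs_torus Y \<longleftrightarrow> torus_rel X Y"
  by (rule torus.abs_eq_iff)

lemma torus_norm_le: "torus_norm (abs_torus X) \<le> norm X"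
  unfolding torus_norm_def by (rule cINF_lower) (auto intro: bdd_belowI[of _ 0])

lemma torus_representative: "\<exists>X. abs_torus X = x"
  by (metis Quotient_abs_rep Quotient_torus)

lemma torus_norm_nonneg: "0 \<le> torus_norm x"
  unfolding torus_norm_def using torus_representative[of x] by (intro cINF_greatest) auto

text \<open>Used for \<open>x\<close> and for \<open>- x\<close> it gives equality; a kernel that is
  monotone in the norm is therefore even.\<close>

lemma torus_norm_uminus_le: "torus_norm (- x) \<le> torus_norm x"
proof -
  have "torus_norm (- x) \<le> norm X" if "abs_torus X = x" for X
    using torus_norm_le[of "- X"] that by (simp add: uminus_torus.abs_eq[symmetric])
  then show ?thesis
    unfolding torus_norm_def[of x] using torus_representative[of x] by (intro cINF_greatest) auto
qed

text \<open>Close points are translated together into a ball where the derivative is bounded by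
  compactness. For points at distance more than 1 the bound \<open>H\<close> on the values
  suffices.\<close>

lemma bounded_C1_periodic_lipschitz:
  fixes f :: "real ^ 'n::finite \<Rightarrow> real" and D :: "real ^ 'n \<Rightarrow> (real ^ 'n) \<Rightarrow>\<^sub>L real"
  assumes D: "\<And>X. (f has_derivative blinfun_apply (D X)) (at X)" "continuous_on UNIV D"
    and bd: "\<And>X. 0 \<le> f X" "\<And>X. f X \<le> H"
    and per: "\<And>X l. (\<And>k. \<exists>m::int. l $ k = 2 * pi * of_int m) \<Longrightarrow> f (X + l) = f X"
  shows "\<exists>\<Lambda>. \<forall>X Y. \<bar>f X - f Y\<bar> \<le> \<Lambda> * norm (X - Y)"
proof -
  \<comment> \<open>Radius of a ball that contains the cell together with its neighbourhood of width
    1.\<close>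
  define r where "r = real CARD('n) * (2 * pi) + 1"
  have "compact (D ` cball 0 r)"
    by (rule compact_continuous_image) (auto intro: continuous_on_subset[OF D(2)])
  then obtain c where c: "\<And>X. X \<in> cball 0 r \<Longrightarrow> norm (D X) \<le> c"
    using bounded_iff compact_imp_bounded by (metis image_eqI)
  have H0: "0 \<le> H" using order_trans[OF bd(1) bd(2)] .
  have loc: "\<bar>f X - f Y\<bar> \<le> c * norm (X - Y)" if "X \<in> cball 0 r" "Y \<in> cball 0 r" for X Y
  proof -
    have "norm (f X - f Y) \<le> c * norm (X - Y)"
    proof (rule differentiable_bound[where S = "cball 0 r" and f' = "\<lambda>x. blinfun_apply (D x)"])
      show "onorm (blinfun_apply (D x)) \<le> c" if "x \<in> cball 0 r" for x
        using c[OF that] by (simp add: norm_blinfun.rep_eq)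
    qed (use that D(1) in \<open>auto intro: has_derivative_at_withinI\<close>)
    then show ?thesis by simp
  qed
  have "\<bar>f X - f Y\<bar> \<le> max c H * norm (X - Y)" for X Y
  proof (cases "norm (X - Y) \<le> 1")
    case True
    define l :: "real ^ 'n" where "l = (\<chi> k. 2 * pi * of_int (- \<lfloor>X $ k / (2 * pi)\<rfloor>))"
    have l: "\<exists>m::int. l $ k = 2 * pi * of_int m" for k by (auto simp: l_def simp del: of_int_minus)
    have fl: "0 \<le> x + 2 * pi * of_int (- \<lfloor>x / (2 * pi)\<rfloor>) \<and> x + 2 * pi * of_int (- \<lfloor>x / (2 * pi)\<rfloor>) < 2 * pi"
      for x :: real
      by (simp only: floor_period_unique)
    have "\<bar>(X + l) $ k\<bar> \<le> 2 * pi" for k using fl[of "X $ k"] by (simp add: l_def)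
    then have X: "norm (X + l) \<le> real CARD('n) * (2 * pi)"
      using order_trans[OF norm_le_l1_cart sum_bounded_above[of UNIV "\<lambda>k. \<bar>(X + l) $ k\<bar>" "2 * pi"]] by simp
    have "norm (Y + l) \<le> norm (X + l) + norm (X - Y)"
      using norm_triangle_ineq4[of "X + l" "X - Y"] by (simp add: add.commute)
    with X True have "\<bar>f (X + l) - f (Y + l)\<bar> \<le> c * norm ((X + l) - (Y + l))"
      by (intro loc) (auto simp: r_def)
    also have "\<dots> \<le> max c H * norm (X - Y)" by (simp add: mult_right_mono)
    finally show ?thesis by (simp add: per[OF l])
  next
    case False
    have "\<bar>f X - f Y\<bar> \<le> H" using bd(1)[of X] bd(1)[of Y] bd(2)[of X] bd(2)[of Y] by linarith
    also have "\<dots> \<le> H * norm (X - Y)" using False H0 by (simp add: mult_le_cancel_left1)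
    also have "\<dots> \<le> max c H * norm (X - Y)" by (intro mult_right_mono) auto
    finally show ?thesis .
  qed
  then show ?thesis by blast
qed

lemma strictly_local_kernel_periodic:
  fixes \<phi> :: "'n::finite torus \<Rightarrow> real"
  assumes "r0 > 0" and ker: "strictly_local_kernel r0 \<phi>"
  shows "\<exists>\<Lambda> H. periodic_kernel (\<lambda>X. \<phi> (abs_torus X)) \<Lambda> H"
proof -
  obtain D where D: "\<And>X. ((\<lambda>Y. \<phi> (abs_torus Y)) has_derivative blinfun_apply (D X)) (at X)" "continuous_on UNIV D"
    using ker unfolding strictly_local_kernel_def C1_on_torus_def by blast
  have nn: "\<And>x. 0 \<le> \<phi> x" and mono: "\<And>x y. torus_norm x \<le> torus_norm y \<Longrightarrow> \<phi> y \<le> \<phi> x"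
    and pos: "\<And>x. torus_norm x < r0 \<Longrightarrow> 0 < \<phi> x"
    using ker unfolding strictly_local_kernel_def by blast+
  have per: "abs_torus (X + l) = abs_torus X" if "\<And>k. \<exists>m::int. l $ k = 2 * pi * of_int m" for X l :: "real ^ 'n"
    unfolding abs_torus_eq_iff torus_rel_def using that by simp
  have n0: "torus_norm (abs_torus 0 :: 'n torus) \<le> 0" using torus_norm_le[of 0] by simp
  have le: "\<phi> x \<le> \<phi> (abs_torus 0)" for x
    using n0 torus_norm_nonneg[of x] by (intro mono) simp
  have even: "\<phi> (- x) = \<phi> x" for x
    using mono[OF torus_norm_uminus_le[of x]] mono[OF torus_norm_uminus_le[of "- x"]] by simp
  obtain \<Lambda> where "\<And>X Y. \<bar>\<phi> (abs_torus X) - \<phi> (abs_torus Y)\<bar> \<le> \<Lambda> * norm (X - Y)"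
    using bounded_C1_periodic_lipschitz[OF D, of "\<phi> (abs_torus 0)"] nn le per by metis
  then have "periodic_kernel (\<lambda>X. \<phi> (abs_torus X)) \<Lambda> (\<phi> (abs_torus 0))"
    using nn le per pos n0 \<open>r0 > 0\<close> even by unfold_locales (auto simp: uminus_torus.abs_eq[symmetric])
  then show ?thesis by blast
qed

section \<open>Lifting curves from the torus\<close>

lemma torus_rel_component: "torus_rel X Y \<Longrightarrow> \<exists>m::int. X $ k = Y $ k + 2 * pi * of_int m"
  unfolding torus_rel_def by (metis add.commute diff_add_cancel)

lemma cos_add_2pi_int: "cos (x + 2 * pi * of_int m) = cos x"
  by (simp add: cos_add cos_int_2pin sin_int_2pin)

text \<open>The cosines of the coordinates of the difference between \<open>x\<close> and the projection of \<open>X\<close> are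
  well defined real functions, and constant.\<close>

lemma torus_lift_unique:
  fixes x :: "real \<Rightarrow> 'n::finite torus" and X :: "real \<Rightarrow> real ^ 'n"
  assumes x: "\<And>t. 0 \<le> t \<Longrightarrow> has_torus_derivative x (w t) t {0..}"
    and X: "\<And>t. 0 \<le> t \<Longrightarrow> (X has_vector_derivative w t) (at t within {0..})"
    and x0: "abs_torus (X 0) = x 0" and t: "0 \<le> t"
  shows "abs_torus (X t) = x t"
proof -
  have "\<exists>m::int. X t $ k - rep_torus (x t) $ k = 2 * pi * of_int m" for k
  proof -
    define g where "g s = cos (X s $ k - rep_torus (x s) $ k)" for s
    \<comment> \<open>The value of \<open>g\<close> is the same for every representative, so at each
      time the differentiable lift belonging to that time may be used, although the lift varies with
      the time.\<close>
    have g: "g s = cos (X s $ k - Y s $ k)" if "abs_torus (Y s) = x s" for Y s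
    proof -
      have "abs_torus (rep_torus (x s)) = abs_torus (Y s)"
        using that Quotient_abs_rep[OF Quotient_torus] by simp
      then obtain m :: int where "rep_torus (x s) $ k = Y s $ k + 2 * pi * of_int m"
        unfolding abs_torus_eq_iff using torus_rel_component by blast
      then have "X s $ k - Y s $ k = (X s $ k - rep_torus (x s) $ k) + 2 * pi * of_int m" by simp
      then show ?thesis unfolding g_def by (simp only: cos_add_2pi_int)
    qed
    have g': "(g has_real_derivative 0) (at s within {0..})" if s: "0 \<le> s" for s
    proof -
      obtain Y where Y: "\<And>u. abs_torus (Y u) = x u" "(Y has_vector_derivative w s) (at s within {0..})"
        using x[OF s] unfolding has_torus_derivative_def by blast
      have "((\<lambda>u. X u $ k - Y u $ k) has_vector_derivative w s $ k - w s $ k) (at s within {0..})"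
        by (intro has_vector_derivative_diff bounded_linear.has_vector_derivative[OF bounded_linear_vec_nth] X s Y)
      then have "((\<lambda>u. X u $ k - Y u $ k) has_real_derivative 0) (at s within {0..})"
        by (simp add: has_real_derivative_iff_has_vector_derivative)
      from DERIV_chain2[OF DERIV_cos this]
      have "((\<lambda>u. cos (X u $ k - Y u $ k)) has_real_derivative 0) (at s within {0..})" by simp
      moreover have "g = (\<lambda>u. cos (X u $ k - Y u $ k))" using g[of Y] Y(1) by auto
      ultimately show ?thesis by simp
    qed
    have "((\<lambda>s. - g s) has_real_derivative 0) (at s within {0..})" if "0 \<le> s" for s
      using DERIV_minus[OF g'[OF that]] by simp
    then have "g t \<le> g 0" "- g t \<le> - g 0"
      using nonincreasing_halfline[of g "\<lambda>_. 0" 0 0 t] nonincreasing_halfline[of "\<lambda>t. - g t" "\<lambda>_. 0" 0 0 t]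
        g' t by auto
    moreover have "g 0 = 1" using g[of X 0] x0 by simp
    ultimately have "cos (X t $ k - rep_torus (x t) $ k) = 1" by (simp add: g_def)
    then obtain m :: int where "X t $ k - rep_torus (x t) $ k = of_int m * 2 * pi"
      unfolding cos_one_2pi_int by blast
    then show ?thesis by (intro exI[of _ m]) simp
  qed
  then have "abs_torus (X t) = abs_torus (rep_torus (x t))"
    unfolding abs_torus_eq_iff torus_rel_def by blast
  then show ?thesis using Quotient_abs_rep[OF Quotient_torus] by simp
qed

lemma has_vector_derivative_vec:
  fixes f :: "real \<Rightarrow> 'a::euclidean_space ^ 'N::finite"
  assumes "\<And>i. ((\<lambda>t. f t $ i) has_vector_derivative f' $ i) F"
  shows "(f has_vector_derivative f') F"
proof -
  have bl: "bounded_linear (\<lambda>y::'a. axis i y :: 'a ^ 'N)" for i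
    unfolding linear_conv_bounded_linear[symmetric]
    by (rule linearI) (auto simp: axis_def vec_eq_iff)
  have sum: "(\<Sum>i\<in>UNIV. axis i (v $ i)) = v" for v :: "'a ^ 'N"
    by (simp add: vec_eq_iff axis_def)
  have "((\<lambda>t. \<Sum>i\<in>UNIV. axis i (f t $ i)) has_vector_derivative (\<Sum>i\<in>UNIV. axis i (f' $ i))) F"
    by (intro has_vector_derivative_sum bounded_linear.has_vector_derivative[OF bl] assms)
  then show ?thesis by (simp only: sum)
qed

text \<open>A negligible preimage is Lebesgue measurable, so \<open>A\<close> belongs to the family
  that generates the sigma-algebra.\<close>

lemma negligible_null_sets_phase:
  assumes "negligible (phase_proj -` A \<inter> phase_cell)"
  shows "A \<in> null_sets lebesgue_phase"
proof -
  let ?\<Sigma> = "{A. phase_proj -` A \<inter> phase_cell \<in> sets lebesgue}"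
  have cell: "phase_cell \<in> sets lebesgue" using phase_cell_borel by (intro sets_completionI_sets) simp
  then have cell': "phase_cell \<inter> space lebesgue \<in> sets lebesgue" by simp
  have A: "A \<in> sets (sigma UNIV ?\<Sigma>)"
    using negligible_imp_sets[OF assms] by (auto simp: sets_measure_of)
  have meas: "phase_proj \<in> measurable (lebesgue_on phase_cell) (sigma UNIV ?\<Sigma>)"
    by (rule measurable_measure_of) (use cell in \<open>auto simp: sets_restrict_space_iff[OF cell']\<close>)
  have "emeasure lebesgue_phase A = emeasure (lebesgue_on phase_cell) (phase_proj -` A \<inter> phase_cell)"
    unfolding lebesgue_phase_def by (subst emeasure_distr[OF meas A]) simp
  also have "\<dots> = emeasure lebesgue (phase_proj -` A \<inter> phase_cell)"
    by (rule emeasure_restrict_space) (use cell in auto)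
  also have "\<dots> = 0" using assms by (simp add: negligible_iff_null_sets null_setsD1)
  finally show ?thesis using A by (auto simp: null_sets_def lebesgue_phase_def)
qed

text \<open>The lifts in \<open>has_torus_derivative\<close> depend on the time and need not fit
  together. A global lift is obtained by integrating the velocity from \<open>X0\<close>, and
  \<open>torus_lift_unique\<close> shows that it projects to \<open>x\<close>.\<close>

lemma (in periodic_kernel) lifted_solution_exists:
  fixes x :: "real \<Rightarrow> 'n torus ^ 'N::finite" and X0 :: "(real ^ 'n) ^ 'N"
  assumes \<Phi>: "\<Phi> = (\<lambda>X. \<phi> (abs_torus X))"
    and sol: "cucker_smale_solution \<phi> x v" and x0: "\<And>i. abs_torus (X0 $ i) = x 0 $ i"
  shows "\<exists>X. X 0 = X0 \<and> lifted_solution X v"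
proof -
  have comp: "((\<lambda>s. v s $ i) has_vector_derivative (1 / real CARD('N)) *\<^sub>R
      (\<Sum>j\<in>UNIV. \<phi> (x t $ i - x t $ j) *\<^sub>R (v t $ j - v t $ i))) (at t within {0..})" if "0 \<le> t" for t i
    using sol that unfolding cucker_smale_solution_def by blast
  have xd: "has_torus_derivative (\<lambda>s. x s $ i) (v t $ i) t {0..}" if "0 \<le> t" for t i
    using sol that unfolding cucker_smale_solution_def by blast
  have v': "(v has_vector_derivative (\<chi> i. (1 / real CARD('N)) *\<^sub>R
      (\<Sum>j\<in>UNIV. \<phi> (x t $ i - x t $ j) *\<^sub>R (v t $ j - v t $ i)))) (at t within {0..})" if "0 \<le> t" for t
    by (rule has_vector_derivative_vec) (simp only: vec_lambda_beta comp[OF that])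
  have cont: "continuous_on {0..} v"
    using v' by (auto simp: continuous_on_eq_continuous_within intro!: has_vector_derivative_continuous)
  define X where "X t = X0 + integral {0..t} v" for t
  have X': "(X has_vector_derivative v t) (at t within {0..})" if "0 \<le> t" for t
    using has_vector_derivative_add[OF has_vector_derivative_const has_vector_derivative_integral_halfline[OF cont that], of X0]
    by (simp add: X_def[abs_def])
  have lift: "abs_torus (X t $ i) = x t $ i" if "0 \<le> t" for t i
  proof (rule torus_lift_unique[where x = "\<lambda>s. x s $ i" and X = "\<lambda>s. X s $ i", OF xd _ _ that])
    show "((\<lambda>s. X s $ i) has_vector_derivative v t $ i) (at t within {0..})" if "0 \<le> t" for t
      by (rule bounded_linear.has_vector_derivative[OF bounded_linear_vec_nth X'[OF that]])
    show "abs_torus (X 0 $ i) = x 0 $ i" by (simp add: X_def x0)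
  qed
  have "\<phi> (x t $ i - x t $ j) = \<Phi> (X t $ i - X t $ j)" if "0 \<le> t" for t i j
    by (simp add: \<Phi> lift[OF that, symmetric] minus_torus.abs_eq)
  then have "lifted_solution X v"
    unfolding lifted_solution_def accel_def using X' v' by simp
  moreover have "X 0 = X0" by (simp add: X_def)
  ultimately show ?thesis by blast
qed

theorem theorem1p4:
  fixes \<phi> :: "'n::finite torus \<Rightarrow> real" and r0 :: real
  assumes "r0 > 0"
    and "strictly_local_kernel r0 \<phi>"
    and "CARD('N::finite) \<ge> 2"
  shows "(AE (x0, v0) in (lebesgue_phase :: (('n torus ^ 'N) \<times> ((real ^ 'n) ^ 'N)) measure).
            \<forall>x v. cucker_smale_solution \<phi> x v \<and> x 0 = x0 \<and> v 0 = v0 \<longrightarrow>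
              (\<exists>i j. i \<noteq> j \<and> ((\<lambda>t. norm (v t $ i - v t $ j)) \<longlongrightarrow> 0) at_top)) \<and>
         (CARD('N) = 2 \<longrightarrow>
           (AE (x0, v0) in (lebesgue_phase :: (('n torus ^ 'N) \<times> ((real ^ 'n) ^ 'N)) measure).
             \<forall>x v. cucker_smale_solution \<phi> x v \<and> x 0 = x0 \<and> v 0 = v0 \<longrightarrow>
               (\<forall>i j. i \<noteq> j \<longrightarrow> ((\<lambda>t. norm (v t $ i - v t $ j)) \<longlongrightarrow> 0) at_top)))"
proof -
  obtain \<Lambda> H where "periodic_kernel (\<lambda>X. \<phi> (abs_torus X)) \<Lambda> H"
    using strictly_local_kernel_periodic[OF assms(1,2)] by blast
  then interpret periodic_kernel "\<lambda>X. \<phi> (abs_torus X)" \<Lambda> H .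
  \<comment> \<open>A datum counts as bad as soon as one of the solutions starting there has no
    aligning pair.\<close>
  define bad :: "(('n torus ^ 'N) \<times> ((real ^ 'n) ^ 'N)) set" where
    "bad = {(x0, v0). \<exists>x v. cucker_smale_solution \<phi> x v \<and> x 0 = x0 \<and> v 0 = v0 \<and>
      \<not> (\<exists>i j. i \<noteq> j \<and> ((\<lambda>t. norm (v t $ i - v t $ j)) \<longlongrightarrow> 0) at_top)}"
  have "phase_proj -` bad \<inter> phase_cell \<subseteq> phase_cell \<inter> spread_data"
  proof
    fix z assume z: "z \<in> phase_proj -` bad \<inter> phase_cell"
    obtain x0 v0 where p: "phase_proj z = (x0, v0)" by (cases "phase_proj z")
    then have "(x0, v0) \<in> bad" using z by auto
    then obtain x v where sol: "cucker_smale_solution \<phi> x v" and "x 0 = x0" "v 0 = v0"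
      and spread: "\<And>i j. i \<noteq> j \<Longrightarrow> \<not> ((\<lambda>t. norm (v t $ i - v t $ j)) \<longlongrightarrow> 0) at_top"
      unfolding bad_def by blast
    then have 0: "(x 0, v 0) = phase_proj z" using p by simp
    have "abs_torus (fst z $ i) = x 0 $ i" for i
      using 0 by (cases z) (simp add: phase_proj_def)
    then obtain X where X: "X 0 = fst z" "lifted_solution X v"
      using lifted_solution_exists[OF refl sol] by blast
    have v0: "v 0 = snd z" using 0 by (cases z) (simp add: phase_proj_def)
    obtain w where w: "(v \<longlongrightarrow> w) at_top" using V_converges[OF X(2)] by blast
    \<comment> \<open>Two agents with equal limit velocities would align, so along such a solution
      the limits are pairwise distinct.\<close>
    have "w $ i \<noteq> w $ j" if "i \<noteq> j" for i j
    proof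
      assume "w $ i = w $ j"
      moreover have "((\<lambda>t. norm (v t $ i - v t $ j)) \<longlongrightarrow> norm (w $ i - w $ j)) at_top"
        by (intro tendsto_intros w)
      ultimately show False using spread[OF that] by simp
    qed
    moreover have "(X 0, v 0) = z" using X v0 by simp
    ultimately show "z \<in> phase_cell \<inter> spread_data"
      using z X(2) w unfolding spread_data_def by blast
  qed
  then have "negligible (phase_proj -` bad \<inter> phase_cell)"
    using negligible_spread_data[OF assms(3)] negligible_subset by blast
  then have "bad \<in> null_sets lebesgue_phase" by (rule negligible_null_sets_phase)
  then have AE: "AE (x0, v0) in (lebesgue_phase :: (('n torus ^ 'N) \<times> ((real ^ 'n) ^ 'N)) measure).
    \<forall>x v. cucker_smale_solution \<phi> x v \<and> x 0 = x0 \<and> v 0 = v0 \<longrightarrow>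
      (\<exists>i j. i \<noteq> j \<and> ((\<lambda>t. norm (v t $ i - v t $ j)) \<longlongrightarrow> 0) at_top)"
    by (rule AE_I') (auto simp: bad_def)
  moreover have "AE (x0, v0) in (lebesgue_phase :: (('n torus ^ 'N) \<times> ((real ^ 'n) ^ 'N)) measure).
    \<forall>x v. cucker_smale_solution \<phi> x v \<and> x 0 = x0 \<and> v 0 = v0 \<longrightarrow>
      (\<forall>i j. i \<noteq> j \<longrightarrow> ((\<lambda>t. norm (v t $ i - v t $ j)) \<longlongrightarrow> 0) at_top)" if N2: "CARD('N) = 2"
  proof -
    have pair: "((\<lambda>t. norm (v t $ i - v t $ j)) \<longlongrightarrow> 0) at_top"
      if ex: "\<exists>i j. i \<noteq> j \<and> ((\<lambda>t. norm (v t $ i - v t $ j)) \<longlongrightarrow> 0) at_top" and ij: "i \<noteq> j"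
      for v :: "real \<Rightarrow> (real ^ 'n) ^ 'N" and i j
    proof -
      obtain k l where kl: "k \<noteq> l" and lim: "((\<lambda>t. norm (v t $ k - v t $ l)) \<longlongrightarrow> 0) at_top"
        using ex by blast
      have "{i, j} = UNIV" using ij N2 by (intro card_subset_eq) auto
      then have "k \<in> {i, j}" "l \<in> {i, j}" by simp_all
      with kl have "k = i \<and> l = j \<or> k = j \<and> l = i" by auto
      then have "(\<lambda>t. norm (v t $ i - v t $ j)) = (\<lambda>t. norm (v t $ k - v t $ l))"
        by (elim disjE) (simp_all add: norm_minus_commute)
      then show ?thesis using lim by simp
    qed
    show ?thesis
    proof (rule eventually_mono[OF AE], clarify)
      fix x :: "real \<Rightarrow> 'n torus ^ 'N" and v :: "real \<Rightarrow> (real ^ 'n) ^ 'N" and i j :: 'N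
      assume "\<forall>x' v'. cucker_smale_solution \<phi> x' v' \<and> x' 0 = x 0 \<and> v' 0 = v 0 \<longrightarrow>
          (\<exists>i j. i \<noteq> j \<and> ((\<lambda>t. norm (v' t $ i - v' t $ j)) \<longlongrightarrow> 0) at_top)"
        and sol: "cucker_smale_solution \<phi> x v" and ij: "i \<noteq> j"
      then have "\<exists>i j. i \<noteq> j \<and> ((\<lambda>t. norm (v t $ i - v t $ j)) \<longlongrightarrow> 0) at_top" by blast
      then show "((\<lambda>t. norm (v t $ i - v t $ j)) \<longlongrightarrow> 0) at_top" using ij by (rule pair)
    qed
  qed
  ultimately show ?thesis by blast
qed

end
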